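(* Let $n\ge1$ be an integer, let $\Gamma$ be a group of type $F_{n+1}$, and suppose that $\mathcal{SC}_n=\ker D_{n-1}$. The following conditions are equivalent: (1) $H^n(\Gamma,\pi)=0$ for every unitary representation $(\pi,\mathcal{H})$ of $\Gamma$. (2) Every positive hermitian functional $\phi:\operatorname{im}D_{n-1}\to\mathbb{R}$ can be extended to a positive hermitian functional $\overline{\phi}:\mathbb{M}_{k_{n-1}}(\mathbb{R}\Gamma)\to\mathbb{R}$.
   Context: $\mathbb{R}\Gamma$ is the real group algebra with involution $(\sum a_\gamma\gamma)^*=\sum a_\gamma\gamma^{-1}$; $\mathbb{M}_{k\times l}(\mathbb{R}\Gamma)$ denotes $k\times l$ matrices over $\mathbb{R}\Gamma$, $\mathbb{M}_k=\mathbb{M}_{k\times k}$, and for a matrix $x$, $x^*$ is the transpose of $x$ with the involution applied to each entry. $\Sigma^2\mathbb{M}_k(\mathbb{R}\Gamma)$ is the set of finite sums $\sum_i a_i^*a_i$ with $a_i\in\mathbb{M}_k(\mathbb{R}\Gamma)$. Finiteness: $\Gamma$ is of type $F_m$ if it acts freely by simplicial automorphisms on a locally finite contractible simplicial complex $X$ such that, for every $n\le m$, the set $X^{(n)}$ of $n$-simplices has a finite number $k_n$ of $\Gamma$-orbits. Fix such an $X$ (with $m=n+1$). Codifferentials: fix a $\Gamma$-invariant orientation of the simplices of $X$ and representatives $\tau^n_1,\dots,\tau^n_{k_n}$ of the $\Gamma$-orbits in $X^{(n)}$. Writing the simplicial boundary as $\partial\tau^{n+1}_i=\sum_{j}\sum_{\gamma\in\Gamma}\varepsilon_{ij}(\gamma)\,\gamma\tau^n_j$,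 let $d_n\in\mathbb{M}_{k_{n+1}\times k_n}(\mathbb{R}\Gamma)$ be the matrix with entries $(d_n)_{ij}=\sum_\gamma\varepsilon_{ij}(\gamma)\gamma$. Then $d_nd_{n-1}=0$. Define $D_n:\mathbb{M}_{k_{n+1}}(\mathbb{R}\Gamma)\to\mathbb{M}_{k_n}(\mathbb{R}\Gamma)$ by $D_n(a)=d_n^*ad_n$, and the split conjugation space $$\mathcal{SC}_n=\{d_n^*x+yd_n:\ x\in\mathbb{M}_{k_{n+1}\times k_n}(\mathbb{R}\Gamma),\ y\in\mathbb{M}_{k_n\times k_{n+1}}(\mathbb{R}\Gamma)\}\subseteq\mathbb{M}_{k_n}(\mathbb{R}\Gamma).$$ Functionals: a linear functional $\phi$ on a $*$-invariant linear subspace $V\subseteq\mathbb{M}_k(\mathbb{R}\Gamma)$ is hermitian if $\phi(a^* )=\phi(a)$ for all $a\in V$, and positive if $\phi(a)\ge0$ for all $a\in V\cap\Sigma^2\mathbb{M}_k(\mathbb{R}\Gamma)$. Cohomology: for a unitary representation $(\pi,\mathcal{H})$ of $\Gamma$ on a Hilbert space, extend $\pi$ linearly to $\mathbb{R}\Gamma$ and apply it entrywise to matrices, so $\pi(d_n):\mathcal{H}^{k_n}\to\mathcal{H}^{k_{n+1}}$. Group cohomology is $H^n(\Gamma,\pi)=\ker\pi(d_n)/\operatorname{im}\pi(d_{n-1})$. *)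

theory Defs
  imports
    "HOL-Analysis.Homotopy"
    "HOL-Analysis.Function_Topology"
    "HOL-Library.Poly_Mapping"
    "HOL-Library.Equipollence"
    "HOL-Combinatorics.Permutations"
    "HOL-Algebra.Product_Groups"
    "HOL-Algebra.Elementary_Groups"
    "Jordan_Normal_Form.Matrix"
    "Jordan_Normal_Form.VS_Connect"
begin

section \<open>Matrices over the real group algebra\<close>

text \<open>
  The group is the type \<open>'g :: group_add\<close>, which need not be commutative: the group operation
  is written \<open>g + h\<close>, the unit \<open>0\<close> and the inverse \<open>- g\<close>.  The product on \<open>'g \<Rightarrow>\<^sub>0 real\<close> is
  convolution, so this ring is the real group algebra, and \<open>single g r\<close> is \<open>r\<close> times the group
  element \<open>g\<close>.
\<close>

type_synonym 'g group_algebra = "'g \<Rightarrow>\<^sub>0 real"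

definition star :: "'g::group_add group_algebra \<Rightarrow> 'g group_algebra" where
  "star a = (\<Sum>g\<in>Poly_Mapping.keys a. Poly_Mapping.single (- g) (Poly_Mapping.lookup a g))"

definition star_mat :: "'g::group_add group_algebra mat \<Rightarrow> 'g group_algebra mat" where
  "star_mat A = map_mat star (transpose_mat A)"

definition scaleR_mat :: "real \<Rightarrow> 'g::group_add group_algebra mat \<Rightarrow> 'g group_algebra mat" where
  "scaleR_mat r A = Poly_Mapping.single 0 r \<cdot>\<^sub>m A"

definition sum_squares :: "nat \<Rightarrow> 'g::group_add group_algebra mat set" where
  "sum_squares k = {foldr (+) (map (\<lambda>a. star_mat a * a) as) (0\<^sub>m k k) | as. set as \<subseteq> carrier_mat k k}"

definition conj_map :: "'g::group_add group_algebra mat \<Rightarrow> 'g group_algebra mat \<Rightarrow> 'g group_algebra mat" where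
  "conj_map d a = star_mat d * a * d"

definition split_conj_space :: "'g::group_add group_algebra mat \<Rightarrow> 'g group_algebra mat set" where
  "split_conj_space d =
     {star_mat d * x + y * d | x y.
        x \<in> carrier_mat (dim_row d) (dim_col d) \<and> y \<in> carrier_mat (dim_col d) (dim_row d)}"

text \<open>Functionals on a subspace \<open>V\<close> of the \<open>k \<times> k\<close> matrices; their values outside \<open>V\<close> are irrelevant.\<close>

definition linear_functional ::
    "'g::group_add group_algebra mat set \<Rightarrow> ('g group_algebra mat \<Rightarrow> real) \<Rightarrow> bool" where
  "linear_functional V \<phi> \<longleftrightarrow>
     (\<forall>a\<in>V. \<forall>b\<in>V. \<phi> (a + b) = \<phi> a + \<phi> b) \<and> (\<forall>r. \<forall>a\<in>V. \<phi> (scaleR_mat r a) = r * \<phi> a)"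

definition hermitian_functional ::
    "'g::group_add group_algebra mat set \<Rightarrow> ('g group_algebra mat \<Rightarrow> real) \<Rightarrow> bool" where
  "hermitian_functional V \<phi> \<longleftrightarrow> (\<forall>a\<in>V. \<phi> (star_mat a) = \<phi> a)"

definition positive_functional ::
    "nat \<Rightarrow> 'g::group_add group_algebra mat set \<Rightarrow> ('g group_algebra mat \<Rightarrow> real) \<Rightarrow> bool" where
  "positive_functional k V \<phi> \<longleftrightarrow> (\<forall>a \<in> V \<inter> sum_squares k. 0 \<le> \<phi> a)"

definition positive_hermitian_functional ::
    "nat \<Rightarrow> 'g::group_add group_algebra mat set \<Rightarrow> ('g group_algebra mat \<Rightarrow> real) \<Rightarrow> bool" where
  "positive_hermitian_functional k V \<phi> \<longleftrightarrow>
     linear_functional V \<phi> \<and> hermitian_functional V \<phi> \<and> positive_functional k V \<phi>"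


section \<open>Simplicial complexes and group actions of finite type\<close>

text \<open>An abstract simplicial complex is the set of its (nonempty, finite) simplices; the vertex set
  is \<open>\<Union>X\<close>.\<close>

definition abstract_complex :: "'v set set \<Rightarrow> bool" where
  "abstract_complex X \<longleftrightarrow>
     (\<forall>\<sigma>\<in>X. finite \<sigma> \<and> \<sigma> \<noteq> {}) \<and> (\<forall>\<sigma>\<in>X. \<forall>\<rho>. \<rho> \<subseteq> \<sigma> \<and> \<rho> \<noteq> {} \<longrightarrow> \<rho> \<in> X)"

definition locally_finite_complex :: "'v set set \<Rightarrow> bool" where
  "locally_finite_complex X \<longleftrightarrow> (\<forall>v\<in>\<Union>X. finite {\<sigma>\<in>X. v \<in> \<sigma>})"

definition simplices :: "'v set set \<Rightarrow> nat \<Rightarrow> 'v set set" where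
  "simplices X m = {\<sigma>\<in>X. card \<sigma> = Suc m}"

text \<open>The closed geometric simplex spanned by \<open>\<sigma>\<close>, in barycentric coordinates.\<close>

definition geometric_simplex :: "'v set \<Rightarrow> ('v \<Rightarrow> real) set" where
  "geometric_simplex \<sigma> = {p. (\<forall>v. 0 \<le> p v) \<and> (\<forall>v. v \<notin> \<sigma> \<longrightarrow> p v = 0) \<and> sum p \<sigma> = 1}"

text \<open>The geometric realization carries the weak topology: a set is open iff its intersection with
  every closed simplex is open in that simplex.\<close>

definition geometric_realization :: "'v set set \<Rightarrow> ('v \<Rightarrow> real) topology" where
  "geometric_realization X = topology (\<lambda>U. U \<subseteq> (\<Union>\<sigma>\<in>X. geometric_simplex \<sigma>) \<and>
     (\<forall>\<sigma>\<in>X. openin (subtopology (powertop_real UNIV) (geometric_simplex \<sigma>)) (U \<inter> geometric_simplex \<sigma>)))"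

lemma openin_geometric_realization:
  "openin (geometric_realization X) U \<longleftrightarrow> U \<subseteq> (\<Union>\<sigma>\<in>X. geometric_simplex \<sigma>) \<and>
     (\<forall>\<sigma>\<in>X. openin (subtopology (powertop_real UNIV) (geometric_simplex \<sigma>)) (U \<inter> geometric_simplex \<sigma>))"
proof -
  let ?T = "\<lambda>\<sigma>. subtopology (powertop_real UNIV) (geometric_simplex \<sigma>)"
  let ?P = "\<lambda>U. U \<subseteq> (\<Union>\<sigma>\<in>X. geometric_simplex \<sigma>) \<and> (\<forall>\<sigma>\<in>X. openin (?T \<sigma>) (U \<inter> geometric_simplex \<sigma>))"
  have inter: "S \<inter> T \<inter> G = (S \<inter> G) \<inter> (T \<inter> G)" and union: "\<Union>\<K> \<inter> G = (\<Union>U\<in>\<K>. U \<inter> G)"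
    for S T G :: "('a \<Rightarrow> real) set" and \<K>
    by blast+
  have "istopology ?P"
    unfolding istopology_def
  proof (intro conjI allI impI)
    fix S T assume S: "?P S" and T: "?P T"
    show "S \<inter> T \<subseteq> (\<Union>\<sigma>\<in>X. geometric_simplex \<sigma>)" using S by blast
    show "\<forall>\<sigma>\<in>X. openin (?T \<sigma>) (S \<inter> T \<inter> geometric_simplex \<sigma>)"
    proof
      fix \<sigma> assume "\<sigma> \<in> X"
      then have "openin (?T \<sigma>) (S \<inter> geometric_simplex \<sigma>)" "openin (?T \<sigma>) (T \<inter> geometric_simplex \<sigma>)"
        using S T by blast+
      then have "openin (?T \<sigma>) ((S \<inter> geometric_simplex \<sigma>) \<inter> (T \<inter> geometric_simplex \<sigma>))"
        by (rule openin_Int)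
      then show "openin (?T \<sigma>) (S \<inter> T \<inter> geometric_simplex \<sigma>)"
        by (subst inter)
    qed
  next
    fix \<K> assume K: "\<forall>U\<in>\<K>. ?P U"
    show "\<Union>\<K> \<subseteq> (\<Union>\<sigma>\<in>X. geometric_simplex \<sigma>)" using K by blast
    show "\<forall>\<sigma>\<in>X. openin (?T \<sigma>) (\<Union>\<K> \<inter> geometric_simplex \<sigma>)"
    proof
      fix \<sigma> assume "\<sigma> \<in> X"
      then have "openin (?T \<sigma>) (\<Union>U\<in>\<K>. U \<inter> geometric_simplex \<sigma>)"
        using K by (intro openin_Union) blast
      then show "openin (?T \<sigma>) (\<Union>\<K> \<inter> geometric_simplex \<sigma>)"
        by (subst union)
    qed
  qed
  then show ?thesis
    unfolding geometric_realization_def by (simp only: topology_inverse')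
qed

definition simplicial_action :: "'v set set \<Rightarrow> ('g::group_add \<Rightarrow> 'v \<Rightarrow> 'v) \<Rightarrow> bool" where
  "simplicial_action X act \<longleftrightarrow>
     (\<forall>v\<in>\<Union>X. act 0 v = v) \<and> (\<forall>g h. \<forall>v\<in>\<Union>X. act (g + h) v = act g (act h v)) \<and>
     (\<forall>g. \<forall>\<sigma>\<in>X. act g ` \<sigma> \<in> X)"

text \<open>No nontrivial element maps a simplex to itself, not even while permuting its vertices (it would
  fix the barycenter).\<close>

definition free_action :: "'v set set \<Rightarrow> ('g::group_add \<Rightarrow> 'v \<Rightarrow> 'v) \<Rightarrow> bool" where
  "free_action X act \<longleftrightarrow> (\<forall>g. \<forall>\<sigma>\<in>X. act g ` \<sigma> = \<sigma> \<longrightarrow> g = 0)"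

definition simplex_orbit :: "('g \<Rightarrow> 'v \<Rightarrow> 'v) \<Rightarrow> 'v set \<Rightarrow> 'v set set" where
  "simplex_orbit act \<sigma> = range (\<lambda>g. act g ` \<sigma>)"

definition simplex_orbits :: "'v set set \<Rightarrow> ('g \<Rightarrow> 'v \<Rightarrow> 'v) \<Rightarrow> nat \<Rightarrow> 'v set set set" where
  "simplex_orbits X act m = simplex_orbit act ` simplices X m"

definition num_orbits :: "'v set set \<Rightarrow> ('g \<Rightarrow> 'v \<Rightarrow> 'v) \<Rightarrow> nat \<Rightarrow> nat" where
  "num_orbits X act m = card (simplex_orbits X act m)"

text \<open>\<open>X\<close> with the action \<open>act\<close> witnesses that the group is of type \<open>F\<^sub>m\<close>.  Nonemptiness is stated
  separately because \<open>contractible_space\<close> holds for the empty space.\<close>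

definition type_F_complex :: "nat \<Rightarrow> 'v set set \<Rightarrow> ('g::group_add \<Rightarrow> 'v \<Rightarrow> 'v) \<Rightarrow> bool" where
  "type_F_complex m X act \<longleftrightarrow>
     abstract_complex X \<and> X \<noteq> {} \<and> locally_finite_complex X \<and>
     contractible_space (geometric_realization X) \<and>
     simplicial_action X act \<and> free_action X act \<and>
     (\<forall>i\<le>m. finite (simplex_orbits X act i))"


section \<open>Orientations and codifferentials\<close>

text \<open>An orientation of a simplex is a class of orderings of its vertices modulo even permutations.\<close>

definition even_reordering :: "'v list \<Rightarrow> 'v list \<Rightarrow> bool" where
  "even_reordering xs ys \<longleftrightarrow>
     (\<exists>p. p permutes {..<length xs} \<and> evenperm p \<and> ys = permute_list p xs)"

definition invariant_orientation ::
    "'v set set \<Rightarrow> ('g \<Rightarrow> 'v \<Rightarrow> 'v) \<Rightarrow> ('v set \<Rightarrow> 'v list set) \<Rightarrow> bool" where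
  "invariant_orientation X act ori \<longleftrightarrow>
     (\<forall>\<sigma>\<in>X. \<exists>xs. distinct xs \<and> set xs = \<sigma> \<and> ori \<sigma> = {ys. even_reordering xs ys}) \<and>
     (\<forall>g. \<forall>\<sigma>\<in>X. ori (act g ` \<sigma>) = map (act g) ` ori \<sigma>)"

definition orientation_sign :: "('v set \<Rightarrow> 'v list set) \<Rightarrow> 'v list \<Rightarrow> real" where
  "orientation_sign ori ys = (if ys \<in> ori (set ys) then 1 else - 1)"

text \<open>The boundary \<open>\<Sum>\<^sub>i (-1)\<^sup>i [x\<^sub>0, \<dots>, x\<^sub>i\<^sub>-\<^sub>1, x\<^sub>i\<^sub>+\<^sub>1, \<dots>, x\<^sub>m]\<close> of a simplex \<open>[x\<^sub>0, \<dots>, x\<^sub>m]\<close>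
  ordered compatibly with its orientation, in the basis of oriented simplices.  It does not depend on
  the chosen ordering and is used only for simplices of positive dimension.\<close>

definition simplicial_boundary :: "('v set \<Rightarrow> 'v list set) \<Rightarrow> 'v set \<Rightarrow> ('v set \<Rightarrow>\<^sub>0 real)" where
  "simplicial_boundary ori \<sigma> =
     (let xs = (SOME xs. xs \<in> ori \<sigma>) in
        \<Sum>i<length xs. let ys = take i xs @ drop (Suc i) xs in
          Poly_Mapping.single (set ys) ((- 1) ^ i * orientation_sign ori ys))"

definition orbit_representatives ::
    "'v set set \<Rightarrow> ('g \<Rightarrow> 'v \<Rightarrow> 'v) \<Rightarrow> nat \<Rightarrow> (nat \<Rightarrow> 'v set) \<Rightarrow> bool" where
  "orbit_representatives X act m t \<longleftrightarrow>
     (\<forall>i < num_orbits X act m. t i \<in> simplices X m) \<and>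
     bij_betw (\<lambda>i. simplex_orbit act (t i)) {..<num_orbits X act m} (simplex_orbits X act m)"

text \<open>\<open>\<tau> m i\<close> is the \<open>i\<close>-th representative in dimension \<open>m\<close>, counted from \<open>0\<close>.  For a free action only
  finitely many \<open>g\<close> contribute to \<open>codifferential_entry\<close>.\<close>

definition codifferential_entry ::
    "('g::group_add \<Rightarrow> 'v \<Rightarrow> 'v) \<Rightarrow> ('v set \<Rightarrow> 'v list set) \<Rightarrow> 'v set \<Rightarrow> 'v set \<Rightarrow> 'g group_algebra" where
  "codifferential_entry act ori \<sigma> \<rho> =
     (let \<epsilon> = (\<lambda>g. Poly_Mapping.lookup (simplicial_boundary ori \<sigma>) (act g ` \<rho>)) in
        \<Sum>g | \<epsilon> g \<noteq> 0. Poly_Mapping.single g (\<epsilon> g))"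

definition codifferential ::
    "'v set set \<Rightarrow> ('g::group_add \<Rightarrow> 'v \<Rightarrow> 'v) \<Rightarrow> ('v set \<Rightarrow> 'v list set) \<Rightarrow> (nat \<Rightarrow> nat \<Rightarrow> 'v set)
      \<Rightarrow> nat \<Rightarrow> 'g group_algebra mat" where
  "codifferential X act ori \<tau> m =
     mat (num_orbits X act (Suc m)) (num_orbits X act m)
       (\<lambda>(i, j). codifferential_entry act ori (\<tau> (Suc m) i) (\<tau> m j))"


section \<open>Unitary representations and cohomology\<close>

text \<open>Hilbert spaces are carrier based, so that one can quantify over them inside a formula.  The
  additive part of the inherited \<open>ring\<close> record is the vector addition; its multiplicative part is
  unused, as always for \<open>module\<close>.\<close>

record 'h hilbert = "(complex, 'h) module" +
  hinner :: "'h \<Rightarrow> 'h \<Rightarrow> complex"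

definition hnorm :: "'h hilbert \<Rightarrow> 'h \<Rightarrow> real" where
  "hnorm H x = sqrt (Re (hinner H x x))"

locale hilbert_space = module "class_ring :: complex ring" H for H :: "'h hilbert" (structure) +
  assumes hinner_add: "\<lbrakk>x \<in> carrier H; y \<in> carrier H; z \<in> carrier H\<rbrakk>
      \<Longrightarrow> hinner H (x \<oplus>\<^bsub>H\<^esub> y) z = hinner H x z + hinner H y z"
    and hinner_smult: "\<lbrakk>x \<in> carrier H; y \<in> carrier H\<rbrakk>
      \<Longrightarrow> hinner H (c \<odot>\<^bsub>H\<^esub> x) y = c * hinner H x y"
    and hinner_cnj: "\<lbrakk>x \<in> carrier H; y \<in> carrier H\<rbrakk> \<Longrightarrow> hinner H y x = cnj (hinner H x y)"
    and hinner_nonneg: "x \<in> carrier H \<Longrightarrow> 0 \<le> Re (hinner H x x)"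
    and hinner_definite: "\<lbrakk>x \<in> carrier H; hinner H x x = 0\<rbrakk> \<Longrightarrow> x = \<zero>\<^bsub>H\<^esub>"
    and complete: "\<lbrakk>\<And>i. s i \<in> carrier H;
        \<And>e. e > 0 \<Longrightarrow> \<exists>N. \<forall>i\<ge>N. \<forall>j\<ge>N. hnorm H (s i \<ominus>\<^bsub>H\<^esub> s j) < e\<rbrakk>
      \<Longrightarrow> \<exists>x\<in>carrier H. (\<lambda>i. hnorm H (s i \<ominus>\<^bsub>H\<^esub> x)) \<longlonglongrightarrow> 0"

definition unitary_operator :: "'h hilbert \<Rightarrow> ('h \<Rightarrow> 'h) \<Rightarrow> bool" where
  "unitary_operator H U \<longleftrightarrow>
     bij_betw U (carrier H) (carrier H) \<and>
     (\<forall>x\<in>carrier H. \<forall>y\<in>carrier H. U (x \<oplus>\<^bsub>H\<^esub> y) = U x \<oplus>\<^bsub>H\<^esub> U y) \<and>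
     (\<forall>c. \<forall>x\<in>carrier H. U (c \<odot>\<^bsub>H\<^esub> x) = c \<odot>\<^bsub>H\<^esub> U x) \<and>
     (\<forall>x\<in>carrier H. \<forall>y\<in>carrier H. hinner H (U x) (U y) = hinner H x y)"

definition unitary_representation :: "'h hilbert \<Rightarrow> ('g::group_add \<Rightarrow> 'h \<Rightarrow> 'h) \<Rightarrow> bool" where
  "unitary_representation H \<pi> \<longleftrightarrow>
     hilbert_space H \<and> (\<forall>g. unitary_operator H (\<pi> g)) \<and>
     (\<forall>g h. \<forall>x\<in>carrier H. \<pi> (g + h) x = \<pi> g (\<pi> h x))"

definition rep_algebra ::
    "'h hilbert \<Rightarrow> ('g::group_add \<Rightarrow> 'h \<Rightarrow> 'h) \<Rightarrow> 'g group_algebra \<Rightarrow> 'h \<Rightarrow> 'h" where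
  "rep_algebra H \<pi> a x =
     finsum H (\<lambda>g. complex_of_real (Poly_Mapping.lookup a g) \<odot>\<^bsub>H\<^esub> \<pi> g x) (Poly_Mapping.keys a)"

definition hilbert_power :: "'h hilbert \<Rightarrow> nat \<Rightarrow> (nat \<Rightarrow> 'h) monoid" where
  "hilbert_power H k = product_group {..<k} (\<lambda>_. add_monoid H)"

definition rep_mat ::
    "'h hilbert \<Rightarrow> ('g::group_add \<Rightarrow> 'h \<Rightarrow> 'h) \<Rightarrow> 'g group_algebra mat \<Rightarrow> (nat \<Rightarrow> 'h) \<Rightarrow> nat \<Rightarrow> 'h" where
  "rep_mat H \<pi> A \<xi> =
     (\<lambda>i\<in>{..<dim_row A}. finsum H (\<lambda>j. rep_algebra H \<pi> (A $$ (i, j)) (\<xi> j)) {..<dim_col A})"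

text \<open>For \<open>n \<ge> 1\<close>, the quotient of the kernel of \<open>\<pi>(d\<^sub>n)\<close> by the image of \<open>\<pi>(d\<^sub>n\<^sub>-\<^sub>1)\<close>, as an additive group.\<close>

definition group_cohomology ::
    "(nat \<Rightarrow> 'g::group_add group_algebra mat) \<Rightarrow> nat \<Rightarrow> 'h hilbert \<Rightarrow> ('g \<Rightarrow> 'h \<Rightarrow> 'h)
      \<Rightarrow> (nat \<Rightarrow> 'h) set monoid" where
  "group_cohomology d n H \<pi> =
     subgroup_generated (hilbert_power H (dim_col (d n)))
       (kernel (hilbert_power H (dim_col (d n))) (hilbert_power H (dim_row (d n))) (rep_mat H \<pi> (d n)))
     Mod (rep_mat H \<pi> (d (n - 1)) ` carrier (hilbert_power H (dim_col (d (n - 1)))))"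

end

theory Submission
  imports Defs "HOL-Homology.Homology"
begin

text \<open>
  Suppose cohomology vanishes and let \<open>\<phi>\<close> be positive on \<open>im D\<close>, where \<open>D a = d\<^sup>* a d\<close> with
  \<open>d = d\<^sub>n\<^sub>-\<^sub>1\<close>.  The functional \<open>\<phi> \<circ> D\<close> is positive on all matrices, so the GNS construction yields
  \<open>\<phi> (D a) = \<langle>\<pi>(a) \<xi>, \<xi>\<rangle>\<close>.  As \<open>d\<^sub>n\<^sup>* d\<^sub>n\<close> lies in the split conjugation space \<open>ker D\<close>, the vector
  \<open>\<xi>\<close> is a cocycle, hence \<open>\<xi> = \<pi>(d) \<eta>\<close>, and \<open>b \<mapsto> \<langle>\<pi>(b) \<eta>, \<eta>\<rangle>\<close> extends \<open>\<phi>\<close>.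

  Conversely, for a cocycle \<open>\<xi>\<close> the functional \<open>a \<mapsto> \<langle>\<pi>(a) \<xi>, \<xi>\<rangle>\<close> vanishes on the split conjugation
  space \<open>ker D\<close> and so descends to some \<open>\<phi>\<close> on \<open>im D\<close>.  It is positive: if \<open>d\<^sup>* a d = \<Sum> b\<^sup>* b\<close>, then each
  \<open>b\<close> is of the form \<open>c d\<close>.  To see this, apply both sides, in the regular representation on chains, to
  the vector of the boundaries of the orbit representatives, which \<open>d\<close> annihilates; thus the rows of
  \<open>b\<close> are cycles, and they are boundaries because the complex is contractible.  An extension \<open>\<psi>\<close> of
  \<open>\<phi>\<close> and the Cauchy-Schwarz inequality \<open>\<psi>(s\<^sup>* c d)\<^sup>2 \<le> \<psi>(s\<^sup>* s) \<parallel>\<pi>(c) \<xi>\<parallel>\<^sup>2\<close> for rows \<open>s\<close>, \<open>c\<close> turn, by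
  Riesz representation, the functionals \<open>\<pi>(c) \<xi> \<mapsto> \<psi>(e\<^sub>j\<^sup>* c d)\<close> into vectors \<open>\<eta>\<^sub>j\<close> with \<open>\<pi>(d) \<eta> = \<xi>\<close>.

  That a cycle of a contractible complex bounds is reduced to singular homology: a singular simplex
  of a fine subdivision is sent to the simplex spanned by the vertices at which the barycentric
  coordinates of its corners are largest.
\<close>

section \<open>Oriented simplicial chains\<close>

text \<open>Three mismatches shape the development. Singular chains have integer coefficients,
  whereas rows over the real group algebra give real cycles; linear algebra over the rationals
  reduces these to integral ones. The condition on representations ranges over Hilbert spaces with
  carriers in one type \<open>'h\<close>, whereas the vectors of the GNS space are functions; they
  are moved into \<open>'h\<close> along an injection, which exists because local finiteness,
  connectedness and freeness make the group countable. Finally, functionals on matrices over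
  \<real>\<Gamma> are only real linear, so Riesz representation is carried out with real parts of
  inner products, on real subspaces.

  The image of \<pi>(d) need not be closed, so it is not enough to approximate \<xi> by
  coboundaries. The extension supplies bounds by \<open>\<psi>(s\<^sup>* s)\<close>, and with them
  an exact solution.\<close>

definition smul :: "real \<Rightarrow> ('a \<Rightarrow>\<^sub>0 real) \<Rightarrow> ('a \<Rightarrow>\<^sub>0 real)" where
  "smul r p = Poly_Mapping.map ((*) r) p"

text \<open>Over the reals what \<open>frag_extend\<close> is for integer chains.\<close>

definition linear_ext :: "('a \<Rightarrow> ('b \<Rightarrow>\<^sub>0 real)) \<Rightarrow> ('a \<Rightarrow>\<^sub>0 real) \<Rightarrow> ('b \<Rightarrow>\<^sub>0 real)" where
  "linear_ext f c = (\<Sum>x\<in>Poly_Mapping.keys c. smul (Poly_Mapping.lookup c x) (f x))"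

lemma lookup_smul [simp]: "Poly_Mapping.lookup (smul r p) x = r * Poly_Mapping.lookup p x"
  by (simp add: smul_def Poly_Mapping.map.rep_eq when_def)

lemma smul_simps [simp]:
  "smul 0 p = 0" "smul 1 p = p" "smul r 0 = 0" "smul r (smul s p) = smul (r * s) p"
  by (auto intro!: poly_mapping_eqI)

lemma smul_distrib:
  "smul r (p + q) = smul r p + smul r q" "smul (r + s) p = smul r p + smul s p"
  "smul r (p - q) = smul r p - smul r q" "smul (r - s) p = smul r p - smul s p"
  "smul (- r) p = - smul r p" "smul r (- p) = - smul r p"
  by (auto intro!: poly_mapping_eqI simp: lookup_add lookup_minus algebra_simps)

lemma smul_sum: "smul r (sum f A) = (\<Sum>x\<in>A. smul r (f x))"
  by (induction A rule: infinite_finite_induct) (auto simp: smul_distrib)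

lemma smul_single [simp]: "smul r (Poly_Mapping.single x s) = Poly_Mapping.single x (r * s)"
  by (auto intro!: poly_mapping_eqI simp: lookup_single when_def)

lemma keys_smul: "Poly_Mapping.keys (smul r p) \<subseteq> Poly_Mapping.keys p"
  by (auto simp: in_keys_iff)

lemma lookup_linear_ext:
  "Poly_Mapping.lookup (linear_ext f c) y
     = (\<Sum>x\<in>Poly_Mapping.keys c. Poly_Mapping.lookup c x * Poly_Mapping.lookup (f x) y)"
  by (simp add: linear_ext_def lookup_sum)

lemma linear_ext_superset:
  assumes "finite S" "Poly_Mapping.keys c \<subseteq> S"
  shows "linear_ext f c = (\<Sum>x\<in>S. smul (Poly_Mapping.lookup c x) (f x))"
  unfolding linear_ext_def by (rule sum.mono_neutral_left) (use assms in \<open>auto simp: in_keys_iff\<close>)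

lemma linear_ext_0 [simp]: "linear_ext f 0 = 0"
  by (simp add: linear_ext_def)

lemma linear_ext_single [simp]: "linear_ext f (Poly_Mapping.single x r) = smul r (f x)"
  by (cases "r = 0") (simp_all add: linear_ext_def)

lemma linear_ext_add: "linear_ext f (a + b) = linear_ext f a + linear_ext f b"
  unfolding linear_ext_def
  by (rule setsum_keys_plus_distrib[of "\<lambda>x r. smul r (f x)"]) (simp_all add: smul_distrib)

lemma linear_ext_smul: "linear_ext f (smul r a) = smul r (linear_ext f a)"
  by (subst linear_ext_superset[OF finite_keys keys_smul]) (simp add: linear_ext_def smul_sum)

lemma linear_ext_uminus: "linear_ext f (- a) = - linear_ext f a"
  using linear_ext_smul[of f "-1" a] by (simp add: smul_distrib)

lemma linear_ext_diff: "linear_ext f (a - b) = linear_ext f a - linear_ext f b"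
  using linear_ext_add[of f a "- b"] by (simp add: linear_ext_uminus)

lemma linear_ext_sum: "linear_ext f (sum g A) = (\<Sum>x\<in>A. linear_ext f (g x))"
  by (induction A rule: infinite_finite_induct) (auto simp: linear_ext_add)

lemma linear_ext_linear_ext: "linear_ext f (linear_ext g c) = linear_ext (\<lambda>x. linear_ext f (g x)) c"
  by (simp add: linear_ext_def[of g] linear_ext_sum linear_ext_smul) (simp add: linear_ext_def)

lemma linear_ext_cong: "(\<And>x. x \<in> Poly_Mapping.keys c \<Longrightarrow> f x = g x) \<Longrightarrow> linear_ext f c = linear_ext g c"
  by (simp add: linear_ext_def)

lemma linear_ext_ident: "linear_ext (\<lambda>x. Poly_Mapping.single x 1) c = c"
  by (rule poly_mapping_eqI)
     (auto simp: lookup_linear_ext lookup_single when_def if_distrib in_keys_iff cong: if_cong)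

lemma keys_linear_ext: "Poly_Mapping.keys (linear_ext f c) \<subseteq> (\<Union>x\<in>Poly_Mapping.keys c. Poly_Mapping.keys (f x))"
  unfolding linear_ext_def using keys_smul by (intro order.trans[OF keys_sum]) fast


section \<open>Alternating sums over the faces of a list\<close>

primrec alt_sum :: "'v list \<Rightarrow> ('v list \<Rightarrow> ('a \<Rightarrow>\<^sub>0 real)) \<Rightarrow> ('a \<Rightarrow>\<^sub>0 real)" where
  "alt_sum [] G = 0"
| "alt_sum (x # xs) G = G xs - alt_sum xs (\<lambda>ys. G (x # ys))"

definition omit :: "nat \<Rightarrow> 'v list \<Rightarrow> 'v list" where
  "omit i xs = take i xs @ drop (Suc i) xs"

lemma omit_simps [simp]: "omit 0 (x # xs) = xs" "omit (Suc i) (x # xs) = x # omit i xs" "omit i [] = []"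
  by (simp_all add: omit_def)

lemma length_omit: "i < length xs \<Longrightarrow> length (omit i xs) = length xs - 1"
  by (auto simp: omit_def)

lemma set_omit: "set (omit i xs) \<subseteq> set xs"
  by (auto simp: omit_def dest: in_set_takeD in_set_dropD)

lemma distinct_omit: "distinct xs \<Longrightarrow> distinct (omit i xs)"
  by (auto simp: omit_def set_take_disj_set_drop_if_distinct)

text \<open>The recursion is the cone formula for the boundary,
  \<open>\<partial>[x, xs] = [xs] - [x, \<partial>xs]\<close>, with a function \<open>G\<close> of
  lists in place of the simplex itself. Unfolded it is the usual sum with signs.\<close>

lemma alt_sum_conv: "alt_sum xs G = (\<Sum>i<length xs. smul ((- 1) ^ i) (G (omit i xs)))"
proof (induction xs arbitrary: G)
  case (Cons x xs)
  then show ?case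
    by (simp only: alt_sum.simps length_Cons sum.lessThan_Suc_shift)
       (simp add: smul_distrib sum_negf)
qed simp

lemma alt_sum_minus: "alt_sum xs (\<lambda>ys. G ys - H ys) = alt_sum xs G - alt_sum xs H"
  by (simp add: alt_sum_conv smul_distrib sum_subtractf)

text \<open>Expanding the cone formula twice, the two copies of \<open>alt_sum xs G\<close> cancel;
  what remains is the claim for \<open>xs\<close> and the function
  \<open>\<lambda>ys. G (x # ys)\<close>.\<close>

lemma alt_sum_alt_sum: "alt_sum xs (\<lambda>ys. alt_sum ys G) = 0"
proof (induction xs arbitrary: G)
  case (Cons x xs)
  show ?case by (simp add: alt_sum_minus Cons)
qed simp

lemma alt_sum_cong: "(\<And>i. i < length xs \<Longrightarrow> G (omit i xs) = H (omit i xs)) \<Longrightarrow> alt_sum xs G = alt_sum xs H"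
  by (simp add: alt_sum_conv)

text \<open>Adjacent transpositions generate all permutations, so these are the only ones to be
  compared with \<open>evenperm\<close>.\<close>

definition alternating :: "('v list \<Rightarrow> ('a \<Rightarrow>\<^sub>0 real)) \<Rightarrow> bool" where
  "alternating G \<longleftrightarrow> (\<forall>us a b vs. G (us @ b # a # vs) = - G (us @ a # b # vs))"

lemma alternating_Cons: "alternating G \<Longrightarrow> alternating (\<lambda>ys. G (x # ys))"
  unfolding alternating_def by (metis append_Cons)

lemma alt_sum_swap:
  assumes "alternating G"
  shows "alt_sum (us @ b # a # vs) G = - alt_sum (us @ a # b # vs) G"
  using assms
proof (induction us arbitrary: G)
  case Nil
  have "G (b # a # ys) = - G (a # b # ys)" for ys
    using Nil unfolding alternating_def by (metis append_Nil)
  then have "alt_sum vs (\<lambda>ys. G (b # a # ys)) = - alt_sum vs (\<lambda>ys. G (a # b # ys))"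
    by (simp add: alt_sum_conv smul_distrib sum_negf)
  then show ?case by simp
next
  case (Cons x us)
  have "G (us @ b # a # vs) = - G (us @ a # b # vs)"
    using Cons.prems unfolding alternating_def by blast
  then show ?case using Cons.IH[OF alternating_Cons[OF Cons.prems], of x] by simp
qed

lemma alternating_alt_sum: "alternating G \<Longrightarrow> alternating (\<lambda>ys. alt_sum ys G)"
  unfolding alternating_def[of "\<lambda>ys. alt_sum ys G"] by (intro allI alt_sum_swap)

text \<open>The sign is chosen before \<open>G\<close>. It will be applied both to a function and to
  its alternating sum, and only a common sign lets the two be compared.\<close>

lemma alternating_front:
  "\<exists>s. \<forall>G :: 'v list \<Rightarrow> ('a \<Rightarrow>\<^sub>0 real). alternating G \<longrightarrow> G (us @ a # vs) = (if s then G (a # us @ vs) else - G (a # us @ vs))"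
proof (induction us arbitrary: vs rule: rev_induct)
  case (snoc x us)
  obtain s where s: "alternating G \<Longrightarrow> G (us @ a # x # vs) = (if s then G (a # us @ x # vs) else - G (a # us @ x # vs))"
    for G :: "'v list \<Rightarrow> ('a \<Rightarrow>\<^sub>0 real)"
    using snoc by meson
  have sw: "G (us @ x # a # vs) = - G (us @ a # x # vs)" if "alternating G"
    for G :: "'v list \<Rightarrow> ('a \<Rightarrow>\<^sub>0 real)"
    using that unfolding alternating_def by blast
  then have "alternating G \<longrightarrow> G ((us @ [x]) @ a # vs)
      = (if \<not> s then G (a # (us @ [x]) @ vs) else - G (a # (us @ [x]) @ vs))"
    for G :: "'v list \<Rightarrow> ('a \<Rightarrow>\<^sub>0 real)"
    using s[of G] sw[of G] by auto
  then show ?case by blast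
qed (auto intro: exI[of _ True])

text \<open>The sign is that of the permutation relating \<open>xs\<close> and \<open>zs\<close>.\<close>

lemma alternating_permute:
  assumes "mset xs = mset zs"
  shows "\<exists>s. \<forall>G :: 'v list \<Rightarrow> ('a \<Rightarrow>\<^sub>0 real). alternating G \<longrightarrow> G xs = (if s then G zs else - G zs)"
  using assms
proof (induction zs arbitrary: xs)
  case Nil
  then show ?case by (auto intro: exI[of _ True])
next
  case (Cons z zs)
  obtain us vs where xs: "xs = us @ z # vs"
    by (metis Cons.prems in_set_conv_decomp list.set_intros(1) set_mset_mset)
  then have "mset (us @ vs) = mset zs" using Cons.prems by simp
  then obtain s where s: "alternating G \<Longrightarrow> G (us @ vs) = (if s then G zs else - G zs)"
    for G :: "'v list \<Rightarrow> ('a \<Rightarrow>\<^sub>0 real)"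
    using Cons.IH by meson
  obtain t where t: "alternating G \<Longrightarrow> G xs = (if t then G (z # us @ vs) else - G (z # us @ vs))"
    for G :: "'v list \<Rightarrow> ('a \<Rightarrow>\<^sub>0 real)"
    using alternating_front[of us z vs] unfolding xs by meson
  have "alternating G \<longrightarrow> G xs = (if s = t then G (z # zs) else - G (z # zs))"
    for G :: "'v list \<Rightarrow> ('a \<Rightarrow>\<^sub>0 real)"
    using s[OF alternating_Cons, of G z] t[of G] by auto
  then show ?case by blast
qed

text \<open>With the two equal entries moved to the front, a swap gives \<open>G = - G\<close>,
  which forces zero over the reals.\<close>

lemma alternating_repeated:
  fixes G :: "'v list \<Rightarrow> ('a \<Rightarrow>\<^sub>0 real)"
  assumes "alternating G" "\<not> distinct xs"
  shows "G xs = 0"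
proof -
  obtain us vs ws a where xs: "xs = us @ [a] @ vs @ [a] @ ws"
    using assms(2) not_distinct_decomp by blast
  have "mset xs = mset (a # a # us @ vs @ ws)" by (simp add: xs)
  then obtain s where s: "G xs = (if s then G (a # a # us @ vs @ ws) else - G (a # a # us @ vs @ ws))"
    using alternating_permute assms(1) by blast
  have z: "G (a # a # us @ vs @ ws) = - G (a # a # us @ vs @ ws)"
    using assms(1) unfolding alternating_def by (metis append_Nil)
  have "G (a # a # us @ vs @ ws) = 0"
  proof (rule poly_mapping_eqI)
    fix k show "Poly_Mapping.lookup (G (a # a # us @ vs @ ws)) k = Poly_Mapping.lookup 0 k"
      using arg_cong[OF z, of "\<lambda>p. Poly_Mapping.lookup p k"] by simp
  qed
  then show ?thesis using s by simp
qed

section \<open>Simplicial chains and the boundary operator\<close>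

locale oriented_complex =
  fixes X :: "'v set set" and ori :: "'v set \<Rightarrow> 'v list set"
  assumes X: "abstract_complex X"
    and ori: "\<And>\<sigma>. \<sigma> \<in> X \<Longrightarrow> \<exists>xs. distinct xs \<and> set xs = \<sigma> \<and> ori \<sigma> = {ys. even_reordering xs ys}"
begin

lemma finite_simplex: "\<sigma> \<in> X \<Longrightarrow> finite \<sigma>" and nonempty_simplex: "\<sigma> \<in> X \<Longrightarrow> \<sigma> \<noteq> {}"
  and face_closed: "\<sigma> \<in> X \<Longrightarrow> \<rho> \<subseteq> \<sigma> \<Longrightarrow> \<rho> \<noteq> {} \<Longrightarrow> \<rho> \<in> X"
  using X unfolding abstract_complex_def by blast+

text \<open>The oriented simplex \<open>[ys]\<close> as a chain.  The empty list is kept: it makes the chain complex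
  augmented.\<close>

definition oriented_simplex :: "'v list \<Rightarrow> ('v set \<Rightarrow>\<^sub>0 real)" where
  "oriented_simplex ys = (if distinct ys \<and> set ys \<in> insert {} X
     then Poly_Mapping.single (set ys) (orientation_sign ori ys) else 0)"

definition boundary :: "('v set \<Rightarrow>\<^sub>0 real) \<Rightarrow> ('v set \<Rightarrow>\<^sub>0 real)" where
  "boundary = linear_ext (simplicial_boundary ori)"

lemma orientation_sign_swap:
  assumes "distinct (us @ a # b # vs)" "set (us @ a # b # vs) \<in> X"
  shows "orientation_sign ori (us @ b # a # vs) = - orientation_sign ori (us @ a # b # vs)"
proof -
  let ?ys = "us @ a # b # vs" and ?zs = "us @ b # a # vs"
  let ?t = "Transposition.transpose (length us) (Suc (length us))"
  obtain xs where xs: "distinct xs" "set xs = set ?ys" "ori (set ?ys) = {ys. even_reordering xs ys}"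
    using ori[OF assms(2)] by blast
  have "mset ?ys = mset xs" using xs assms(1) by (metis set_eq_iff_mset_eq_distinct)
  then obtain r where r: "r permutes {..<length xs}" "permute_list r xs = ?ys"
    by (rule mset_eq_permutation)
  have len: "length ?ys = length xs" using r(2) by (metis length_permute_list)
  have t: "?t permutes {..<length xs}"
    using len by (intro permutes_swap_id) auto
  have zs: "?zs = permute_list ?t ?ys"
  proof (rule nth_equalityI)
    fix i assume i: "i < length ?zs"
    consider "i < length us" | "i = length us" | "i = Suc (length us)" | "i > Suc (length us)" by linarith
    then show "?zs ! i = permute_list ?t ?ys ! i"
      using i t len
      by cases (auto simp: permute_list_nth nth_append nth_Cons' Transposition.transpose_def)
  qed simp
  have zs': "?zs = permute_list (r \<circ> ?t) xs"
    using zs r t by (simp add: permute_list_compose)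
  have rt: "(r \<circ> ?t) permutes {..<length xs}" using permutes_compose[OF t r(1)] .
  \<comment> \<open>Since \<open>xs\<close> is distinct, an ordering determines the permutation that
    produces it. Membership in the orientation class is thus the parity of that one permutation,
    which the swap reverses.\<close>
  have uniq: "p = q" if "p permutes {..<length xs}" "q permutes {..<length xs}"
    "permute_list p xs = permute_list q xs" for p q
  proof
    fix i show "p i = q i"
    proof (cases "i < length xs")
      case True
      then have "xs ! p i = xs ! q i" using that by (metis permute_list_nth)
      moreover have "p i < length xs" "q i < length xs"
        using True that by (metis lessThan_iff permutes_in_image)+
      ultimately show ?thesis using xs(1) nth_eq_iff_index_eq by blast
    next
      case False then show ?thesis using that by (simp add: permutes_not_in)
    qed
  qed
  have iff: "permute_list p xs \<in> ori (set ?ys) \<longleftrightarrow> evenperm p" if "p permutes {..<length xs}" for p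
    using that uniq unfolding xs(3) even_reordering_def by blast
  have pt: "permutation r" "permutation ?t" using r t by (auto intro: permutation_permutes[THEN iffD2])
  have "evenperm (r \<circ> ?t) \<longleftrightarrow> \<not> evenperm r"
    using pt by (simp add: evenperm_comp evenperm_swap)
  moreover have "set ?zs = set ?ys" by auto
  ultimately show ?thesis
    using iff[OF r(1)] iff[OF rt] unfolding orientation_sign_def r(2) zs'[symmetric] by auto
qed

lemma alternating_oriented_simplex: "alternating oriented_simplex"
  unfolding alternating_def
proof (intro allI)
  fix us vs :: "'v list" and a b
  have s: "set (us @ b # a # vs) = set (us @ a # b # vs)" by auto
  have d: "distinct (us @ b # a # vs) = distinct (us @ a # b # vs)" by auto
  show "oriented_simplex (us @ b # a # vs) = - oriented_simplex (us @ a # b # vs)"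
    unfolding oriented_simplex_def s d using orientation_sign_swap[of us a b vs]
    by (auto simp: single_uminus)
qed

text \<open>Removes the choice of an ordering from \<open>simplicial_boundary\<close>; later
  arguments see only some ordering of sign 1.\<close>

lemma simplicial_boundary_oriented_simplex:
  assumes "\<sigma> \<in> X"
  obtains xs where "distinct xs" "set xs = \<sigma>" "orientation_sign ori xs = 1"
    "simplicial_boundary ori \<sigma> = alt_sum xs oriented_simplex"
proof -
  obtain x0 where x0: "distinct x0" "set x0 = \<sigma>" "ori \<sigma> = {ys. even_reordering x0 ys}"
    using ori[OF assms] by blast
  define xs where "xs = (SOME xs. xs \<in> ori \<sigma>)"
  have "even_reordering x0 x0" unfolding even_reordering_def
    by (rule exI[of _ id]) (auto simp: evenperm_id permutes_id)
  then have "x0 \<in> ori \<sigma>" using x0 by simp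
  then have xs: "xs \<in> ori \<sigma>" unfolding xs_def by (rule someI)
  then have "mset xs = mset x0" unfolding x0(3) even_reordering_def by auto
  then have dxs: "distinct xs" "set xs = \<sigma>"
    using x0 by (metis mset_eq_imp_distinct_iff, metis mset_eq_setD)
  have "oriented_simplex (omit i xs) = Poly_Mapping.single (set (omit i xs)) (orientation_sign ori (omit i xs))" for i
  proof -
    have "set (omit i xs) \<in> insert {} X"
      using face_closed[OF assms] set_omit[of i xs] dxs by auto
    then show ?thesis using distinct_omit[OF dxs(1)] by (simp add: oriented_simplex_def)
  qed
  then have "simplicial_boundary ori \<sigma> = alt_sum xs oriented_simplex"
    unfolding simplicial_boundary_def xs_def[symmetric] alt_sum_conv Let_def omit_def[symmetric] by simp
  moreover have "orientation_sign ori xs = 1" using xs dxs by (simp add: orientation_sign_def)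
  ultimately show ?thesis using that dxs by blast
qed

text \<open>Both sides alternate in \<open>ys\<close>. A repeated vertex makes both zero; otherwise
  \<open>ys\<close> may be permuted into the ordering for which the boundary is known, with the same
  sign on both sides.\<close>

lemma boundary_oriented_simplex:
  assumes "set ys \<in> X"
  shows "boundary (oriented_simplex ys) = alt_sum ys oriented_simplex"
proof (cases "distinct ys")
  case False
  then show ?thesis
    using alternating_repeated[OF alternating_alt_sum[OF alternating_oriented_simplex]]
    by (simp add: oriented_simplex_def boundary_def)
next
  case True
  obtain xs where xs: "distinct xs" "set xs = set ys" "orientation_sign ori xs = 1"
    "simplicial_boundary ori (set ys) = alt_sum xs oriented_simplex"
    using simplicial_boundary_oriented_simplex[OF assms] by blast
  have "mset ys = mset xs" using xs True by (metis set_eq_iff_mset_eq_distinct)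
  then obtain s where s: "\<And>G :: 'v list \<Rightarrow> 'v set \<Rightarrow>\<^sub>0 real. alternating G \<Longrightarrow> G ys = (if s then G xs else - G xs)"
    using alternating_permute by meson
  have "boundary (oriented_simplex xs) = alt_sum xs oriented_simplex"
    using xs assms by (simp add: oriented_simplex_def boundary_def)
  then show ?thesis
    using s[OF alternating_oriented_simplex] s[OF alternating_alt_sum[OF alternating_oriented_simplex]]
    by (simp add: boundary_def linear_ext_uminus)
qed

text \<open>With at least two vertices all faces are nonempty, so
  \<open>boundary_oriented_simplex\<close> applies to each of them and
  \<open>alt_sum_alt_sum\<close> finishes.\<close>

lemma boundary_boundary_simplex:
  assumes "\<sigma> \<in> X" "card \<sigma> \<ge> 2"
  shows "boundary (simplicial_boundary ori \<sigma>) = 0"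
proof -
  obtain xs where xs: "distinct xs" "set xs = \<sigma>" "simplicial_boundary ori \<sigma> = alt_sum xs oriented_simplex"
    using simplicial_boundary_oriented_simplex[OF assms(1)] by blast
  have "boundary (oriented_simplex (omit i xs)) = alt_sum (omit i xs) oriented_simplex" if "i < length xs" for i
  proof (rule boundary_oriented_simplex)
    have "length (omit i xs) \<ge> 1" using that assms xs by (simp add: length_omit distinct_card[symmetric])
    then have "set (omit i xs) \<noteq> {}" by auto
    then show "set (omit i xs) \<in> X" using face_closed[OF assms(1)] set_omit[of i xs] xs by auto
  qed
  then have "boundary (alt_sum xs oriented_simplex) = alt_sum xs (\<lambda>ys. alt_sum ys oriented_simplex)"
    by (simp add: alt_sum_conv[of xs] boundary_def linear_ext_sum linear_ext_smul)
  then show ?thesis by (simp add: xs(3) alt_sum_alt_sum)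
qed

lemma oriented_simplex_abs:
  assumes "distinct ys" "set ys \<in> insert {} X"
  shows "smul (orientation_sign ori ys) (oriented_simplex ys) = Poly_Mapping.single (set ys) 1"
  using assms by (simp add: oriented_simplex_def orientation_sign_def)

lemma keys_oriented_simplex: "Poly_Mapping.keys (oriented_simplex ys) \<subseteq> {\<sigma> \<in> insert {} X. card \<sigma> = length ys}"
  by (auto simp: oriented_simplex_def distinct_card)

lemma keys_simplicial_boundary:
  assumes "\<sigma> \<in> X"
  shows "Poly_Mapping.keys (simplicial_boundary ori \<sigma>)
     \<subseteq> {\<rho> \<in> insert {} X. Suc (card \<rho>) = card \<sigma> \<and> \<rho> \<subseteq> \<sigma>}"
proof -
  obtain xs where xs: "distinct xs" "set xs = \<sigma>" "simplicial_boundary ori \<sigma> = alt_sum xs oriented_simplex"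
    using simplicial_boundary_oriented_simplex[OF assms(1)] by blast
  have "Poly_Mapping.keys (oriented_simplex (omit i xs)) \<subseteq> {\<rho> \<in> insert {} X. Suc (card \<rho>) = card \<sigma> \<and> \<rho> \<subseteq> \<sigma>}"
    if "i < length xs" for i
  proof -
    have "Suc (length (omit i xs)) = card \<sigma>" using that xs by (simp add: length_omit distinct_card[symmetric])
    moreover have "Poly_Mapping.keys (oriented_simplex (omit i xs)) \<subseteq> {set (omit i xs)}" by (simp add: oriented_simplex_def)
    ultimately show ?thesis using keys_oriented_simplex[of "omit i xs"] set_omit[of i xs] xs by auto
  qed
  then show ?thesis unfolding xs(3) alt_sum_conv
    using keys_smul by (intro order.trans[OF keys_sum]) fast
qed

end

section \<open>The geometric realization\<close>

text \<open>The point with barycentric weights \<open>t\<close> on the vertices \<open>xs\<close>;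
  weights at repeated vertices add up. The recursion lets \<open>omit\<close> be matched with
  \<open>simplical_face\<close> by induction.\<close>

primrec affine_point :: "'v list \<Rightarrow> (nat \<Rightarrow> real) \<Rightarrow> 'v \<Rightarrow> real" where
  "affine_point [] t v = 0"
| "affine_point (x # xs) t v = (if x = v then t 0 else 0) + affine_point xs (t \<circ> Suc) v"

lemma affine_point_omit: "k < length xs \<Longrightarrow> affine_point (omit k xs) t v = affine_point xs (simplical_face k t) v"
proof (induction xs arbitrary: k t)
  case (Cons x xs)
  show ?case
  proof (cases k)
    case 0
    have "simplical_face 0 t \<circ> Suc = t" by (auto simp: simplical_face_def)
    then show ?thesis using 0 by (simp add: simplical_face_def)
  next
    case (Suc k')
    have "simplical_face (Suc k') t \<circ> Suc = simplical_face k' (t \<circ> Suc)"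
      by (auto simp: simplical_face_def fun_eq_iff)
    then show ?thesis using Suc Cons by (simp add: simplical_face_def)
  qed
qed simp

lemma affine_point_nonneg: "(\<And>i. 0 \<le> t i) \<Longrightarrow> 0 \<le> affine_point xs t v"
  by (induction xs arbitrary: t) auto

lemma affine_point_outside: "v \<notin> set xs \<Longrightarrow> affine_point xs t v = 0"
  by (induction xs arbitrary: t) auto

lemma sum_affine_point: "finite S \<Longrightarrow> set xs \<subseteq> S \<Longrightarrow> sum (affine_point xs t) S = (\<Sum>i<length xs. t i)"
proof (induction xs arbitrary: t)
  case (Cons x xs)
  then have "sum (affine_point (x # xs) t) S = t 0 + (\<Sum>i<length xs. (t \<circ> Suc) i)"
    by (simp add: sum.distrib)
  then show ?case by (simp only: length_Cons sum.lessThan_Suc_shift o_def)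
qed simp

lemma continuous_map_affine_point: "continuous_map (powertop_real UNIV) euclideanreal (\<lambda>t. affine_point xs t v)"
proof -
  \<comment> \<open>The recursion passes from \<open>t\<close> to \<open>t \<circ> Suc\<close>, so
    the induction has to allow an arbitrary shift \<open>n\<close>.\<close>
  have "continuous_on UNIV (\<lambda>t. affine_point xs (\<lambda>i. t (i + n)) v)" for n
  proof (induction xs arbitrary: n)
    case (Cons x xs)
    have *: "((\<lambda>i. t (i + n)) \<circ> Suc) = (\<lambda>i. t (i + Suc n))" for t :: "nat \<Rightarrow> real" by auto
    have "continuous_on UNIV (\<lambda>t :: nat \<Rightarrow> real. if x = v then t (0 + n) else 0)"
      by (cases "x = v") (auto intro!: continuous_on_product_coordinates)
    then show ?case using Cons.IH[of "Suc n"]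
      by (auto simp: * intro!: continuous_intros)
  qed simp
  from this[of 0] show ?thesis
    by (simp add: euclidean_product_topology)
qed

lemma topspace_geometric_realization:
  "topspace (geometric_realization X) = (\<Union>\<sigma>\<in>X. geometric_simplex \<sigma>)"
proof
  show "topspace (geometric_realization X) \<subseteq> (\<Union>\<sigma>\<in>X. geometric_simplex \<sigma>)"
    using openin_topspace[of "geometric_realization X"] unfolding openin_geometric_realization by blast
  have "(\<Union>\<sigma>\<in>X. geometric_simplex \<sigma>) \<inter> geometric_simplex \<tau> = geometric_simplex \<tau>" if "\<tau> \<in> X" for \<tau>
    using that by blast
  moreover have "openin (subtopology (powertop_real UNIV) S) S" for S :: "('a \<Rightarrow> real) set"
    by (simp add: openin_subtopology_refl)
  ultimately have "openin (geometric_realization X) (\<Union>\<sigma>\<in>X. geometric_simplex \<sigma>)"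
    by (simp add: openin_geometric_realization)
  then show "(\<Union>\<sigma>\<in>X. geometric_simplex \<sigma>) \<subseteq> topspace (geometric_realization X)"
    by (rule openin_subset)
qed

text \<open>A weakly open set meets the closed simplex in a set that is open for the coordinate
  topology, and a map into the simplex sees only this intersection.\<close>

lemma continuous_map_into_geometric_realization:
  assumes f: "continuous_map T (subtopology (powertop_real UNIV) (geometric_simplex \<sigma>)) f"
    and "\<sigma> \<in> X"
  shows "continuous_map T (geometric_realization X) f"
  unfolding continuous_map_def
proof (intro conjI allI impI)
  have im: "f x \<in> geometric_simplex \<sigma>" if "x \<in> topspace T" for x
    using f that by (auto simp: continuous_map_in_subtopology)
  then show "f \<in> topspace T \<rightarrow> topspace (geometric_realization X)"
    using assms(2) by (auto simp: topspace_geometric_realization)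
  fix U assume "openin (geometric_realization X) U"
  then have "openin (subtopology (powertop_real UNIV) (geometric_simplex \<sigma>)) (U \<inter> geometric_simplex \<sigma>)"
    using assms(2) by (simp add: openin_geometric_realization)
  with f have "openin T {x \<in> topspace T. f x \<in> U \<inter> geometric_simplex \<sigma>}"
    by (rule openin_continuous_map_preimage)
  moreover have "{x \<in> topspace T. f x \<in> U \<inter> geometric_simplex \<sigma>} = {x \<in> topspace T. f x \<in> U}"
    using im by blast
  ultimately show "openin T {x \<in> topspace T. f x \<in> U}" by simp
qed

text \<open>The restriction makes the map extensional, as \<open>singular_simplex\<close>
  demands.\<close>

definition affine_simplex :: "'v list \<Rightarrow> (nat \<Rightarrow> real) \<Rightarrow> 'v \<Rightarrow> real" where
  "affine_simplex xs = restrict (affine_point xs) (standard_simplex (length xs - 1))"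

lemma affine_point_in_geometric_simplex:
  assumes "t \<in> standard_simplex (length xs - 1)" "xs \<noteq> []"
  shows "affine_point xs t \<in> geometric_simplex (set xs)"
proof -
  have "{..<length xs} = {..length xs - 1}" using assms(2) by (cases xs) auto
  then show ?thesis
    using assms by (auto simp: geometric_simplex_def standard_simplex_def sum_affine_point affine_point_outside affine_point_nonneg)
qed

lemma affine_simplex_in_geometric_simplex:
  assumes "xs \<noteq> []"
  shows "affine_simplex xs ` standard_simplex (length xs - 1) \<subseteq> geometric_simplex (set xs)"
  using affine_point_in_geometric_simplex[OF _ assms] by (auto simp: affine_simplex_def)

lemma singular_simplex_affine_simplex:
  assumes "set xs \<in> X" "xs \<noteq> []"
  shows "singular_simplex (length xs - 1) (geometric_realization X) (affine_simplex xs)"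
  unfolding singular_simplex_def
proof
  let ?S = "standard_simplex (length xs - 1)"
  show "affine_simplex xs \<in> extensional ?S" by (simp add: affine_simplex_def)
  have "continuous_map (subtopology (powertop_real UNIV) ?S) (powertop_real UNIV) (affine_point xs)"
    by (simp add: continuous_map_componentwise continuous_map_affine_point continuous_map_from_subtopology)
  then have "continuous_map (subtopology (powertop_real UNIV) ?S)
      (subtopology (powertop_real UNIV) (geometric_simplex (set xs))) (affine_point xs)"
    using affine_point_in_geometric_simplex[OF _ assms(2)] by (auto simp: continuous_map_in_subtopology)
  then have "continuous_map (subtopology (powertop_real UNIV) ?S)
      (subtopology (powertop_real UNIV) (geometric_simplex (set xs))) (affine_simplex xs)"
    by (rule continuous_map_eq) (simp add: affine_simplex_def)
  then show "continuous_map (subtopology (powertop_real UNIV) ?S) (geometric_realization X) (affine_simplex xs)"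
    by (rule continuous_map_into_geometric_realization) (rule assms)
qed

lemma singular_face_affine_simplex:
  assumes "length xs = Suc (Suc p)" "k \<le> Suc p"
  shows "singular_face (Suc p) k (affine_simplex xs) = affine_simplex (omit k xs)"
proof -
  have "simplical_face k x \<in> standard_simplex (Suc p)" if "x \<in> standard_simplex p" for x
    using simplical_face_in_standard_simplex[of "Suc p" k x] assms that by simp
  then show ?thesis
    using assms affine_point_omit[of k xs]
    by (auto simp: singular_face_def affine_simplex_def length_omit fun_eq_iff)
qed

subsection \<open>Retracting points to vertices\<close>

text \<open>A singular simplex inside \<open>peak_set X \<sigma>\<close> has all the peaks of its points in \<open>\<sigma>\<close>, so the peaks of
  its corners span a simplex of \<open>X\<close>; these sets form an open cover.\<close>

definition peak :: "('v \<Rightarrow> real) \<Rightarrow> 'v" where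
  "peak p = (SOME v. \<forall>w. p w \<le> p v)"

definition peak_set :: "'v set set \<Rightarrow> 'v set \<Rightarrow> ('v \<Rightarrow> real) set" where
  "peak_set X \<sigma> = {p \<in> topspace (geometric_realization X). \<forall>v\<in>\<sigma>. 0 < p v \<and> (\<forall>w. w \<notin> \<sigma> \<longrightarrow> p w < p v)}"

lemma geometric_simplex_max:
  assumes "p \<in> geometric_simplex \<sigma>" "finite \<sigma>"
  obtains v where "v \<in> \<sigma>" "0 < p v" "\<And>w. p w \<le> p v"
proof -
  have p: "\<And>v. 0 \<le> p v" "\<And>v. v \<notin> \<sigma> \<Longrightarrow> p v = 0" "sum p \<sigma> = 1"
    using assms(1) by (auto simp: geometric_simplex_def)
  then have ne: "\<sigma> \<noteq> {}" by auto
  have fin: "finite (p ` \<sigma>)" "p ` \<sigma> \<noteq> {}" using assms(2) ne by auto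
  obtain v where v: "v \<in> \<sigma>" "p v = Max (p ` \<sigma>)" using Max_in[OF fin] by auto
  have le: "p w \<le> p v" for w
  proof (cases "w \<in> \<sigma>")
    case True then show ?thesis using v fin by simp
  next
    case False then show ?thesis using p by simp
  qed
  moreover have "p v \<noteq> 0"
  proof
    assume "p v = 0"
    then have "p w = 0" for w using le p(1) by (metis antisym)
    then show False using p(3) by simp
  qed
  ultimately show ?thesis using that v p(1)[of v] by (simp add: less_le)
qed

lemma peak_max:
  assumes "p \<in> geometric_simplex \<sigma>" "finite \<sigma>"
  shows "p w \<le> p (peak p)"
proof -
  have "\<exists>v. \<forall>w. p w \<le> p v" by (rule geometric_simplex_max[OF assms]) blast
  then show ?thesis unfolding peak_def by (rule someI_ex[THEN spec])
qed

lemma peak_in_carrier: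
  assumes "p \<in> geometric_simplex \<sigma>" "finite \<sigma>"
  shows "peak p \<in> \<sigma>"
proof -
  obtain v where "0 < p v" by (rule geometric_simplex_max[OF assms]) blast
  then have "0 < p (peak p)" using peak_max[OF assms, of v] by simp
  then show ?thesis using assms(1) by (auto simp: geometric_simplex_def)
qed

text \<open>On a closed simplex \<tau> finitely many strict inequalities remain: for a vertex
  \<open>w\<close> outside \<tau> the coordinate \<open>p w\<close> is 0, so
  \<open>p w < p v\<close> is the positivity of \<open>p v\<close>. If \<sigma> is not contained in
  \<tau>, the trace is empty.\<close>

lemma openin_peak_set:
  assumes "abstract_complex X" "\<sigma> \<in> X"
  shows "openin (geometric_realization X) (peak_set X \<sigma>)"
  unfolding openin_geometric_realization
proof (intro conjI ballI)
  show "peak_set X \<sigma> \<subseteq> (\<Union>\<sigma>\<in>X. geometric_simplex \<sigma>)"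
    by (auto simp: peak_set_def topspace_geometric_realization)
  fix \<tau> assume \<tau>: "\<tau> \<in> X"
  then have fin: "finite \<tau>" "finite \<sigma>" using assms unfolding abstract_complex_def by blast+
  let ?T = "subtopology (powertop_real UNIV) (geometric_simplex \<tau>)"
  show "openin ?T (peak_set X \<sigma> \<inter> geometric_simplex \<tau>)"
  proof (cases "\<sigma> \<subseteq> \<tau>")
    case False
    then obtain v where v: "v \<in> \<sigma>" "v \<notin> \<tau>" by blast
    have "p \<notin> geometric_simplex \<tau>" if "p \<in> peak_set X \<sigma>" for p
    proof -
      have "0 < p v" using that v by (simp add: peak_set_def)
      then show ?thesis using v by (auto simp: geometric_simplex_def)
    qed
    then have "peak_set X \<sigma> \<inter> geometric_simplex \<tau> = {}" by blast
    then show ?thesis by simp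
  next
    case True
    define W where "W = (\<Inter>v\<in>\<sigma>. {p :: 'a \<Rightarrow> real. 0 < p v} \<inter> (\<Inter>w\<in>\<tau> - \<sigma>. {p. p w < p v}))"
    have "open W" unfolding W_def
      by (intro open_INT open_Int fin ballI finite_Diff open_Collect_less continuous_intros
          continuous_on_product_coordinates)
    moreover have "peak_set X \<sigma> \<inter> geometric_simplex \<tau> = geometric_simplex \<tau> \<inter> W"
    proof (intro Set.set_eqI iffI)
      fix p assume p: "p \<in> geometric_simplex \<tau> \<inter> W"
      have "p w < p v" if "v \<in> \<sigma>" "w \<notin> \<sigma>" for v w
        using p that by (cases "w \<in> \<tau>") (auto simp: W_def geometric_simplex_def)
      then show "p \<in> peak_set X \<sigma> \<inter> geometric_simplex \<tau>"
        using p \<tau> by (auto simp: peak_set_def W_def topspace_geometric_realization)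
    qed (auto simp: peak_set_def W_def)
    ultimately show ?thesis
      by (auto simp: openin_subtopology euclidean_product_topology)
  qed
qed

text \<open>A point belongs to the peak set of the face spanned by the vertices at which its
  coordinate is maximal.\<close>

lemma peak_sets_cover:
  assumes "abstract_complex X"
  shows "topspace (geometric_realization X) \<subseteq> \<Union>(peak_set X ` X)"
proof
  fix p assume p: "p \<in> topspace (geometric_realization X)"
  then obtain \<tau> where \<tau>: "\<tau> \<in> X" "p \<in> geometric_simplex \<tau>" by (auto simp: topspace_geometric_realization)
  then have fin: "finite \<tau>" using assms unfolding abstract_complex_def by blast
  obtain v where v: "v \<in> \<tau>" "0 < p v" "\<And>w. p w \<le> p v" using geometric_simplex_max[OF \<tau>(2) fin] by blast
  let ?\<sigma> = "{w \<in> \<tau>. p w = p v}"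
  have "?\<sigma> \<subseteq> \<tau>" "?\<sigma> \<noteq> {}" using v(1) by auto
  then have "?\<sigma> \<in> X" using assms \<tau>(1) unfolding abstract_complex_def by blast
  moreover have "p w < p v" if "w \<notin> ?\<sigma>" for w
    using that v(2) v(3)[of w] \<tau>(2) by (cases "w \<in> \<tau>") (auto simp: geometric_simplex_def)
  then have "p \<in> peak_set X ?\<sigma>"
    using p v(2) by (auto simp: peak_set_def)
  ultimately show "p \<in> \<Union>(peak_set X ` X)" by blast
qed

lemma peak_in_peak_set:
  assumes "abstract_complex X" "\<sigma> \<in> X" "p \<in> peak_set X \<sigma>"
  shows "peak p \<in> \<sigma>"
proof (rule ccontr)
  assume "peak p \<notin> \<sigma>"
  obtain v where v: "v \<in> \<sigma>" using assms(1,2) unfolding abstract_complex_def by blast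
  then have "p (peak p) < p v" using assms(3) \<open>peak p \<notin> \<sigma>\<close> by (simp add: peak_set_def)
  moreover obtain \<tau> where \<tau>: "\<tau> \<in> X" "p \<in> geometric_simplex \<tau>"
    using assms(3) by (auto simp: peak_set_def topspace_geometric_realization)
  have "finite \<tau>" using assms(1) \<tau>(1) unfolding abstract_complex_def by blast
  then have "p v \<le> p (peak p)" by (rule peak_max[OF \<tau>(2)])
  ultimately show False by simp
qed

definition corner_peaks :: "nat \<Rightarrow> ((nat \<Rightarrow> real) \<Rightarrow> 'v \<Rightarrow> real) \<Rightarrow> 'v list" where
  "corner_peaks p s = map (\<lambda>i. peak (s (\<lambda>j. if j = i then 1 else 0))) [0..<Suc p]"

lemma length_corner_peaks [simp]: "length (corner_peaks p s) = Suc p"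
  by (simp add: corner_peaks_def)

lemma set_corner_peaks: "(\<And>t. t \<in> standard_simplex p \<Longrightarrow> peak (s t) \<in> S) \<Longrightarrow> set (corner_peaks p s) \<subseteq> S"
  by (auto simp: corner_peaks_def)

lemma nth_omit: "i < length xs - 1 \<Longrightarrow> omit k xs ! i = (if i < k then xs ! i else xs ! Suc i)"
  by (cases "k < length xs") (auto simp: omit_def nth_append)

text \<open>The \<open>k\<close>-th face inclusion sends corner \<open>i\<close> to corner
  \<open>i\<close> or \<open>Suc i\<close>, skipping \<open>k\<close>. This compatibility is what
  makes collapsing to peaks commute with boundaries.\<close>

lemma corner_peaks_singular_face:
  assumes "k \<le> Suc p"
  shows "corner_peaks p (singular_face (Suc p) k s) = omit k (corner_peaks (Suc p) s)"
proof (rule nth_equalityI)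
  show "length (corner_peaks p (singular_face (Suc p) k s)) = length (omit k (corner_peaks (Suc p) s))"
    using assms by (simp add: length_omit)
  fix i assume "i < length (corner_peaks p (singular_face (Suc p) k s))"
  then have i: "i \<le> p" by simp
  have "simplical_face k (\<lambda>j. if j = i then 1 else 0)
     = (\<lambda>j. if j = (if i < k then i else Suc i) then 1 else 0 :: real)"
    by (auto simp: simplical_face_def fun_eq_iff)
  then show "corner_peaks p (singular_face (Suc p) k s) ! i = omit k (corner_peaks (Suc p) s) ! i"
    using i assms by (auto simp: nth_omit corner_peaks_def singular_face_def simp del: upt_Suc)
qed

lemma corner_peaks_affine_simplex_singleton: "corner_peaks 0 (affine_simplex [x]) = [x]"
proof -
  let ?t = "\<lambda>j. if j = 0 then 1 else 0 :: real"
  have "affine_simplex [x] ?t = (\<lambda>v. if x = v then 1 else 0)"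
    using basis_in_standard_simplex[of 0 0] by (auto simp: affine_simplex_def)
  moreover have "(\<lambda>v. if x = v then 1 else 0) \<in> geometric_simplex {x}"
    by (auto simp: geometric_simplex_def)
  then have "peak (\<lambda>v. if x = v then 1 else 0 :: real) \<in> {x}"
    by (rule peak_in_carrier) simp
  ultimately show ?thesis by (simp add: corner_peaks_def)
qed

section \<open>Comparison of singular chains with real simplicial chains\<close>

definition real_chain :: "('a \<Rightarrow>\<^sub>0 int) \<Rightarrow> ('a \<Rightarrow>\<^sub>0 real)" where
  "real_chain c = Poly_Mapping.map real_of_int c"

lemma lookup_real_chain [simp]: "Poly_Mapping.lookup (real_chain c) x = real_of_int (Poly_Mapping.lookup c x)"
  by (simp add: real_chain_def Poly_Mapping.map.rep_eq when_def)

lemma keys_real_chain [simp]: "Poly_Mapping.keys (real_chain c) = Poly_Mapping.keys c"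
  by (auto simp: in_keys_iff)

lemma real_chain_simps [simp]: "real_chain 0 = 0" "real_chain (frag_of x) = Poly_Mapping.single x 1"
  by (auto intro!: poly_mapping_eqI simp: lookup_single when_def)

lemma real_chain_distrib:
  "real_chain (a + b) = real_chain a + real_chain b" "real_chain (a - b) = real_chain a - real_chain b"
  "real_chain (frag_cmul k a) = smul (real_of_int k) (real_chain a)"
  by (auto intro!: poly_mapping_eqI simp: lookup_add lookup_minus)

lemma real_chain_sum: "real_chain (sum f A) = (\<Sum>x\<in>A. real_chain (f x))"
  by (induction A rule: infinite_finite_induct) (auto simp: real_chain_distrib)

lemma real_chain_inj: "real_chain a = real_chain b \<Longrightarrow> a = b"
  by (auto intro!: poly_mapping_eqI simp: poly_mapping_eq_iff fun_eq_iff)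

lemma real_chain_frag_extend: "real_chain (frag_extend f c) = linear_ext (\<lambda>x. real_chain (f x)) (real_chain c)"
  by (simp add: frag_extend_def linear_ext_def real_chain_sum real_chain_distrib)

lemma real_chain_ex:
  assumes "\<And>x. Poly_Mapping.lookup c x \<in> \<int>"
  obtains c' where "real_chain c' = c"
proof
  show "real_chain (Poly_Mapping.map floor c) = c"
    using assms by (auto intro!: poly_mapping_eqI simp: Poly_Mapping.map.rep_eq when_def elim!: Ints_cases)
qed

lemma chain_boundary_Suc: "chain_boundary (Suc p) c
    = frag_extend (\<lambda>s. \<Sum>k\<le>Suc p. frag_cmul ((- 1) ^ k) (frag_of (singular_face (Suc p) k s))) c"
  by (simp add: chain_boundary_def)

text \<open>One computation for all comparisons of the two boundaries: \<open>ls\<close> attaches a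
  list of vertices to a singular simplex, and \<open>F\<close> of a face depends only on the list
  with one entry omitted.\<close>

lemma linear_ext_chain_boundary:
  assumes "\<And>s k. s \<in> Poly_Mapping.keys c \<Longrightarrow> k \<le> Suc p
      \<Longrightarrow> F (singular_face (Suc p) k s) = G (omit k (ls s))"
    and "\<And>s. s \<in> Poly_Mapping.keys c \<Longrightarrow> length (ls s) = Suc (Suc p)"
  shows "linear_ext F (real_chain (chain_boundary (Suc p) c)) = linear_ext (\<lambda>s. alt_sum (ls s) G) (real_chain c)"
proof -
  have "linear_ext F (real_chain (\<Sum>k\<le>Suc p. frag_cmul ((- 1) ^ k) (frag_of (singular_face (Suc p) k s))))
      = alt_sum (ls s) G" if s: "s \<in> Poly_Mapping.keys c" for s
    using assms(1)[OF s] assms(2)[OF s]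
    by (simp only: real_chain_sum real_chain_distrib real_chain_simps linear_ext_sum linear_ext_smul linear_ext_single alt_sum_conv
        lessThan_Suc_atMost) simp
  then show ?thesis
    unfolding chain_boundary_Suc real_chain_frag_extend linear_ext_linear_ext by (intro linear_ext_cong) simp
qed

context oriented_complex
begin

definition vertex_chain :: "nat \<Rightarrow> ('v \<Rightarrow> real) chain \<Rightarrow> ('v set \<Rightarrow>\<^sub>0 real)" where
  "vertex_chain p c = linear_ext (\<lambda>s. oriented_simplex (corner_peaks p s)) (real_chain c)"

text \<open>The peaks have to span a simplex: \<open>oriented_simplex\<close> is 0 on any other
  list, while the alternating sum of its faces need not vanish.\<close>

lemma boundary_vertex_chain:
  assumes "\<And>s. s \<in> Poly_Mapping.keys c \<Longrightarrow> set (corner_peaks (Suc p) s) \<in> X"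
  shows "boundary (vertex_chain (Suc p) c) = vertex_chain p (chain_boundary (Suc p) c)"
proof -
  have "boundary (vertex_chain (Suc p) c) = linear_ext (\<lambda>s. alt_sum (corner_peaks (Suc p) s) oriented_simplex) (real_chain c)"
    unfolding vertex_chain_def boundary_def linear_ext_linear_ext
    by (rule linear_ext_cong) (simp add: boundary_oriented_simplex[OF assms, unfolded boundary_def])
  then show ?thesis
    unfolding vertex_chain_def by (subst linear_ext_chain_boundary) (auto simp: corner_peaks_singular_face)
qed

lemma vertex_chain_diff: "vertex_chain p (a - b) = vertex_chain p a - vertex_chain p b"
  by (simp add: vertex_chain_def real_chain_distrib linear_ext_diff)

lemma vertex_chain_subdivision:
  "vertex_chain p ((singular_subdivision p ^^ m) c)
     = linear_ext (\<lambda>s. vertex_chain p ((singular_subdivision p ^^ m) (frag_of s))) (real_chain c)"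
proof (induction c rule: frag_induction[OF subset_UNIV])
  case 1
  then show ?case by (simp add: vertex_chain_def)
next
  case (2 x)
  then show ?case by simp
next
  case (3 a b)
  then show ?case
    by (simp add: singular_subdivision_power_diff vertex_chain_diff real_chain_distrib linear_ext_diff)
qed

lemma singular_chain_subdivision_power:
  "singular_chain p T c \<Longrightarrow> singular_chain p T ((singular_subdivision p ^^ m) c)"
  by (induction m) (auto intro: singular_chain_singular_subdivision)

lemma chain_boundary_subdivision_power:
  "singular_chain p T c \<Longrightarrow>
    chain_boundary p ((singular_subdivision p ^^ m) c)
      = (singular_subdivision (p - 1) ^^ m) (chain_boundary p c)"
  by (induction m)
     (auto simp: chain_boundary_singular_subdivision[OF singular_chain_subdivision_power])

text \<open>Collapsing a fine subdivision of a simplex back to its vertices gives the simplex with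
  multiplicity one, as in Sperner's lemma: the multiplicity is determined by the boundary.\<close>

lemma vertex_chain_subdivision_affine_simplex:
  assumes "distinct xs" "set xs \<in> X" "length xs = Suc p"
  shows "vertex_chain p ((singular_subdivision p ^^ m) (frag_of (affine_simplex xs))) = oriented_simplex xs"
  using assms
proof (induction p arbitrary: xs)
  case 0
  obtain x where x: "xs = [x]" using 0 by (cases xs) auto
  have "singular_simplex 0 (geometric_realization X) (affine_simplex xs)"
    using singular_simplex_affine_simplex[of xs X] 0 x by simp
  then have *: "singular_chain 0 (geometric_realization X) (frag_of (affine_simplex xs))" by (simp add: singular_chain_of)
  have "(singular_subdivision 0 ^^ m) (frag_of (affine_simplex xs)) = frag_of (affine_simplex xs)"
    by (induction m) (simp_all add: singular_subdivision_zero[OF *])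
  then show ?case by (simp add: vertex_chain_def corner_peaks_affine_simplex_singleton x)
next
  case (Suc p)
  let ?T = "geometric_realization X" and ?c = "(singular_subdivision (Suc p) ^^ m) (frag_of (affine_simplex xs))"
  have ne: "xs \<noteq> []" using Suc.prems by auto
  have ss: "singular_simplex (Suc p) ?T (affine_simplex xs)"
    using singular_simplex_affine_simplex[OF Suc.prems(2) ne] Suc.prems by simp
  \<comment> \<open>Subdivision does not leave the closed simplex, so the peaks of all pieces are
    vertices of \<open>xs\<close>.\<close>
  then have "singular_chain (Suc p) (subtopology ?T (geometric_simplex (set xs))) (frag_of (affine_simplex xs))"
    using affine_simplex_in_geometric_simplex[OF ne] Suc.prems by (simp add: singular_chain_of singular_simplex_subtopology)
  then have "singular_chain (Suc p) (subtopology ?T (geometric_simplex (set xs))) ?c"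
    by (rule singular_chain_subdivision_power)
  then have "s ` standard_simplex (Suc p) \<subseteq> geometric_simplex (set xs)"
    if "s \<in> Poly_Mapping.keys ?c" for s
    using that by (simp add: singular_chain_subtopology)
  then have sub: "set (corner_peaks (Suc p) s) \<subseteq> set xs" if "s \<in> Poly_Mapping.keys ?c" for s
    using that by (intro set_corner_peaks peak_in_carrier) auto
  then have inX: "set (corner_peaks (Suc p) s) \<in> X" if "s \<in> Poly_Mapping.keys ?c" for s
    using that face_closed[OF Suc.prems(2), of "set (corner_peaks (Suc p) s)"] length_corner_peaks[of "Suc p" s]
    by (metis length_0_conv nat.distinct(1) set_empty)
  \<comment> \<open>A list with repetitions contributes 0, and a distinct list of the same length as
    \<open>xs\<close> exhausts \<open>xs\<close>. So the collapsed chain is a multiple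
    \<open>r\<close> of one simplex.\<close>
  have "Poly_Mapping.keys (oriented_simplex (corner_peaks (Suc p) s)) \<subseteq> {set xs}" if "s \<in> Poly_Mapping.keys ?c" for s
  proof (cases "distinct (corner_peaks (Suc p) s)")
    case True
    then have "card (set (corner_peaks (Suc p) s)) = card (set xs)"
      using Suc.prems by (simp add: distinct_card)
    then have "set (corner_peaks (Suc p) s) = set xs" using sub[OF that] by (simp add: card_subset_eq)
    then show ?thesis by (simp add: oriented_simplex_def)
  qed (simp add: oriented_simplex_def)
  then have "Poly_Mapping.keys (vertex_chain (Suc p) ?c) \<subseteq> {set xs}"
    unfolding vertex_chain_def by (intro order.trans[OF keys_linear_ext]) auto
  then have "vertex_chain (Suc p) ?c
      = Poly_Mapping.single (set xs) (Poly_Mapping.lookup (vertex_chain (Suc p) ?c) (set xs))"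
    by (intro poly_mapping_eqI) (auto simp: lookup_single when_def in_keys_iff)
  also have "\<dots> = smul (Poly_Mapping.lookup (vertex_chain (Suc p) ?c) (set xs))
      (smul (orientation_sign ori xs) (oriented_simplex xs))"
    using Suc.prems by (subst oriented_simplex_abs) auto
  finally obtain r where r: "vertex_chain (Suc p) ?c = smul r (oriented_simplex xs)" by auto
  have faces: "vertex_chain p ((singular_subdivision p ^^ m) (frag_of (affine_simplex (omit k xs)))) = oriented_simplex (omit k xs)"
    if "k < length xs" for k
  proof (rule Suc.IH)
    show "distinct (omit k xs)" using Suc.prems by (simp add: distinct_omit)
    show len: "length (omit k xs) = Suc p" using that Suc.prems by (simp add: length_omit)
    then have "set (omit k xs) \<noteq> {}" by auto
    then show "set (omit k xs) \<in> X" by (intro face_closed[OF Suc.prems(2) set_omit])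
  qed
  have "smul r (alt_sum xs oriented_simplex) = boundary (vertex_chain (Suc p) ?c)"
    using boundary_oriented_simplex[OF Suc.prems(2)] by (simp add: r boundary_def linear_ext_smul)
  also have "\<dots> = vertex_chain p (chain_boundary (Suc p) ?c)"
    by (rule boundary_vertex_chain) (rule inX)
  also have "chain_boundary (Suc p) ?c = (singular_subdivision p ^^ m) (chain_boundary (Suc p) (frag_of (affine_simplex xs)))"
    using chain_boundary_subdivision_power[of "Suc p" ?T "frag_of (affine_simplex xs)" m] ss by (simp add: singular_chain_of)
  also have "vertex_chain p \<dots> = linear_ext (\<lambda>s. alt_sum xs oriented_simplex) (real_chain (frag_of (affine_simplex xs)))"
    by (subst vertex_chain_subdivision, rule linear_ext_chain_boundary[where ls = "\<lambda>_. xs"])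
       (use Suc.prems in \<open>auto simp: keys_frag_of singular_face_affine_simplex faces\<close>)
  finally have eq: "smul r (alt_sum xs oriented_simplex) = alt_sum xs oriented_simplex" by simp
  \<comment> \<open>The face opposite the first vertex occurs exactly once in the boundary, with
    coefficient 1 or -1. Comparing coefficients there gives \<open>r = 1\<close>.\<close>
  obtain x ys where xs: "xs = x # ys" using ne by (cases xs) auto
  have ys: "ys \<noteq> []" using Suc.prems xs by auto
  have "Poly_Mapping.lookup (oriented_simplex (x # omit i ys)) (set ys) = 0" for i
  proof -
    have "Poly_Mapping.keys (oriented_simplex (x # omit i ys)) \<subseteq> {insert x (set (omit i ys))}" by (simp add: oriented_simplex_def)
    moreover have "set ys \<noteq> insert x (set (omit i ys))" using Suc.prems(1) xs by auto
    ultimately show ?thesis by (auto simp: in_keys_iff)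
  qed
  then have "Poly_Mapping.lookup (alt_sum ys (\<lambda>zs. oriented_simplex (x # zs))) (set ys) = 0"
    by (simp add: alt_sum_conv lookup_sum)
  then have "Poly_Mapping.lookup (alt_sum xs oriented_simplex) (set ys) = Poly_Mapping.lookup (oriented_simplex ys) (set ys)"
    by (simp add: xs lookup_minus)
  moreover have "set ys \<in> X" using face_closed[OF Suc.prems(2), of "set ys"] xs ys by auto
  ultimately have "Poly_Mapping.lookup (alt_sum xs oriented_simplex) (set ys) \<noteq> 0"
    using Suc.prems(1) xs by (simp add: oriented_simplex_def orientation_sign_def)
  moreover have "r * Poly_Mapping.lookup (alt_sum xs oriented_simplex) (set ys) = Poly_Mapping.lookup (alt_sum xs oriented_simplex) (set ys)"
    using arg_cong[OF eq, of "\<lambda>c. Poly_Mapping.lookup c (set ys)"] by simp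
  ultimately have "r = 1" by simp
  then show ?case using r by simp
qed

end

section \<open>Acyclicity of contractible complexes\<close>

text \<open>A contraction makes \<open>c\<close> homologous to its image in a one-point space, where
  cycles of positive degree bound.\<close>

lemma contractible_cycle_is_boundary:
  assumes T: "contractible_space T" and c: "singular_relcycle p T {} c" and p: "1 \<le> p"
  obtains w where "singular_chain (Suc p) T w" "chain_boundary (Suc p) w = c"
proof (cases "topspace T = {}")
  case True
  then have "c = 0" using c by (simp add: singular_relcycle_def singular_chain_empty)
  then show ?thesis using that[of 0] by simp
next
  case False
  obtain a where a: "homotopic_with (\<lambda>x. True) T T id (\<lambda>x. a)"
    using T by (auto simp: contractible_space_def)
  then have "continuous_map T T (\<lambda>x. a)" by (rule homotopic_with_imp_continuous_maps[THEN conjunct2])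
  then have aT: "a \<in> topspace T" using False by (auto simp: continuous_map_def)
  have "homologous_rel p T {} (chain_map p id c) (chain_map p (\<lambda>x. a) c)"
    by (rule homotopic_imp_homologous_rel_chain_maps[OF _ c]) (use a in simp)
  moreover have "chain_map p id c = c"
    using c by (intro chain_map_id_gen[where X = T]) (auto simp: singular_relcycle_def)
  moreover have "singular_relboundary p T {} (chain_map p (\<lambda>x. a) c)"
  proof -
    let ?A = "subtopology T {a}"
    have "singular_relcycle p ?A {} (chain_map p (\<lambda>x. a) c)"
      by (rule singular_relcycle_chain_map[OF c]) (auto simp: aT continuous_map_in_subtopology)
    moreover have "topspace ?A = {a}" using aT by auto
    ultimately have "singular_relboundary p ?A {} (chain_map p (\<lambda>x. a) c)"
      using singular_boundary_eq_cycle_singleton[of ?A a p] p by simp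
    then show ?thesis
      using singular_boundary_mono[of "{a}" "UNIV" p T] by simp
  qed
  ultimately have "singular_relboundary p T {} ((c - chain_map p (\<lambda>x. a) c) + chain_map p (\<lambda>x. a) c)"
    unfolding homologous_rel_def by (intro singular_relboundary_add) simp_all
  then have "singular_relboundary p T {} c" by simp
  then show ?thesis using that by (auto simp: singular_boundary)
qed

section \<open>Filling integral simplicial cycles\<close>

lemma omit_map: "omit k (map f xs) = map f (omit k xs)"
  by (simp add: omit_def take_map drop_map)

lemma sorted_omit: "sorted xs \<Longrightarrow> sorted (omit k xs)"
proof (induction xs arbitrary: k)
  case (Cons x xs)
  then show ?case using set_omit by (cases k) fastforce+
qed simp

text \<open>One order on all vertices makes the ordered list of a face an omission from that of the
  simplex, so that ordered simplices map to singular simplices compatibly with faces. The order is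
  pulled back from the natural numbers along an enumeration.\<close>

lemma vertex_ordering:
  assumes "countable V"
  obtains srt where "\<And>\<sigma>. finite \<sigma> \<Longrightarrow> \<sigma> \<subseteq> V \<Longrightarrow> distinct (srt \<sigma>) \<and> set (srt \<sigma>) = \<sigma>"
    "\<And>\<sigma> k. finite \<sigma> \<Longrightarrow> \<sigma> \<subseteq> V \<Longrightarrow> srt (set (omit k (srt \<sigma>))) = omit k (srt \<sigma>)"
proof -
  let ?h = "to_nat_on V" and ?g = "from_nat_into V"
  define srt where "srt \<sigma> = map ?g (sorted_list_of_set (?h ` \<sigma>))" for \<sigma>
  have gh: "?g (?h v) = v" if "v \<in> V" for v using assms that by simp
  have 1: "distinct (srt \<sigma>) \<and> set (srt \<sigma>) = \<sigma>" if "finite \<sigma>" "\<sigma> \<subseteq> V" for \<sigma>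
  proof
    have "inj_on ?g (?h ` \<sigma>)" 
      by (rule inj_on_inverseI[where g = ?h]) (use gh that in auto)
    then show "distinct (srt \<sigma>)" using that by (simp add: srt_def distinct_map)
    show "set (srt \<sigma>) = \<sigma>" using that gh by (force simp: srt_def image_image)
  qed
  have 2: "srt (set (omit k (srt \<sigma>))) = omit k (srt \<sigma>)" if fin: "finite \<sigma>" and sub: "\<sigma> \<subseteq> V" for \<sigma> k
  proof -
    let ?l = "omit k (sorted_list_of_set (?h ` \<sigma>))"
    have l: "set ?l \<subseteq> ?h ` \<sigma>" using set_omit[of k "sorted_list_of_set (?h ` \<sigma>)"] fin by simp
    have "?h (?g i) = i" if "i \<in> set ?l" for i
    proof -
      obtain v where "v \<in> \<sigma>" "i = ?h v" using \<open>i \<in> set ?l\<close> l by blast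
      then show ?thesis using gh sub by auto
    qed
    then have "?h ` ?g ` set ?l = set ?l" by (force simp: image_image)
    moreover have "sorted ?l" "distinct ?l" by (simp_all add: sorted_omit distinct_omit)
    then have "sorted_list_of_set (set ?l) = ?l"
      by (rule sorted_list_of_set.idem_if_sorted_distinct)
    ultimately show ?thesis by (simp add: srt_def omit_map)
  qed
  show ?thesis using that[of srt] 1 2 by blast
qed

context oriented_complex
begin

text \<open>The singular filling \<open>w\<close> has to be subdivided before it can be collapsed to
  vertices, and its boundary \<open>c\<close> is subdivided with it. That the collapse nevertheless
  returns \<open>z\<close> is \<open>vertex_chain_subdivision_affine_simplex\<close>.\<close>

lemma integral_cycle_is_boundary:
  assumes contr: "contractible_space (geometric_realization X)" and ctb: "countable (\<Union>X)"
    and keys: "Poly_Mapping.keys z \<subseteq> simplices X (Suc p)"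
    and int: "\<And>\<sigma>. Poly_Mapping.lookup z \<sigma> \<in> \<int>" and cycle: "boundary z = 0"
  obtains e where "Poly_Mapping.keys e \<subseteq> simplices X (Suc (Suc p))" "boundary e = z"
proof -
  let ?T = "geometric_realization X"
  obtain srt where srt0: "\<And>\<sigma>. finite \<sigma> \<Longrightarrow> \<sigma> \<subseteq> \<Union>X \<Longrightarrow> distinct (srt \<sigma>) \<and> set (srt \<sigma>) = \<sigma>"
    "\<And>\<sigma> k. finite \<sigma> \<Longrightarrow> \<sigma> \<subseteq> \<Union>X \<Longrightarrow> srt (set (omit k (srt \<sigma>))) = omit k (srt \<sigma>)"
    using vertex_ordering[OF ctb] by blast
  have srt: "distinct (srt \<sigma>)" "set (srt \<sigma>) = \<sigma>" "srt (set (omit k (srt \<sigma>))) = omit k (srt \<sigma>)" "srt \<sigma> \<noteq> []"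
    if "\<sigma> \<in> X" for \<sigma> k
  proof -
    have "finite \<sigma>" "\<sigma> \<subseteq> \<Union>X" "\<sigma> \<noteq> {}" using finite_simplex nonempty_simplex that by blast+
    then show "distinct (srt \<sigma>)" "set (srt \<sigma>) = \<sigma>" "srt (set (omit k (srt \<sigma>))) = omit k (srt \<sigma>)" "srt \<sigma> \<noteq> []"
      using srt0[of \<sigma>] by auto
  qed
  define s where "s \<sigma> = orientation_sign ori (srt \<sigma>)" for \<sigma>
  have s2: "s \<sigma> * s \<sigma> = 1" for \<sigma> by (simp add: s_def orientation_sign_def)
  have oriented_simplex_srt: "oriented_simplex (srt \<sigma>) = Poly_Mapping.single \<sigma> (s \<sigma>)" if "\<sigma> \<in> X" for \<sigma>
    using srt[OF that] that by (simp add: oriented_simplex_def s_def)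
  have keysX: "\<sigma> \<in> X" "length (srt \<sigma>) = Suc (Suc p)" if "\<sigma> \<in> Poly_Mapping.keys z" for \<sigma>
  proof -
    show *: "\<sigma> \<in> X" using that keys by (auto simp: simplices_def)
    have "card \<sigma> = Suc (Suc p)" using that keys by (auto simp: simplices_def)
    then show "length (srt \<sigma>) = Suc (Suc p)" using srt[OF *] distinct_card by metis
  qed
  \<comment> \<open>The sign \<open>s \<sigma>\<close> passes from the orientation chosen by
    \<open>ori\<close> to the one given by the order of the vertices.\<close>
  define J where "J = linear_ext (\<lambda>\<sigma>. Poly_Mapping.single (affine_simplex (srt \<sigma>)) (s \<sigma>))"
  have J_oriented_simplex: "J (oriented_simplex (srt \<sigma>)) = Poly_Mapping.single (affine_simplex (srt \<sigma>)) 1" if "\<sigma> \<in> X" for \<sigma>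
    by (simp add: J_def oriented_simplex_srt[OF that] s2)
  have "Poly_Mapping.lookup (J z) x \<in> \<int>" for x
    unfolding J_def lookup_linear_ext
    by (intro Ints_sum Ints_mult int) (auto simp: lookup_single when_def s_def orientation_sign_def)
  then obtain c where c: "real_chain c = J z" using real_chain_ex by blast
  have keysc: "Poly_Mapping.keys c \<subseteq> (\<lambda>\<sigma>. affine_simplex (srt \<sigma>)) ` Poly_Mapping.keys z"
  proof -
    have "Poly_Mapping.keys (J z) \<subseteq> (\<lambda>\<sigma>. affine_simplex (srt \<sigma>)) ` Poly_Mapping.keys z"
      unfolding J_def by (intro order.trans[OF keys_linear_ext]) (auto split: if_splits)
    then show ?thesis using keys_real_chain[of c] c by simp
  qed
  have affine_simplex_srt: "singular_simplex (Suc p) ?T (affine_simplex (srt \<sigma>))" if "\<sigma> \<in> Poly_Mapping.keys z" for \<sigma>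
    using singular_simplex_affine_simplex[of "srt \<sigma>" X] srt[OF keysX(1)[OF that]] keysX[OF that] by simp
  then have chain: "singular_chain (Suc p) ?T c"
    using keysc by (auto simp: singular_chain_def)
  have bd: "real_chain (chain_boundary (Suc p) (frag_of (affine_simplex (srt \<sigma>)))) = J (boundary (oriented_simplex (srt \<sigma>)))"
    if z: "\<sigma> \<in> Poly_Mapping.keys z" for \<sigma>
  proof -
    let ?xs = "srt \<sigma>"
    have "real_chain (chain_boundary (Suc p) (frag_of (affine_simplex ?xs)))
        = linear_ext (\<lambda>s. Poly_Mapping.single s 1) (real_chain (chain_boundary (Suc p) (frag_of (affine_simplex ?xs))))"
      by (simp add: linear_ext_ident)
    also have "\<dots> = linear_ext (\<lambda>s. alt_sum ?xs (\<lambda>ys. Poly_Mapping.single (affine_simplex ys) 1)) (real_chain (frag_of (affine_simplex ?xs)))"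
      by (rule linear_ext_chain_boundary[where ls = "\<lambda>_. ?xs"])
         (use keysX[OF z] in \<open>auto simp: keys_frag_of singular_face_affine_simplex\<close>)
    also have "\<dots> = alt_sum ?xs (\<lambda>ys. Poly_Mapping.single (affine_simplex ys) 1)" by simp
    \<comment> \<open>The coherence of the ordering enters here: a face \<open>omit i ?xs\<close> is
      its own ordered list.\<close>
    also have "\<dots> = alt_sum ?xs (\<lambda>ys. J (oriented_simplex ys))"
    proof (rule alt_sum_cong)
      fix i assume "i < length ?xs"
      then have "omit i ?xs \<noteq> []" using keysX[OF z] by (auto simp: length_omit simp flip: length_0_conv)
      then have "set (omit i ?xs) \<in> X"
        using face_closed[OF keysX(1)[OF z]] set_omit[of i ?xs] srt[OF keysX(1)[OF z]] by auto
      from J_oriented_simplex[OF this] show "Poly_Mapping.single (affine_simplex (omit i ?xs)) 1 = J (oriented_simplex (omit i ?xs))"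
        using srt[OF keysX(1)[OF z]] by simp
    qed
    also have "\<dots> = J (alt_sum ?xs oriented_simplex)" by (simp add: alt_sum_conv J_def linear_ext_sum linear_ext_smul)
    also have "alt_sum ?xs oriented_simplex = boundary (oriented_simplex ?xs)"
      using boundary_oriented_simplex[of ?xs] srt[OF keysX(1)[OF z]] keysX[OF z] by simp
    finally show ?thesis .
  qed
  have "real_chain (chain_boundary (Suc p) c)
      = linear_ext (\<lambda>x. real_chain (chain_boundary (Suc p) (frag_of x))) (real_chain c)"
    by (simp only: chain_boundary_Suc real_chain_frag_extend frag_extend_of)
  also have "\<dots> = linear_ext (\<lambda>\<sigma>. smul (s \<sigma>) (real_chain (chain_boundary (Suc p) (frag_of (affine_simplex (srt \<sigma>)))))) z"
    unfolding c J_def linear_ext_linear_ext by simp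
  also have "\<dots> = linear_ext (\<lambda>\<sigma>. J (simplicial_boundary ori \<sigma>)) z"
    by (rule linear_ext_cong) (simp add: bd oriented_simplex_srt keysX boundary_def J_def linear_ext_smul s2)
  also have "\<dots> = J (boundary z)" by (simp add: J_def boundary_def linear_ext_linear_ext)
  finally have "real_chain (chain_boundary (Suc p) c) = real_chain 0" by (simp add: cycle J_def)
  then have "chain_boundary (Suc p) c = 0" by (rule real_chain_inj)
  then have "singular_relcycle (Suc p) ?T {} c" using chain by (simp add: singular_cycle)
  then obtain w where w: "singular_chain (Suc (Suc p)) ?T w" "chain_boundary (Suc (Suc p)) w = c"
    by (rule contractible_cycle_is_boundary[OF contr]) simp
  have op: "openin ?T U" if "U \<in> peak_set X ` X" for U using that openin_peak_set[OF X] by blast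
  \<comment> \<open>After \<open>m\<close> subdivisions every piece of \<open>w\<close> lies in a
    single peak set.\<close>
  obtain m where "\<And>m' f. m \<le> m' \<Longrightarrow>
      f \<in> Poly_Mapping.keys ((singular_subdivision (Suc (Suc p)) ^^ m') w)
      \<Longrightarrow> \<exists>V\<in>peak_set X ` X. f \<in> standard_simplex (Suc (Suc p)) \<rightarrow> V"
    by (rule sufficient_iterated_singular_subdivision_exists[OF op peak_sets_cover[OF X] w(1)])
       (assumption, erule that)
  note m = this[OF order_refl]
  define e where "e = vertex_chain (Suc (Suc p)) ((singular_subdivision (Suc (Suc p)) ^^ m) w)"
  have inX: "set (corner_peaks (Suc (Suc p)) f) \<in> X"
    if f: "f \<in> Poly_Mapping.keys ((singular_subdivision (Suc (Suc p)) ^^ m) w)" for f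
  proof -
    obtain \<sigma> where \<sigma>: "\<sigma> \<in> X" "f \<in> standard_simplex (Suc (Suc p)) \<rightarrow> peak_set X \<sigma>"
      using m[OF f] by blast
    have "set (corner_peaks (Suc (Suc p)) f) \<subseteq> \<sigma>"
      using \<sigma> by (intro set_corner_peaks peak_in_peak_set[OF X]) auto
    moreover have "set (corner_peaks (Suc (Suc p)) f) \<noteq> {}"
      using length_corner_peaks[of "Suc (Suc p)" f] by (metis length_0_conv nat.distinct(1) set_empty)
    ultimately show ?thesis using \<sigma> face_closed by blast
  qed
  have "boundary e = vertex_chain (Suc p) (chain_boundary (Suc (Suc p)) ((singular_subdivision (Suc (Suc p)) ^^ m) w))"
    unfolding e_def by (rule boundary_vertex_chain) (rule inX)
  also have "\<dots> = vertex_chain (Suc p) ((singular_subdivision (Suc p) ^^ m) c)"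
    using chain_boundary_subdivision_power[OF w(1), of m] w(2) by simp
  also have "\<dots> = linear_ext (\<lambda>x. vertex_chain (Suc p) ((singular_subdivision (Suc p) ^^ m) (frag_of x))) (J z)"
    by (subst vertex_chain_subdivision) (simp only: c)
  also have "\<dots> = linear_ext (\<lambda>\<sigma>. smul (s \<sigma>) (vertex_chain (Suc p) ((singular_subdivision (Suc p) ^^ m) (frag_of (affine_simplex (srt \<sigma>)))))) z"
    unfolding J_def linear_ext_linear_ext by simp
  also have "\<dots> = linear_ext (\<lambda>\<sigma>. Poly_Mapping.single \<sigma> 1) z"
  proof (rule linear_ext_cong)
    fix \<sigma> assume z: "\<sigma> \<in> Poly_Mapping.keys z"
    have "vertex_chain (Suc p) ((singular_subdivision (Suc p) ^^ m) (frag_of (affine_simplex (srt \<sigma>)))) = oriented_simplex (srt \<sigma>)"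
      using srt[OF keysX(1)[OF z]] keysX[OF z] by (intro vertex_chain_subdivision_affine_simplex) auto
    then show "smul (s \<sigma>) (vertex_chain (Suc p) ((singular_subdivision (Suc p) ^^ m) (frag_of (affine_simplex (srt \<sigma>)))))
        = Poly_Mapping.single \<sigma> 1"
      by (simp add: oriented_simplex_srt[OF keysX(1)[OF z]] s2)
  qed
  finally have "boundary e = z" by (simp add: linear_ext_ident)
  moreover have "Poly_Mapping.keys e \<subseteq> simplices X (Suc (Suc p))"
  proof -
    have "Poly_Mapping.keys (oriented_simplex (corner_peaks (Suc (Suc p)) f)) \<subseteq> simplices X (Suc (Suc p))" for f
      using keys_oriented_simplex[of "corner_peaks (Suc (Suc p)) f"] by (auto simp: simplices_def)
    then show ?thesis unfolding e_def vertex_chain_def by (intro order.trans[OF keys_linear_ext]) blast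
  qed
  ultimately show ?thesis using that by blast
qed

end

section \<open>From integer to real coefficients\<close>

lemma common_denominator:
  assumes "finite A" "\<And>x. x \<in> A \<Longrightarrow> q x \<in> \<rat>"
  obtains N :: nat where "N > 0" "\<And>x. x \<in> A \<Longrightarrow> real N * q x \<in> \<int>"
proof -
  have "\<exists>N::nat. N > 0 \<and> (\<forall>x\<in>A. real N * q x \<in> \<int>)" using assms
  proof (induction A rule: finite_induct)
    case empty
    then show ?case by auto
  next
    case (insert a A)
    then obtain N where N: "N > 0" "\<forall>x\<in>A. real N * q x \<in> \<int>" by auto
    obtain i j where ij: "j > 0" "q a = real_of_int i / real_of_int j"
      using insert.prems[of a] by (metis Rats_cases' insertI1)
    have "real (nat j * N) * q a = real N * real_of_int i" using ij by simp
    moreover have "real N * real_of_int i \<in> \<int>" by (intro Ints_mult Ints_of_nat Ints_of_int)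
    moreover have "real (nat j * N) * q x \<in> \<int>" if "x \<in> A" for x
    proof -
      have "real N * q x \<in> \<int>" using N that by blast
      then have "real (nat j) * (real N * q x) \<in> \<int>" by (rule Ints_mult[OF Ints_of_nat])
      then show ?thesis by (simp add: mult.assoc)
    qed
    ultimately show ?case using N ij by (intro exI[of _ "nat j * N"]) auto
  qed
  then show ?thesis using that by blast
qed

text \<open>The solution space of a homogeneous linear system with integer coefficients is spanned by
  integer solutions: expand a real solution in a basis of the \<open>\<rat>\<close>-span of its entries.\<close>

lemma integral_kernel_induct:
  fixes f :: "'a \<Rightarrow> ('b \<Rightarrow>\<^sub>0 real)"
  assumes int: "\<And>x y. Poly_Mapping.lookup (f x) y \<in> \<int>"
    and z: "Poly_Mapping.keys z \<subseteq> S" "linear_ext f z = 0"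
    and zero: "P 0" and add: "\<And>a b. P a \<Longrightarrow> P b \<Longrightarrow> P (a + b)" and smul: "\<And>r a. P a \<Longrightarrow> P (smul r a)"
    and base: "\<And>w. Poly_Mapping.keys w \<subseteq> S \<Longrightarrow> linear_ext f w = 0
      \<Longrightarrow> (\<And>x. Poly_Mapping.lookup w x \<in> \<int>) \<Longrightarrow> P w"
  shows "P z"
proof -
  interpret Q: vector_space "\<lambda>(q::rat) (x::real). of_rat q * x"
    by unfold_locales (simp_all add: of_rat_add of_rat_mult algebra_simps)
  let ?K = "Poly_Mapping.keys z" and ?z = "Poly_Mapping.lookup z"
  obtain B where B: "B \<subseteq> ?z ` ?K" "Q.independent B" "?z ` ?K \<subseteq> Q.span B"
    using Q.maximal_independent_subset by blast
  have finB: "finite B" using B(1) by (rule finite_subset) simp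
  define q where "q x b = real_of_rat (Q.representation B (?z x) b)" for x b
  have zx: "?z x = (\<Sum>b\<in>B. q x b * b)" if "x \<in> ?K" for x
    unfolding q_def
    using Q.sum_representation_eq[OF B(2) _ finB order_refl, of "?z x"] B(3) that by auto
  define w where "w b = (\<Sum>x\<in>?K. Poly_Mapping.single x (q x b))" for b
  have lw: "Poly_Mapping.lookup (w b) x = (if x \<in> ?K then q x b else 0)" for b x
    by (simp add: w_def lookup_sum lookup_single when_def)
  then have keysw: "Poly_Mapping.keys (w b) \<subseteq> ?K" for b
    by (auto simp: in_keys_iff split: if_splits)
  \<comment> \<open>Because \<open>f\<close> has integer coefficients, each coordinate of
    \<open>linear_ext f z = 0\<close> is a relation between the elements of \<open>B\<close> with
    rational coefficients \<open>u b\<close>. Independence of \<open>B\<close> makes every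
    \<open>u b\<close> vanish, which is the same equation for \<open>w b\<close>.\<close>
  have wz: "linear_ext f (w b) = 0" if "b \<in> B" for b
  proof (rule poly_mapping_eqI)
    fix y
    define m where "m x = (THE i. Poly_Mapping.lookup (f x) y = real_of_int i)" for x
    have m: "Poly_Mapping.lookup (f x) y = of_int (m x)" for x
      using int[of x y] unfolding m_def by (auto elim!: Ints_cases)
    define u where "u b = (\<Sum>x\<in>?K. Q.representation B (?z x) b * of_int (m x))" for b
    have ru: "real_of_rat (u b) = (\<Sum>x\<in>?K. q x b * Poly_Mapping.lookup (f x) y)" for b
      by (simp add: u_def q_def m of_rat_sum of_rat_mult)
    have "0 = (\<Sum>x\<in>?K. ?z x * Poly_Mapping.lookup (f x) y)"
      using arg_cong[OF z(2), of "\<lambda>c. Poly_Mapping.lookup c y"] by (simp add: lookup_linear_ext)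
    also have "\<dots> = (\<Sum>x\<in>?K. (\<Sum>b\<in>B. q x b * b) * Poly_Mapping.lookup (f x) y)"
      by (intro sum.cong refl) (simp add: zx)
    also have "\<dots> = (\<Sum>b\<in>B. of_rat (u b) * b)"
      unfolding ru sum_distrib_right
      by (subst sum.swap) (simp add: mult_ac)
    finally have "u b = 0"
      using Q.independentD[OF B(2) finB order_refl] that by metis
    then have "(\<Sum>x\<in>?K. q x b * Poly_Mapping.lookup (f x) y) = 0" using ru[of b] by simp
    then show "Poly_Mapping.lookup (linear_ext f (w b)) y = Poly_Mapping.lookup 0 y"
      by (simp add: linear_ext_superset[OF finite_keys keysw] lookup_sum lw)
  qed
  have Pw: "P (w b)" if "b \<in> B" for b
  proof -
    have "q x b \<in> \<rat>" for x by (simp add: q_def)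
    then obtain N where N: "N > 0" "\<And>x. x \<in> ?K \<Longrightarrow> real N * q x b \<in> \<int>"
      using common_denominator[of ?K "\<lambda>x. q x b"] finite_keys by blast
    have "P (smul (real N) (w b))"
      by (rule base) (use N keys_smul[of "real N" "w b"] keysw[of b] z(1) in
        \<open>auto simp: linear_ext_smul wz that lw\<close>)
    then have "P (smul (1 / real N) (smul (real N) (w b)))" by (rule smul)
    then show ?thesis using N by simp
  qed
  have "P (\<Sum>b\<in>B'. smul b (w b))" if "finite B'" "B' \<subseteq> B" for B'
    using that by (induction B' rule: finite_induct) (auto intro: zero add smul Pw)
  then have "P (\<Sum>b\<in>B. smul b (w b))" using finB by simp
  moreover have "(\<Sum>b\<in>B. smul b (w b)) = z"
  proof (rule poly_mapping_eqI)
    fix x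
    show "Poly_Mapping.lookup (\<Sum>b\<in>B. smul b (w b)) x = ?z x"
    proof (cases "x \<in> ?K")
      case True
      then show ?thesis by (simp add: lookup_sum lw zx[OF True] mult.commute)
    next
      case False
      then show ?thesis by (simp add: lookup_sum lw in_keys_iff)
    qed
  qed
  ultimately show ?thesis by simp
qed

section \<open>Connectedness, countability and cycles in degree 0\<close>

lemma edge_connected:
  assumes X: "abstract_complex X" and conn: "connected_space (geometric_realization X)"
    and u: "u \<in> \<Union>X" and v: "v \<in> \<Union>X"
  shows "(u, v) \<in> {(a, b). {a, b} \<in> X}\<^sup>*"
proof (rule ccontr)
  let ?E = "{(a, b). {a, b} \<in> X}" and ?T = "geometric_realization X"
  assume v': "(u, v) \<notin> ?E\<^sup>*"
  have face: "\<rho> \<in> X" if "\<sigma> \<in> X" "\<rho> \<subseteq> \<sigma>" "\<rho> \<noteq> {}" for \<sigma> \<rho>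
    using X that unfolding abstract_complex_def by blast
  have fin: "finite \<sigma>" if "\<sigma> \<in> X" for \<sigma> using X that unfolding abstract_complex_def by blast
  define C where "C = {w. (u, w) \<in> ?E\<^sup>*}"
  define U where "U D = {p \<in> topspace ?T. \<exists>w\<in>D. 0 < p w}" for D
  have op: "openin ?T (U D)" for D
    unfolding openin_geometric_realization
  proof (intro conjI ballI)
    show "U D \<subseteq> (\<Union>\<sigma>\<in>X. geometric_simplex \<sigma>)" by (auto simp: U_def topspace_geometric_realization)
    fix \<tau> assume "\<tau> \<in> X"
    then have "U D \<inter> geometric_simplex \<tau> = geometric_simplex \<tau> \<inter> (\<Union>w\<in>D. {p. 0 < p w})"
      by (auto simp: U_def topspace_geometric_realization)
    moreover have "open (\<Union>w\<in>D. {p :: 'a \<Rightarrow> real. 0 < p w})"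
      by (intro open_UN ballI open_Collect_less continuous_intros continuous_on_product_coordinates)
    ultimately show "openin (subtopology (powertop_real UNIV) (geometric_simplex \<tau>)) (U D \<inter> geometric_simplex \<tau>)"
      by (auto simp: openin_subtopology euclidean_product_topology)
  qed
  have vertex: "U D \<noteq> {}" if "w \<in> D" "w \<in> \<Union>X" for w D
  proof -
    have "{w} \<in> X" using that face by blast
    moreover have "(\<lambda>x. if x = w then 1 else 0) \<in> geometric_simplex {w}"
      by (auto simp: geometric_simplex_def)
    ultimately have "(\<lambda>x. if x = w then 1 else 0) \<in> U D"
      using that(1) by (force simp: U_def topspace_geometric_realization)
    then show ?thesis by blast
  qed
  \<comment> \<open>Every point has a positive coordinate, and two vertices with positive
    coordinates at the same point lie in one simplex, hence are joined by an edge. So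
    \<open>U C\<close> and \<open>U (- C)\<close> separate the realization.\<close>
  have "topspace ?T \<subseteq> U C \<union> U (- C)"
  proof
    fix p assume p: "p \<in> topspace ?T"
    then obtain \<sigma> where "\<sigma> \<in> X" "p \<in> geometric_simplex \<sigma>" by (auto simp: topspace_geometric_realization)
    then obtain w where "0 < p w" using geometric_simplex_max fin by blast
    then show "p \<in> U C \<union> U (- C)" using p by (auto simp: U_def)
  qed
  moreover have "U C \<inter> U (- C) = {}"
  proof (rule ccontr)
    assume "U C \<inter> U (- C) \<noteq> {}"
    then obtain p w x where p: "p \<in> topspace ?T" "w \<in> C" "0 < p w" "x \<notin> C" "0 < p x"
      by (auto simp: U_def)
    then obtain \<sigma> where \<sigma>: "\<sigma> \<in> X" "p \<in> geometric_simplex \<sigma>" by (auto simp: topspace_geometric_realization)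
    have "w \<in> \<sigma>" "x \<in> \<sigma>" using p \<sigma>(2) by (auto simp: geometric_simplex_def)
    then have "(w, x) \<in> ?E" using face[OF \<sigma>(1), of "{w, x}"] by simp
    then have "x \<in> C" using p(2) unfolding C_def by (simp add: rtrancl.rtrancl_into_rtrancl)
    then show False using p by simp
  qed
  moreover have "u \<in> C" "v \<in> - C" using v' by (auto simp: C_def)
  ultimately show False
    using conn op[of C] op[of "- C"] vertex[OF \<open>u \<in> C\<close> u] vertex[OF \<open>v \<in> - C\<close> v]
    unfolding connected_space_def by blast
qed

text \<open>Local finiteness leaves each vertex finitely many neighbours, so what can be reached
  from one vertex along edges is countable.\<close>

lemma countable_vertices:
  assumes X: "abstract_complex X" and conn: "connected_space (geometric_realization X)"
    and lf: "locally_finite_complex X"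
  shows "countable (\<Union>X)"
proof (cases "\<Union>X = {}")
  case False
  then obtain u where u: "u \<in> \<Union>X" by blast
  let ?E = "{(a, b). {a, b} \<in> X}"
  have fin: "finite (?E `` {v})" for v
  proof (cases "v \<in> \<Union>X")
    case True
    have "finite {\<sigma> \<in> X. v \<in> \<sigma>}" using lf True unfolding locally_finite_complex_def by blast
    moreover have "\<sigma> \<in> X \<Longrightarrow> finite \<sigma>" for \<sigma> using X unfolding abstract_complex_def by blast
    ultimately have "finite (\<Union>{\<sigma> \<in> X. v \<in> \<sigma>})" by auto
    then show ?thesis by (rule rev_finite_subset) auto
  next
    case False
    then have "?E `` {v} = {}" by auto
    then show ?thesis by (metis finite.emptyI)
  qed
  have "countable (?E `` Y)" if "countable Y" for Y
  proof -
    have "?E `` Y = (\<Union>v\<in>Y. ?E `` {v})" by blast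
    then show ?thesis using that fin by (metis (no_types, lifting) countable_UN countable_finite)
  qed
  then have "countable (?E\<^sup>* `` {u})" by (intro countable_rtrancl) auto
  moreover have "\<Union>X \<subseteq> ?E\<^sup>* `` {u}" using edge_connected[OF X conn u] by auto
  ultimately show ?thesis by (rule countable_subset[rotated])
next
  case True
  then show ?thesis by (metis countable_empty)
qed

context oriented_complex
begin

definition bounds :: "nat \<Rightarrow> ('v set \<Rightarrow>\<^sub>0 real) \<Rightarrow> bool" where
  "bounds p z \<longleftrightarrow> (\<exists>e. Poly_Mapping.keys e \<subseteq> simplices X p \<and> boundary e = z)"

lemma bounds_0: "bounds p 0"
  unfolding bounds_def by (intro exI[of _ 0]) (simp add: boundary_def)

lemma bounds_add:
  assumes "bounds p a" "bounds p b"
  shows "bounds p (a + b)"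
proof -
  obtain e e' where "Poly_Mapping.keys e \<subseteq> simplices X p" "boundary e = a"
    "Poly_Mapping.keys e' \<subseteq> simplices X p" "boundary e' = b"
    using assms unfolding bounds_def by blast
  then have "Poly_Mapping.keys (e + e') \<subseteq> simplices X p" "boundary (e + e') = a + b"
    using keys_add[of e e'] by (auto simp: boundary_def linear_ext_add)
  then show ?thesis unfolding bounds_def by blast
qed

lemma bounds_smul:
  assumes "bounds p a"
  shows "bounds p (smul r a)"
proof -
  obtain e where "Poly_Mapping.keys e \<subseteq> simplices X p" "boundary e = a"
    using assms unfolding bounds_def by blast
  then have "Poly_Mapping.keys (smul r e) \<subseteq> simplices X p" "boundary (smul r e) = smul r a"
    using keys_smul[of r e] by (auto simp: boundary_def linear_ext_smul)
  then show ?thesis unfolding bounds_def by blast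
qed

lemma oriented_simplex_singleton: "v \<in> \<Union>X \<Longrightarrow> oriented_simplex [v] = Poly_Mapping.single {v} 1"
proof -
  assume "v \<in> \<Union>X"
  then have v: "{v} \<in> X" using face_closed by blast
  obtain xs where xs: "distinct xs" "set xs = {v}" "ori {v} = {ys. even_reordering xs ys}"
    using ori[OF v] by blast
  then have "length xs = 1" using distinct_card[of xs] by simp
  then have "xs = [v]" using xs(2) by (cases xs) auto
  moreover have "even_reordering xs xs" unfolding even_reordering_def
    by (rule exI[of _ id]) (auto simp: evenperm_id permutes_id)
  ultimately show ?thesis using v xs(3) by (simp add: oriented_simplex_def orientation_sign_def)
qed

text \<open>The boundary of every vertex is the same nonzero multiple of the empty simplex, so a
  cycle has coefficient sum 0. It is therefore a combination of differences \<open>v - u\<close>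
  with \<open>u\<close> fixed, and each of these is the boundary of an edge path.\<close>

lemma degree_0_cycle_is_boundary:
  assumes conn: "connected_space (geometric_realization X)"
    and keys: "Poly_Mapping.keys z \<subseteq> simplices X 0" and cycle: "boundary z = 0"
  shows "bounds 1 z"
proof (cases "z = 0")
  case True
  then show ?thesis by (simp only: bounds_0)
next
  case False
  have single: "\<exists>v\<in>\<Union>X. \<sigma> = {v}" if "\<sigma> \<in> Poly_Mapping.keys z" for \<sigma>
    using that keys by (fastforce simp: simplices_def card_1_singleton_iff)
  have "Poly_Mapping.keys z \<noteq> {}" using False by simp
  then obtain \<sigma> where "\<sigma> \<in> Poly_Mapping.keys z" by blast
  from single[OF this] obtain u where u: "u \<in> \<Union>X" by (elim bexE)
  have path: "bounds 1 (Poly_Mapping.single {v} 1 - Poly_Mapping.single {u} 1)" if "v \<in> \<Union>X" for v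
    using edge_connected[OF X conn u that]
  proof (induction rule: rtrancl_induct)
    case base
    then show ?case by (simp add: bounds_0)
  next
    case (step a b)
    then have ab: "{a, b} \<in> X" by simp
    have "bounds 1 (Poly_Mapping.single {b} 1 - Poly_Mapping.single {a} 1)"
    proof (cases "a = b")
      case False
      have "boundary (oriented_simplex [a, b]) = Poly_Mapping.single {b} 1 - Poly_Mapping.single {a} 1"
        using boundary_oriented_simplex[of "[a, b]"] ab oriented_simplex_singleton[of a] oriented_simplex_singleton[of b] by force
      moreover have "Poly_Mapping.keys (oriented_simplex [a, b]) \<subseteq> simplices X 1"
        using keys_oriented_simplex[of "[a, b]"] by (auto simp: simplices_def)
      ultimately show ?thesis unfolding bounds_def by blast
    qed (simp add: bounds_0)
    from bounds_add[OF this step.IH] show ?case by simp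
  qed
  have bd: "simplicial_boundary ori \<sigma> = oriented_simplex []" if "\<sigma> \<in> Poly_Mapping.keys z" for \<sigma>
  proof -
    from single[OF that] obtain v where v: "v \<in> \<Union>X" "\<sigma> = {v}" by (elim bexE)
    then have "{v} \<in> X" using face_closed by blast
    then show ?thesis using boundary_oriented_simplex[of "[v]"] oriented_simplex_singleton[OF v(1)] v by (simp add: boundary_def)
  qed
  have "linear_ext (\<lambda>_. oriented_simplex []) z = boundary z" unfolding boundary_def by (rule linear_ext_cong) (simp add: bd)
  then have "Poly_Mapping.lookup (linear_ext (\<lambda>_. oriented_simplex []) z) {} = 0" by (simp add: cycle)
  then have "(\<Sum>\<sigma>\<in>Poly_Mapping.keys z. Poly_Mapping.lookup z \<sigma>) * orientation_sign ori [] = 0"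
    by (simp add: lookup_linear_ext oriented_simplex_def sum_distrib_right)
  then have sum0: "(\<Sum>\<sigma>\<in>Poly_Mapping.keys z. Poly_Mapping.lookup z \<sigma>) = 0"
    by (simp add: orientation_sign_def split: if_splits)
  let ?R = "\<lambda>A. \<Sum>\<sigma>\<in>A. smul (Poly_Mapping.lookup z \<sigma>) (Poly_Mapping.single \<sigma> 1 - Poly_Mapping.single {u} 1)"
  have "(\<Sum>\<sigma>\<in>Poly_Mapping.keys z. smul (Poly_Mapping.lookup z \<sigma>) (Poly_Mapping.single {u} 1)) = 0"
  proof (rule poly_mapping_eqI)
    show "Poly_Mapping.lookup (\<Sum>\<sigma>\<in>Poly_Mapping.keys z.
        smul (Poly_Mapping.lookup z \<sigma>) (Poly_Mapping.single {u} 1)) \<rho> = Poly_Mapping.lookup 0 \<rho>" for \<rho>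
      by (cases "\<rho> = {u}") (simp_all add: lookup_sum lookup_single sum0)
  qed
  then have "?R (Poly_Mapping.keys z) = linear_ext (\<lambda>\<sigma>. Poly_Mapping.single \<sigma> 1) z"
    by (simp add: linear_ext_def smul_distrib sum_subtractf del: smul_single)
  then have z: "?R (Poly_Mapping.keys z) = z" by (simp add: linear_ext_ident)
  have R: "bounds 1 (?R A)" if "finite A" "A \<subseteq> Poly_Mapping.keys z" for A
    using that
  proof (induction A rule: finite_induct)
    case (insert \<sigma> A)
    obtain v where v: "v \<in> \<Union>X" "\<sigma> = {v}" using single[of \<sigma>] insert.prems by auto
    have "?R (insert \<sigma> A) = smul (Poly_Mapping.lookup z \<sigma>)
        (Poly_Mapping.single {v} 1 - Poly_Mapping.single {u} 1) + ?R A"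
      using insert.hyps v by simp
    moreover have "bounds 1 (?R A)" using insert by blast
    ultimately show ?case by (simp only: bounds_add bounds_smul path[OF v(1)])
  qed (simp add: bounds_0)
  show ?thesis using R[OF finite_keys order_refl] unfolding z .
qed

lemma cycle_is_boundary:
  assumes contr: "contractible_space (geometric_realization X)" and lf: "locally_finite_complex X"
    and keys: "Poly_Mapping.keys z \<subseteq> simplices X p" and cycle: "boundary z = 0"
  shows "bounds (Suc p) z"
proof (cases p)
  case 0
  then show ?thesis
    using degree_0_cycle_is_boundary[OF contractible_imp_connected_space[OF contr]] keys cycle by simp
next
  case (Suc p')
  have ctb: "countable (\<Union>X)"
    by (rule countable_vertices[OF X contractible_imp_connected_space[OF contr] lf])
  \<comment> \<open>Set to 0 outside \<open>X\<close>: integrality is demanded for every \<sigma>,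
    and the description of the boundary by an alternating sum is available only on
    \<open>X\<close>.\<close>
  define bd where "bd \<sigma> = (if \<sigma> \<in> X then simplicial_boundary ori \<sigma> else 0)" for \<sigma>
  have bd: "boundary w = linear_ext bd w" if "Poly_Mapping.keys w \<subseteq> simplices X p" for w
    unfolding boundary_def by (rule linear_ext_cong) (use that in \<open>auto simp: bd_def simplices_def\<close>)
  have int: "Poly_Mapping.lookup (bd \<sigma>) \<rho> \<in> \<int>" for \<sigma> \<rho>
  proof (cases "\<sigma> \<in> X")
    case True
    then obtain xs where "simplicial_boundary ori \<sigma> = alt_sum xs oriented_simplex"
      using simplicial_boundary_oriented_simplex by blast
    moreover have "Poly_Mapping.lookup (oriented_simplex ys) \<rho> \<in> \<int>" for ys
      by (auto simp: oriented_simplex_def lookup_single when_def orientation_sign_def)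
    ultimately show ?thesis using True
      by (auto simp: bd_def alt_sum_conv lookup_sum intro!: Ints_sum Ints_mult Ints_power)
  qed (simp add: bd_def)
  show ?thesis
  proof (rule integral_kernel_induct[OF int keys])
    show "linear_ext bd z = 0" using bd[OF keys] cycle by simp
    show "bounds (Suc p) w" if w: "Poly_Mapping.keys w \<subseteq> simplices X p" "linear_ext bd w = 0"
      "\<And>x. Poly_Mapping.lookup w x \<in> \<int>" for w
    proof -
      have "boundary w = 0" "Poly_Mapping.keys w \<subseteq> simplices X (Suc p')" using that bd[of w] Suc by simp_all
      from integral_cycle_is_boundary[OF contr ctb this(2) w(3) this(1)]
      show ?thesis unfolding bounds_def Suc by metis
    qed
  qed (simp_all add: bounds_0 bounds_add bounds_smul)
qed

end

text \<open>By freeness the group embeds into the countable set of simplices as the orbit of any one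
  of them. Countability keeps the GNS space small enough to fit into \<open>'h\<close>.\<close>

lemma type_F_countable:
  assumes "type_F_complex m X (act :: 'g::group_add \<Rightarrow> 'v \<Rightarrow> 'v)"
  shows "countable (UNIV :: 'g set)"
proof -
  have X: "abstract_complex X" "locally_finite_complex X" "X \<noteq> {}"
    "contractible_space (geometric_realization X)" "simplicial_action X act" "free_action X act"
    using assms by (auto simp: type_F_complex_def)
  have fin: "\<sigma> \<in> X \<Longrightarrow> finite \<sigma>" for \<sigma> using X(1) unfolding abstract_complex_def by blast
  have "countable (\<Union>X)"
    by (rule countable_vertices[OF X(1) contractible_imp_connected_space[OF X(4)] X(2)])
  then have "countable {A. finite A \<and> A \<subseteq> \<Union>X}" by (rule countable_Collect_finite_subset)
  then have ctb: "countable X" by (rule countable_subset[rotated]) (use fin in blast)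
  obtain \<sigma> where \<sigma>: "\<sigma> \<in> X" using X(3) by blast
  have comp: "act (g + h) ` \<sigma> = act g ` act h ` \<sigma>" for g h
    using X(5) \<sigma> unfolding simplicial_action_def image_image by (intro image_cong) auto
  have "inj (\<lambda>g. act g ` \<sigma>)"
  proof (rule injI)
    fix g h assume eq: "act g ` \<sigma> = act h ` \<sigma>"
    have "act (- h + g) ` \<sigma> = act (- h) ` act h ` \<sigma>" by (simp add: comp eq)
    also have "\<dots> = act (- h + h) ` \<sigma>" by (simp only: comp)
    also have "\<dots> = \<sigma>" using X(5) \<sigma> unfolding simplicial_action_def by (auto simp: image_def)
    finally have "- h + g = 0" using X(6) \<sigma> unfolding free_action_def by blast
    then have "h + (- h + g) = h + 0" by (rule arg_cong)
    then show "g = h" by (simp only: add_minus_cancel add_0_right)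
  qed
  moreover have "range (\<lambda>g. act g ` \<sigma>) \<subseteq> X" using X(5) \<sigma> unfolding simplicial_action_def by blast
  then have "countable (range (\<lambda>g. act g ` \<sigma>))" using ctb by (rule countable_subset)
  ultimately show ?thesis using countable_image_inj_on by blast
qed

section \<open>Hilbert spaces and unitary representations\<close>

lemma poly_mapping_additive_induct [case_names single add]:
  fixes p :: "'a \<Rightarrow>\<^sub>0 'b::comm_monoid_add"
  assumes "\<And>g r. P (Poly_Mapping.single g r)" "\<And>a b. P a \<Longrightarrow> P b \<Longrightarrow> P (a + b)"
  shows "P p"
proof -
  have 0: "P 0" using assms(1)[of undefined 0] by simp
  have "P (\<Sum>k\<in>A. Poly_Mapping.single k (Poly_Mapping.lookup p k))" if "finite A" for A
    using that by (induction A rule: finite_induct) (auto intro: assms 0)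
  moreover have "(\<Sum>k\<in>Poly_Mapping.keys p. Poly_Mapping.single k (Poly_Mapping.lookup p k)) = p"
    by (rule poly_mapping_eqI) (auto simp: lookup_sum lookup_single when_def in_keys_iff)
  ultimately show ?thesis by (metis finite_keys)
qed

lemma star_single: "star (Poly_Mapping.single g r) = Poly_Mapping.single (- g) r"
  by (cases "r = 0") (simp_all add: star_def)

lemma star_add: "star (a + b) = star a + star b"
  unfolding star_def
  by (rule setsum_keys_plus_distrib[of "\<lambda>g r. Poly_Mapping.single (- g) r"]) (simp_all add: single_add)

lemma star_zero [simp]: "star 0 = 0"
  by (simp add: star_def)

lemma star_sum: "star (sum f A) = (\<Sum>x\<in>A. star (f x))"
  by (induction A rule: infinite_finite_induct) (auto simp: star_add)

lemma star_star [simp]: "star (star a) = a"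
  by (induction a rule: poly_mapping_additive_induct) (simp_all add: star_single star_add)

lemma star_mult: "star (a * b) = star b * star a"
proof (induction a rule: poly_mapping_additive_induct)
  case (single g r)
  show ?case
    by (induction b rule: poly_mapping_additive_induct)
       (simp_all add: mult_single star_single star_add distrib_left distrib_right minus_add mult.commute)
qed (simp add: star_add distrib_left distrib_right)

lemma star_one [simp]: "star 1 = 1"
  by (simp add: star_single flip: single_one)

lemma dim_star_mat [simp]: "dim_row (star_mat A) = dim_col A" "dim_col (star_mat A) = dim_row A"
  by (simp_all add: star_mat_def)

lemma star_mat_carrier [simp]: "A \<in> carrier_mat m n \<Longrightarrow> star_mat A \<in> carrier_mat n m"
  by (auto intro!: carrier_matI)

lemma star_mat_index [simp]:
  "i < dim_col A \<Longrightarrow> j < dim_row A \<Longrightarrow> star_mat A $$ (i, j) = star (A $$ (j, i))"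
  by (simp add: star_mat_def)

lemma star_mat_star_mat [simp]: "star_mat (star_mat A) = A"
  by (rule eq_matI) auto

lemma star_mat_mult:
  "A \<in> carrier_mat m n \<Longrightarrow> B \<in> carrier_mat n k \<Longrightarrow> star_mat (A * B) = star_mat B * star_mat A"
  by (rule eq_matI) (auto simp: scalar_prod_def star_sum star_mult)

lemma single_0_commute: "Poly_Mapping.single 0 r * a = a * Poly_Mapping.single (0 :: 'g::group_add) (r :: real)"
  by (induction a rule: poly_mapping_additive_induct)
     (simp_all add: mult_single mult.commute distrib_left distrib_right)

lemma scaleR_mat_carrier [simp]: "A \<in> carrier_mat m n \<Longrightarrow> scaleR_mat r A \<in> carrier_mat m n"
  by (simp add: scaleR_mat_def)

lemma scaleR_mat_mult_left:
  "A \<in> carrier_mat m n \<Longrightarrow> B \<in> carrier_mat n k \<Longrightarrow> scaleR_mat r (A * B) = scaleR_mat r A * B"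
  unfolding scaleR_mat_def
  by (rule eq_matI) (auto simp: scalar_prod_def sum_distrib_left mult.assoc)

lemma scaleR_mat_mult_right:
  fixes A :: "'a::group_add group_algebra mat"
  shows "A \<in> carrier_mat m n \<Longrightarrow> B \<in> carrier_mat n k \<Longrightarrow> scaleR_mat r (A * B) = A * scaleR_mat r B"
proof -
  have "Poly_Mapping.single 0 r * (a * b) = a * (Poly_Mapping.single 0 r * b)" for a b :: "'a \<Rightarrow>\<^sub>0 real"
    by (metis mult.assoc single_0_commute)
  then show "A \<in> carrier_mat m n \<Longrightarrow> B \<in> carrier_mat n k \<Longrightarrow> ?thesis"
    unfolding scaleR_mat_def by (intro eq_matI) (auto simp: scalar_prod_def sum_distrib_left)
qed

text \<open>The discriminant argument behind the Cauchy-Schwarz inequalities below. The case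
  \<open>c = 0\<close> is included because the forms on rows may be degenerate.\<close>

lemma quadratic_nonneg:
  fixes a b c :: real
  assumes "\<And>t. 0 \<le> a + 2 * t * b + t\<^sup>2 * c" "0 \<le> c"
  shows "b\<^sup>2 \<le> a * c"
proof (cases "c = 0")
  case True
  have "b = 0"
  proof (rule ccontr)
    assume "b \<noteq> 0"
    \<comment> \<open>At this \<open>t\<close> the expression with \<open>c = 0\<close> takes the
      value -1.\<close>
    then have "2 * (- (a + 1) / (2 * b)) * b = - (a + 1)" by (simp add: field_simps)
    then show False using assms(1)[of "- (a + 1) / (2 * b)"] True by simp
  qed
  then show ?thesis using True by simp
next
  case False
  have "c > 0" using False assms(2) by simp
  have "0 \<le> a - b\<^sup>2 / c"
    using assms(1)[of "- b / c"] \<open>c > 0\<close> by (simp add: field_simps power2_eq_square)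
  then show ?thesis using \<open>c > 0\<close> by (simp add: field_simps)
qed

section \<open>Real inner products and Riesz representation\<close>

context hilbert_space
begin

abbreviation ip :: "'h \<Rightarrow> 'h \<Rightarrow> real" where "ip x y \<equiv> Re (hinner H x y)"

lemma smult_closed' [simp]: "x \<in> carrier H \<Longrightarrow> c \<odot>\<^bsub>H\<^esub> x \<in> carrier H"
  by (rule smult_closed) (simp_all add: class_ring_simps)

lemma hinner_add_right:
  "\<lbrakk>x \<in> carrier H; y \<in> carrier H; z \<in> carrier H\<rbrakk>
    \<Longrightarrow> hinner H z (x \<oplus>\<^bsub>H\<^esub> y) = hinner H z x + hinner H z y"
  by (metis hinner_cnj hinner_add M.add.m_closed complex_cnj_add)

lemma hinner_smult_right:
  "\<lbrakk>x \<in> carrier H; y \<in> carrier H\<rbrakk> \<Longrightarrow> hinner H x (c \<odot>\<^bsub>H\<^esub> y) = cnj c * hinner H x y"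
  by (metis hinner_cnj hinner_smult smult_closed' complex_cnj_mult)

lemma hinner_zero [simp]:
  "x \<in> carrier H \<Longrightarrow> hinner H \<zero>\<^bsub>H\<^esub> x = 0" "x \<in> carrier H \<Longrightarrow> hinner H x \<zero>\<^bsub>H\<^esub> = 0"
  using hinner_add[of "\<zero>\<^bsub>H\<^esub>" "\<zero>\<^bsub>H\<^esub>" x] hinner_add_right[of "\<zero>\<^bsub>H\<^esub>" "\<zero>\<^bsub>H\<^esub>" x] by simp_all

lemma hinner_uminus:
  assumes "x \<in> carrier H" "y \<in> carrier H"
  shows "hinner H (\<ominus>\<^bsub>H\<^esub> x) y = - hinner H x y" "hinner H y (\<ominus>\<^bsub>H\<^esub> x) = - hinner H y x"
  using hinner_add[of "\<ominus>\<^bsub>H\<^esub> x" x y] hinner_add_right[of "\<ominus>\<^bsub>H\<^esub> x" x y] assms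
  by (simp_all add: M.l_neg add_eq_0_iff2)

lemma hinner_minus:
  assumes "x \<in> carrier H" "y \<in> carrier H" "z \<in> carrier H"
  shows "hinner H (x \<ominus>\<^bsub>H\<^esub> y) z = hinner H x z - hinner H y z"
    "hinner H z (x \<ominus>\<^bsub>H\<^esub> y) = hinner H z x - hinner H z y"
  using assms by (simp_all add: a_minus_def hinner_add hinner_add_right hinner_uminus)

lemma hinner_finsum:
  assumes "finite A" "\<And>a. a \<in> A \<Longrightarrow> f a \<in> carrier H" "z \<in> carrier H"
  shows "hinner H (finsum H f A) z = (\<Sum>a\<in>A. hinner H (f a) z)"
  using assms
proof (induction A rule: finite_induct)
  case (insert a A)
  then have "finsum H f (insert a A) = f a \<oplus>\<^bsub>H\<^esub> finsum H f A" by (intro M.finsum_insert) auto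
  moreover have "finsum H f A \<in> carrier H" using insert by (intro M.finsum_closed) auto
  ultimately show ?case using insert by (simp add: hinner_add)
qed simp

lemma vec_eqI:
  assumes "x \<in> carrier H" "y \<in> carrier H" "\<And>z. z \<in> carrier H \<Longrightarrow> hinner H x z = hinner H y z"
  shows "x = y"
proof -
  have "x \<ominus>\<^bsub>H\<^esub> y \<in> carrier H" using assms by simp
  then have "x \<ominus>\<^bsub>H\<^esub> y = \<zero>\<^bsub>H\<^esub>" using assms by (intro hinner_definite) (simp_all add: hinner_minus)
  then show ?thesis using assms by simp
qed

lemma ip_commute: "\<lbrakk>x \<in> carrier H; y \<in> carrier H\<rbrakk> \<Longrightarrow> ip x y = ip y x"
  by (simp add: hinner_cnj[of x y])

lemma ip_definite: "\<lbrakk>x \<in> carrier H; ip x x = 0\<rbrakk> \<Longrightarrow> x = \<zero>\<^bsub>H\<^esub>"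
  using hinner_cnj[of x x] by (intro hinner_definite) (auto simp: complex_eq_iff)

lemma ip_Cauchy_Schwarz:
  assumes "x \<in> carrier H" "y \<in> carrier H"
  shows "(ip x y)\<^sup>2 \<le> ip x x * ip y y"
proof (rule quadratic_nonneg)
  fix t :: real
  let ?v = "x \<oplus>\<^bsub>H\<^esub> (complex_of_real t) \<odot>\<^bsub>H\<^esub> y"
  have "0 \<le> ip ?v ?v" using assms by (intro hinner_nonneg) simp
  also have "ip ?v ?v = ip x x + 2 * t * ip x y + t\<^sup>2 * ip y y"
    using assms ip_commute[of x y]
    by (simp add: hinner_add hinner_add_right hinner_smult hinner_smult_right power2_eq_square algebra_simps)
  finally show "0 \<le> ip x x + 2 * t * ip x y + t\<^sup>2 * ip y y" .
qed (use assms in \<open>simp add: hinner_nonneg\<close>)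

lemma hnorm_sq: "x \<in> carrier H \<Longrightarrow> (hnorm H x)\<^sup>2 = ip x x"
  using hinner_nonneg[of x] by (simp add: hnorm_def)

lemma abs_ip_le: "\<lbrakk>x \<in> carrier H; y \<in> carrier H\<rbrakk> \<Longrightarrow> \<bar>ip x y\<bar> \<le> hnorm H x * hnorm H y"
  using ip_Cauchy_Schwarz[of x y]
  by (simp add: hnorm_def real_sqrt_le_iff flip: real_sqrt_mult real_sqrt_abs)

text \<open>Riesz representation on a real subspace \<open>R\<close> that need not be closed; the second property says
  that the representing vector lies in the closure of \<open>R\<close>.\<close>

lemma riesz_representation:
  assumes R: "R \<subseteq> carrier H" "\<zero>\<^bsub>H\<^esub> \<in> R" "\<And>x y. x \<in> R \<Longrightarrow> y \<in> R \<Longrightarrow> x \<oplus>\<^bsub>H\<^esub> y \<in> R"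
      "\<And>(t::real) x. x \<in> R \<Longrightarrow> complex_of_real t \<odot>\<^bsub>H\<^esub> x \<in> R"
    and l: "\<And>x y. x \<in> R \<Longrightarrow> y \<in> R \<Longrightarrow> l (x \<oplus>\<^bsub>H\<^esub> y) = l x + l y"
      "\<And>(t::real) x. x \<in> R \<Longrightarrow> l (complex_of_real t \<odot>\<^bsub>H\<^esub> x) = t * l x"
    and bound: "\<And>x. x \<in> R \<Longrightarrow> (l x)\<^sup>2 \<le> C * ip x x"
  obtains \<eta> where "\<eta> \<in> carrier H" "\<And>x. x \<in> R \<Longrightarrow> ip \<eta> x = l x"
    "\<And>u. u \<in> carrier H \<Longrightarrow> (\<And>x. x \<in> R \<Longrightarrow> ip x u = 0) \<Longrightarrow> ip \<eta> u = 0"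
proof -
  have [simp]: "x \<in> carrier H" if "x \<in> R" for x using R(1) that by blast
  \<comment> \<open>If \<eta> represents \<open>l\<close>, then \<open>J x\<close> is the squared
    norm of \<open>x - \<eta>\<close> minus that of \<eta>. So \<eta> is sought as the limit of a
    minimizing sequence of \<open>J\<close> in \<open>R\<close>.\<close>
  define J where "J x = ip x x - 2 * l x" for x
  have expand: "ip (x \<oplus>\<^bsub>H\<^esub> complex_of_real t \<odot>\<^bsub>H\<^esub> y) (x \<oplus>\<^bsub>H\<^esub> complex_of_real t \<odot>\<^bsub>H\<^esub> y)
      = ip x x + 2 * t * ip x y + t\<^sup>2 * ip y y" if "x \<in> carrier H" "y \<in> carrier H" for x y t
    using that ip_commute[of x y]
    by (simp add: hinner_add hinner_add_right hinner_smult hinner_smult_right power2_eq_square algebra_simps)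
  have lower: "- \<bar>C\<bar> \<le> J x" if "x \<in> R" for x
  proof -
    have nn: "ip x x \<ge> 0" using that by (simp add: hinner_nonneg)
    have "(l x)\<^sup>2 \<le> \<bar>C\<bar> * ip x x"
      using bound[OF that] mult_right_mono[OF abs_ge_self[of C] nn] by linarith
    then have "\<bar>l x\<bar> \<le> sqrt (\<bar>C\<bar> * ip x x)" by (metis real_sqrt_abs real_sqrt_le_iff)
    then have "\<bar>l x\<bar> \<le> sqrt \<bar>C\<bar> * sqrt (ip x x)" by (simp add: real_sqrt_mult)
    moreover have "0 \<le> (sqrt \<bar>C\<bar> - sqrt (ip x x))\<^sup>2" by simp
    then have "2 * (sqrt \<bar>C\<bar> * sqrt (ip x x)) \<le> \<bar>C\<bar> + ip x x"
      using nn by (simp add: power2_diff)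
    ultimately show ?thesis unfolding J_def by linarith
  qed
  have bdd: "bdd_below (J ` R)" using lower by (auto intro!: bdd_belowI)
  define m where "m = Inf (J ` R)"
  have m_le: "m \<le> J x" if "x \<in> R" for x unfolding m_def using bdd that by (intro cINF_lower)
  have "\<exists>x\<in>R. J x < m + 1 / real (Suc n)" for n
  proof -
    have "\<exists>y\<in>J ` R. y < m + 1 / real (Suc n)"
      unfolding m_def using R(2) by (intro cInf_lessD) auto
    then show ?thesis by blast
  qed
  then obtain s where s: "\<And>n. s n \<in> R" "\<And>n. J (s n) < m + 1 / real (Suc n)" by metis
  have [simp]: "s n \<in> carrier H" for n using s(1) by simp
  \<comment> \<open>Parallelogram law: the squared distance is
    \<open>2 * J (s i) + 2 * J (s j)\<close> minus four times the value of \<open>J\<close> at the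
    midpoint, the linear terms cancelling.\<close>
  have par: "(hnorm H (s i \<ominus>\<^bsub>H\<^esub> s j))\<^sup>2 \<le> 2 / real (Suc i) + 2 / real (Suc j)" for i j
  proof -
    let ?h = "complex_of_real (1 / 2) \<odot>\<^bsub>H\<^esub> (s i \<oplus>\<^bsub>H\<^esub> s j)"
    have "?h \<in> R" using s R by blast
    then have "m \<le> J ?h" by (rule m_le)
    moreover have "l ?h = (l (s i) + l (s j)) / 2" using l(2)[of "s i \<oplus>\<^bsub>H\<^esub> s j" "1/2"] l(1) s R by simp
    moreover have "4 * ip ?h ?h = ip (s i) (s i) + 2 * ip (s i) (s j) + ip (s j) (s j)"
      using ip_commute[of "s i" "s j"]
      by (simp add: hinner_add hinner_add_right hinner_smult hinner_smult_right add_divide_distrib)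
    moreover have "(hnorm H (s i \<ominus>\<^bsub>H\<^esub> s j))\<^sup>2 = ip (s i) (s i) - 2 * ip (s i) (s j) + ip (s j) (s j)"
      using ip_commute[of "s i" "s j"] by (simp add: hnorm_sq hinner_minus)
    ultimately have "(hnorm H (s i \<ominus>\<^bsub>H\<^esub> s j))\<^sup>2 \<le> 2 * J (s i) + 2 * J (s j) - 4 * m"
      by (simp add: J_def)
    also have "\<dots> \<le> 2 * (1 / real (Suc i)) + 2 * (1 / real (Suc j))" using s(2)[of i] s(2)[of j] by linarith
    finally show ?thesis by simp
  qed
  have "\<exists>\<eta>\<in>carrier H. (\<lambda>i. hnorm H (s i \<ominus>\<^bsub>H\<^esub> \<eta>)) \<longlonglongrightarrow> 0"
  proof (rule complete)
    fix e :: real assume "e > 0"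
    then obtain N where N: "1 / real (Suc N) < e\<^sup>2 / 4"
      using nat_approx_posE[of "e\<^sup>2 / 4"] by auto
    show "\<exists>N. \<forall>i\<ge>N. \<forall>j\<ge>N. hnorm H (s i \<ominus>\<^bsub>H\<^esub> s j) < e"
    proof (intro exI allI impI)
      fix i j assume "N \<le> i" "N \<le> j"
      then have "1 / real (Suc i) \<le> 1 / real (Suc N)" "1 / real (Suc j) \<le> 1 / real (Suc N)"
        by (auto intro!: divide_left_mono)
      then have "(hnorm H (s i \<ominus>\<^bsub>H\<^esub> s j))\<^sup>2 < e\<^sup>2" using par[of i j] N by simp
      then show "hnorm H (s i \<ominus>\<^bsub>H\<^esub> s j) < e" using \<open>e > 0\<close> by (simp add: power_less_imp_less_base)
    qed
  qed simp
  then obtain \<eta> where \<eta>: "\<eta> \<in> carrier H" "(\<lambda>i. hnorm H (s i \<ominus>\<^bsub>H\<^esub> \<eta>)) \<longlonglongrightarrow> 0" by blast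
  have lim: "(\<lambda>i. ip (s i) u) \<longlonglongrightarrow> ip \<eta> u" if "u \<in> carrier H" for u
  proof -
    have "norm (ip (s i) u - ip \<eta> u) \<le> hnorm H (s i \<ominus>\<^bsub>H\<^esub> \<eta>) * hnorm H u" for i
      using abs_ip_le[of "s i \<ominus>\<^bsub>H\<^esub> \<eta>" u] that \<eta>(1) by (simp add: hinner_minus)
    then have "\<forall>\<^sub>F i in sequentially. norm (ip (s i) u - ip \<eta> u) \<le> hnorm H (s i \<ominus>\<^bsub>H\<^esub> \<eta>) * hnorm H u"
      by (rule always_eventually[OF allI])
    moreover have "(\<lambda>i. hnorm H (s i \<ominus>\<^bsub>H\<^esub> \<eta>) * hnorm H u) \<longlonglongrightarrow> 0"
      by (rule tendsto_mult_left_zero[OF \<eta>(2)])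
    ultimately have "(\<lambda>i. ip (s i) u - ip \<eta> u) \<longlonglongrightarrow> 0"
      by (rule Lim_null_comparison)
    then show ?thesis by (simp add: LIM_zero_iff)
  qed
  have Jlim: "(\<lambda>i. J (s i)) \<longlonglongrightarrow> m"
  proof (rule tendsto_sandwich)
    show "\<forall>\<^sub>F n in sequentially. m \<le> J (s n)" using m_le s(1) by simp
    show "\<forall>\<^sub>F n in sequentially. J (s n) \<le> m + 1 / real (Suc n)" using s(2) by (simp add: less_imp_le)
    show "(\<lambda>n. m + 1 / real (Suc n)) \<longlonglongrightarrow> m"
      using tendsto_add[OF tendsto_const LIMSEQ_inverse_real_of_nat, of m] by (simp add: inverse_eq_divide)
  qed simp
  \<comment> \<open>The limit \<eta> may lie outside \<open>R\<close>, where \<open>l\<close> has no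
    meaning. The first variation is therefore taken at \<open>s i + t y\<close> and only then passed
    to the limit.\<close>
  have "ip \<eta> y = l y" if y: "y \<in> R" for y
  proof -
    have "0 \<le> 0 + 2 * t * (ip \<eta> y - l y) + t\<^sup>2 * ip y y" for t :: real
    proof -
      have "(\<lambda>i. J (s i) + 2 * t * (ip (s i) y - l y) + t\<^sup>2 * ip y y) \<longlonglongrightarrow> m + 2 * t * (ip \<eta> y - l y) + t\<^sup>2 * ip y y"
        using y by (intro tendsto_intros Jlim lim) simp
      moreover have "m \<le> J (s i) + 2 * t * (ip (s i) y - l y) + t\<^sup>2 * ip y y" for i
      proof -
        have "m \<le> J (s i \<oplus>\<^bsub>H\<^esub> complex_of_real t \<odot>\<^bsub>H\<^esub> y)" using y s R by (intro m_le) blast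
        also have "\<dots> = J (s i) + 2 * t * (ip (s i) y - l y) + t\<^sup>2 * ip y y"
          unfolding J_def using y s R l by (simp add: expand algebra_simps)
        finally show ?thesis .
      qed
      ultimately have "m \<le> m + 2 * t * (ip \<eta> y - l y) + t\<^sup>2 * ip y y"
        by (intro LIMSEQ_le_const) auto
      then show ?thesis by simp
    qed
    then have "(ip \<eta> y - l y)\<^sup>2 \<le> 0 * ip y y" by (rule quadratic_nonneg) (use y in \<open>simp add: hinner_nonneg\<close>)
    then show ?thesis by simp
  qed
  moreover have "ip \<eta> u = 0" if "u \<in> carrier H" "\<And>x. x \<in> R \<Longrightarrow> ip x u = 0" for u
    using lim[OF that(1)] that(2)[OF s(1)] by (simp add: LIMSEQ_const_iff)
  ultimately show ?thesis using that \<eta>(1) by blast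
qed

end

section \<open>Matrices over the group algebra acting on powers of a representation\<close>

locale unitary_rep =
  fixes H :: "'h hilbert" and \<pi> :: "'g::group_add \<Rightarrow> 'h \<Rightarrow> 'h"
  assumes rep: "unitary_representation H \<pi>"

sublocale unitary_rep \<subseteq> hilbert_space H
  using rep by (simp add: unitary_representation_def)

context unitary_rep
begin

lemma pi_closed [simp]: "x \<in> carrier H \<Longrightarrow> \<pi> g x \<in> carrier H"
  using rep unfolding unitary_representation_def unitary_operator_def by (meson bij_betwE)

lemma pi_add: "x \<in> carrier H \<Longrightarrow> y \<in> carrier H \<Longrightarrow> \<pi> g (x \<oplus>\<^bsub>H\<^esub> y) = \<pi> g x \<oplus>\<^bsub>H\<^esub> \<pi> g y"
  and pi_smult: "x \<in> carrier H \<Longrightarrow> \<pi> g (c \<odot>\<^bsub>H\<^esub> x) = c \<odot>\<^bsub>H\<^esub> \<pi> g x"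
  and pi_inner: "x \<in> carrier H \<Longrightarrow> y \<in> carrier H \<Longrightarrow> hinner H (\<pi> g x) (\<pi> g y) = hinner H x y"
  and pi_plus: "x \<in> carrier H \<Longrightarrow> \<pi> (g + h) x = \<pi> g (\<pi> h x)"
  using rep by (simp_all add: unitary_representation_def unitary_operator_def)

text \<open>The operator \<open>\<pi> 0\<close> is idempotent and injective.\<close>

lemma pi_0: "x \<in> carrier H \<Longrightarrow> \<pi> 0 x = x"
proof -
  assume x: "x \<in> carrier H"
  have "inj_on (\<pi> 0) (carrier H)"
    using rep by (simp add: unitary_representation_def unitary_operator_def bij_betw_def)
  moreover have "\<pi> 0 (\<pi> 0 x) = \<pi> 0 x" using pi_plus[OF x, of 0 0] by simp
  ultimately show ?thesis using x by (simp add: inj_on_eq_iff)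
qed

lemma pi_adjoint: "x \<in> carrier H \<Longrightarrow> y \<in> carrier H \<Longrightarrow> hinner H (\<pi> g x) y = hinner H x (\<pi> (- g) y)"
  using pi_inner[of x "\<pi> (- g) y" g] pi_plus[of y g "- g"] by (simp add: pi_0)

abbreviation ra :: "'g group_algebra \<Rightarrow> 'h \<Rightarrow> 'h" where "ra \<equiv> rep_algebra H \<pi>"

lemma ra_closed [simp]: "x \<in> carrier H \<Longrightarrow> ra a x \<in> carrier H"
  unfolding rep_algebra_def by (intro M.finsum_closed) simp

text \<open>Identities for \<open>ra\<close> are proved weakly, after pairing with a vector; this
  replaces \<open>finsum\<close> by ordinary complex sums.\<close>

lemma hinner_ra:
  "x \<in> carrier H \<Longrightarrow> z \<in> carrier H \<Longrightarrow>
    hinner H (ra a x) z = (\<Sum>g\<in>Poly_Mapping.keys a. complex_of_real (Poly_Mapping.lookup a g) * hinner H (\<pi> g x) z)"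
  unfolding rep_algebra_def by (subst hinner_finsum) (simp_all add: hinner_smult)

lemma hinner_ra_plus:
  assumes "x \<in> carrier H" "z \<in> carrier H"
  shows "hinner H (ra (a + b) x) z = hinner H (ra a x) z + hinner H (ra b x) z"
  using assms unfolding hinner_ra[OF assms]
  by (intro setsum_keys_plus_distrib[of "\<lambda>g r. complex_of_real r * hinner H (\<pi> g x) z"])
     (simp_all add: algebra_simps)

lemma hinner_ra_single:
  assumes "x \<in> carrier H" "z \<in> carrier H"
  shows "hinner H (ra (Poly_Mapping.single g r) x) z = complex_of_real r * hinner H (\<pi> g x) z"
  by (cases "r = 0") (simp_all add: hinner_ra[OF assms])

lemma hinner_ra_0: "x \<in> carrier H \<Longrightarrow> z \<in> carrier H \<Longrightarrow> hinner H (ra 0 x) z = 0"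
  by (simp add: hinner_ra)

lemma hinner_ra_sum:
  assumes "x \<in> carrier H" "z \<in> carrier H"
  shows "hinner H (ra (sum f A) x) z = (\<Sum>l\<in>A. hinner H (ra (f l) x) z)"
  by (induction A rule: infinite_finite_induct) (simp_all add: hinner_ra_plus hinner_ra_0 assms)

lemma ra_add:
  assumes "x \<in> carrier H" "y \<in> carrier H"
  shows "ra a (x \<oplus>\<^bsub>H\<^esub> y) = ra a x \<oplus>\<^bsub>H\<^esub> ra a y"
  by (rule vec_eqI) (simp_all add: assms hinner_ra pi_add hinner_add sum.distrib algebra_simps)

lemma hinner_ra_adjoint:
  assumes "x \<in> carrier H" "z \<in> carrier H"
  shows "hinner H (ra a x) z = hinner H x (ra (star a) z)"
proof -
  have "hinner H (ra a x) z = cnj (hinner H (ra (star a) z) x)"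
  proof (induction a rule: poly_mapping_additive_induct)
    case (single g r)
    have "cnj (hinner H (\<pi> (- g) z) x) = hinner H x (\<pi> (- g) z)"
      using assms hinner_cnj[of "\<pi> (- g) z" x] by simp
    then show ?case using assms by (simp add: star_single hinner_ra_single pi_adjoint[of x z g])
  qed (simp add: hinner_ra_plus star_add assms)
  also have "\<dots> = hinner H x (ra (star a) z)"
    using assms hinner_cnj[of "ra (star a) z" x] by simp
  finally show ?thesis .
qed

lemma ra_mult:
  assumes x: "x \<in> carrier H"
  shows "ra (a * b) x = ra a (ra b x)"
proof (rule vec_eqI)
  fix z assume z: "z \<in> carrier H"
  show "hinner H (ra (a * b) x) z = hinner H (ra a (ra b x)) z"
  proof (induction a rule: poly_mapping_additive_induct)
    case (single g r)
    show ?case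
    proof (induction b rule: poly_mapping_additive_induct)
      case (single h s)
      show ?case
        using x z by (simp add: mult_single hinner_ra_single pi_adjoint[of "ra (Poly_Mapping.single h s) x" z g]
            pi_plus pi_adjoint[of "\<pi> h x" z g])
    next
      case (add b c)
      then show ?case
        using x z by (simp add: distrib_left hinner_ra_plus hinner_ra_single pi_adjoint[of _ z g] algebra_simps)
    qed
  next
    case (add a c)
    then show ?case using x z by (simp add: distrib_right hinner_ra_plus)
  qed
qed (use x in simp_all)

definition hpow :: "nat \<Rightarrow> (nat \<Rightarrow> 'h) set" where
  "hpow k = {..<k} \<rightarrow>\<^sub>E carrier H"

abbreviation rm :: "'g group_algebra mat \<Rightarrow> (nat \<Rightarrow> 'h) \<Rightarrow> nat \<Rightarrow> 'h" where "rm \<equiv> rep_mat H \<pi>"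

lemma hpowD [simp]: "\<xi> \<in> hpow k \<Longrightarrow> i < k \<Longrightarrow> \<xi> i \<in> carrier H"
  by (auto simp: hpow_def)

lemma hpow_eqI: "\<xi> \<in> hpow k \<Longrightarrow> \<eta> \<in> hpow k \<Longrightarrow> (\<And>i. i < k \<Longrightarrow> \<xi> i = \<eta> i) \<Longrightarrow> \<xi> = \<eta>"
  unfolding hpow_def by (rule PiE_ext) auto

lemma rm_index: "i < dim_row A \<Longrightarrow> rm A \<xi> i = finsum H (\<lambda>j. ra (A $$ (i, j)) (\<xi> j)) {..<dim_col A}"
  by (simp add: rep_mat_def)

lemma rm_closed: "A \<in> carrier_mat m n \<Longrightarrow> \<xi> \<in> hpow n \<Longrightarrow> rm A \<xi> \<in> hpow m"
  unfolding hpow_def rep_mat_def by (rule PiE_I) (auto intro!: M.finsum_closed ra_closed)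

lemma hinner_rm:
  assumes "A \<in> carrier_mat m n" "\<xi> \<in> hpow n" "i < m" "z \<in> carrier H"
  shows "hinner H (rm A \<xi> i) z = (\<Sum>j<n. hinner H (ra (A $$ (i, j)) (\<xi> j)) z)"
  using assms by (subst rm_index) (auto intro!: hinner_finsum)

lemma rm_mult:
  assumes A: "A \<in> carrier_mat m n" and B: "B \<in> carrier_mat n k" and \<xi>: "\<xi> \<in> hpow k"
  shows "rm (A * B) \<xi> = rm A (rm B \<xi>)"
proof (rule hpow_eqI[of _ m])
  have AB: "A * B \<in> carrier_mat m k" and B\<xi>: "rm B \<xi> \<in> hpow n" using A B \<xi> by (auto intro: rm_closed)
  then show "rm (A * B) \<xi> \<in> hpow m" "rm A (rm B \<xi>) \<in> hpow m" using A \<xi> by (auto intro: rm_closed)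
  fix i assume i: "i < m"
  show "rm (A * B) \<xi> i = rm A (rm B \<xi>) i"
  proof (rule vec_eqI)
    fix z assume z: "z \<in> carrier H"
    have "hinner H (rm (A * B) \<xi> i) z = (\<Sum>j<k. \<Sum>l<n. hinner H (ra (A $$ (i, l)) (ra (B $$ (l, j)) (\<xi> j))) z)"
      unfolding hinner_rm[OF AB \<xi> i z]
      using A B \<xi> i z by (intro sum.cong) (auto simp: scalar_prod_def hinner_ra_sum ra_mult atLeast0LessThan)
    also have "\<dots> = (\<Sum>l<n. \<Sum>j<k. hinner H (ra (B $$ (l, j)) (\<xi> j)) (ra (star (A $$ (i, l))) z))"
      using \<xi> z by (subst sum.swap) (simp add: hinner_ra_adjoint[of _ z])
    also have "\<dots> = (\<Sum>l<n. hinner H (rm B \<xi> l) (ra (star (A $$ (i, l))) z))"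
      using z by (intro sum.cong refl) (simp add: hinner_rm[OF B \<xi>])
    also have "\<dots> = hinner H (rm A (rm B \<xi>) i) z"
      using B\<xi> z by (simp add: hinner_rm[OF A B\<xi> i z] hinner_ra_adjoint[of _ z])
    finally show "hinner H (rm (A * B) \<xi> i) z = hinner H (rm A (rm B \<xi>) i) z" .
  qed (use i \<open>rm (A * B) \<xi> \<in> hpow m\<close> \<open>rm A (rm B \<xi>) \<in> hpow m\<close> in auto)
qed

definition dot :: "nat \<Rightarrow> (nat \<Rightarrow> 'h) \<Rightarrow> (nat \<Rightarrow> 'h) \<Rightarrow> complex" where
  "dot k \<xi> \<eta> = (\<Sum>i<k. hinner H (\<xi> i) (\<eta> i))"

lemma dot_adjoint:
  assumes A: "A \<in> carrier_mat m n" and \<xi>: "\<xi> \<in> hpow n" and \<eta>: "\<eta> \<in> hpow m"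
  shows "dot m (rm A \<xi>) \<eta> = dot n \<xi> (rm (star_mat A) \<eta>)"
proof -
  have A': "star_mat A \<in> carrier_mat n m" using A by simp
  have "dot m (rm A \<xi>) \<eta> = (\<Sum>i<m. \<Sum>j<n. hinner H (\<xi> j) (ra (star (A $$ (i, j))) (\<eta> i)))"
    unfolding dot_def using \<xi> \<eta> by (intro sum.cong refl) (simp add: hinner_rm[OF A \<xi>] hinner_ra_adjoint)
  also have "\<dots> = (\<Sum>j<n. \<Sum>i<m. cnj (hinner H (ra (star_mat A $$ (j, i)) (\<eta> i)) (\<xi> j)))"
  proof (subst sum.swap, intro sum.cong refl)
    fix j i assume "j \<in> {..<n}" "i \<in> {..<m}"
    then show "hinner H (\<xi> j) (ra (star (A $$ (i, j))) (\<eta> i)) = cnj (hinner H (ra (star_mat A $$ (j, i)) (\<eta> i)) (\<xi> j))"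
      using A \<xi> \<eta> hinner_cnj[of "ra (star (A $$ (i, j))) (\<eta> i)" "\<xi> j"] by auto
  qed
  also have "\<dots> = (\<Sum>j<n. cnj (hinner H (rm (star_mat A) \<eta> j) (\<xi> j)))"
    using \<xi> by (intro sum.cong refl) (simp add: hinner_rm[OF A' \<eta>])
  also have "\<dots> = dot n \<xi> (rm (star_mat A) \<eta>)"
    unfolding dot_def
  proof (intro sum.cong refl)
    fix j assume "j \<in> {..<n}"
    then show "cnj (hinner H (rm (star_mat A) \<eta> j) (\<xi> j)) = hinner H (\<xi> j) (rm (star_mat A) \<eta> j)"
      using \<xi> rm_closed[OF A' \<eta>] hinner_cnj[of "rm (star_mat A) \<eta> j" "\<xi> j"] by auto
  qed
  finally show ?thesis .
qed

definition quad :: "nat \<Rightarrow> (nat \<Rightarrow> 'h) \<Rightarrow> 'g group_algebra mat \<Rightarrow> real" where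
  "quad k \<xi> a = Re (dot k (rm a \<xi>) \<xi>)"

lemma quad_expand:
  assumes "a \<in> carrier_mat k k" "\<xi> \<in> hpow k"
  shows "quad k \<xi> a = (\<Sum>i<k. \<Sum>j<k. ip (ra (a $$ (i, j)) (\<xi> j)) (\<xi> i))"
  using assms by (simp add: quad_def dot_def hinner_rm)

lemma quad_add:
  assumes "a \<in> carrier_mat k k" "b \<in> carrier_mat k k" "\<xi> \<in> hpow k"
  shows "quad k \<xi> (a + b) = quad k \<xi> a + quad k \<xi> b"
proof -
  have "a + b \<in> carrier_mat k k" using assms by simp
  then show ?thesis
    using assms by (simp add: quad_expand hinner_ra_plus sum.distrib)
qed

lemma quad_scaleR:
  assumes "a \<in> carrier_mat k k" "\<xi> \<in> hpow k"
  shows "quad k \<xi> (scaleR_mat r a) = r * quad k \<xi> a"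
proof -
  have "ip (ra (scaleR_mat r a $$ (i, j)) (\<xi> j)) (\<xi> i) = r * ip (ra (a $$ (i, j)) (\<xi> j)) (\<xi> i)"
    if "i < k" "j < k" for i j
    using that assms by (simp add: scaleR_mat_def ra_mult hinner_ra_single pi_0)
  then show ?thesis using assms by (simp add: quad_expand sum_distrib_left)
qed

lemma quad_star_mult:
  assumes A: "A \<in> carrier_mat m k" and B: "B \<in> carrier_mat m k" and \<xi>: "\<xi> \<in> hpow k"
  shows "quad k \<xi> (star_mat A * B) = Re (dot m (rm B \<xi>) (rm A \<xi>))"
proof -
  have "rm (star_mat A * B) \<xi> = rm (star_mat A) (rm B \<xi>)"
    by (rule rm_mult) (use A B \<xi> in auto)
  then show ?thesis
    using dot_adjoint[of "star_mat A" k m "rm B \<xi>" \<xi>] A rm_closed[OF B \<xi>] \<xi> by (simp add: quad_def)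
qed

lemma dot_cnj: "\<xi> \<in> hpow k \<Longrightarrow> \<eta> \<in> hpow k \<Longrightarrow> Re (dot k \<xi> \<eta>) = Re (dot k \<eta> \<xi>)"
  by (auto simp: dot_def ip_commute intro!: sum.cong)

lemma quad_star:
  assumes a: "a \<in> carrier_mat k k" and \<xi>: "\<xi> \<in> hpow k"
  shows "quad k \<xi> (star_mat a) = quad k \<xi> a"
  using dot_adjoint[OF a \<xi> \<xi>] dot_cnj[OF \<xi> rm_closed[of "star_mat a" k k \<xi>]] a \<xi> by (simp add: quad_def)

lemma quad_0: "\<xi> \<in> hpow k \<Longrightarrow> quad k \<xi> (0\<^sub>m k k) = 0"
  by (simp add: quad_expand hinner_ra_0)

lemma dot_self: "\<xi> \<in> hpow k \<Longrightarrow> 0 \<le> Re (dot k \<xi> \<xi>)"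
  unfolding dot_def by (auto intro!: sum_nonneg hinner_nonneg)

lemma dot_self_eq_0:
  assumes \<xi>: "\<xi> \<in> hpow k" and 0: "Re (dot k \<xi> \<xi>) = 0" and i: "i < k"
  shows "\<xi> i = \<zero>\<^bsub>H\<^esub>"
proof (rule ip_definite)
  have "(\<Sum>i<k. ip (\<xi> i) (\<xi> i)) = 0" using 0 by (simp add: dot_def)
  then show "ip (\<xi> i) (\<xi> i) = 0"
    using \<xi> i by (subst (asm) sum_nonneg_eq_0_iff) (auto intro: hinner_nonneg)
qed (use \<xi> i in simp)

lemma quad_foldr:
  assumes "set as \<subseteq> carrier_mat k k" "\<xi> \<in> hpow k"
  shows "foldr (+) (map (\<lambda>a. star_mat a * a) as) (0\<^sub>m k k) \<in> carrier_mat k k"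
    and "quad k \<xi> (foldr (+) (map (\<lambda>a. star_mat a * a) as) (0\<^sub>m k k)) = (\<Sum>a\<leftarrow>as. Re (dot k (rm a \<xi>) (rm a \<xi>)))"
proof -
  have "foldr (+) (map (\<lambda>a. star_mat a * a) as) (0\<^sub>m k k) \<in> carrier_mat k k \<and>
    quad k \<xi> (foldr (+) (map (\<lambda>a. star_mat a * a) as) (0\<^sub>m k k)) = (\<Sum>a\<leftarrow>as. Re (dot k (rm a \<xi>) (rm a \<xi>)))"
    using assms
  proof (induction as)
    case (Cons a as)
    then have a: "a \<in> carrier_mat k k" by simp
    have "star_mat a * a \<in> carrier_mat k k" using a by (intro mult_carrier_mat star_mat_carrier)
    then show ?case using Cons a by (simp add: quad_add quad_star_mult)
  qed (simp add: quad_0)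
  then show "foldr (+) (map (\<lambda>a. star_mat a * a) as) (0\<^sub>m k k) \<in> carrier_mat k k"
    "quad k \<xi> (foldr (+) (map (\<lambda>a. star_mat a * a) as) (0\<^sub>m k k)) = (\<Sum>a\<leftarrow>as. Re (dot k (rm a \<xi>) (rm a \<xi>)))"
    by blast+
qed

lemma quad_positive_hermitian:
  assumes \<xi>: "\<xi> \<in> hpow k"
  shows "positive_hermitian_functional k (carrier_mat k k) (quad k \<xi>)"
  unfolding positive_hermitian_functional_def linear_functional_def hermitian_functional_def
    positive_functional_def
proof (intro conjI ballI allI)
  fix a :: "'g group_algebra mat" assume "a \<in> carrier_mat k k \<inter> sum_squares k"
  then obtain as where as: "set as \<subseteq> carrier_mat k k" "a = foldr (+) (map (\<lambda>a. star_mat a * a) as) (0\<^sub>m k k)"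
    by (auto simp: sum_squares_def)
  have "0 \<le> (\<Sum>a\<leftarrow>as. Re (dot k (rm a \<xi>) (rm a \<xi>)))"
    using as \<xi> by (intro sum_list_nonneg) (auto intro!: dot_self rm_closed)
  then show "0 \<le> quad k \<xi> a" using quad_foldr(2)[OF as(1) \<xi>] as(2) by simp
qed (auto simp: \<xi> quad_add quad_scaleR quad_star)

text \<open>Each square contributes the squared norm of \<open>rm a \<xi>\<close>, so nothing can
  cancel in the sum.\<close>

lemma quad_sum_squares_eq_0:
  assumes as: "set as \<subseteq> carrier_mat k k" and \<xi>: "\<xi> \<in> hpow k"
    and 0: "quad k \<xi> (foldr (+) (map (\<lambda>a. star_mat a * a) as) (0\<^sub>m k k)) = 0"
    and a: "a \<in> set as" and i: "i < k"
  shows "rm a \<xi> i = \<zero>\<^bsub>H\<^esub>"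
proof (rule dot_self_eq_0)
  show c: "rm a \<xi> \<in> hpow k" using as a \<xi> by (auto intro: rm_closed)
  have "\<forall>x\<in>set (map (\<lambda>a. Re (dot k (rm a \<xi>) (rm a \<xi>))) as). x = 0"
    using 0 as \<xi> unfolding quad_foldr(2)[OF as \<xi>]
    by (subst (asm) sum_list_nonneg_eq_0_iff) (auto intro!: dot_self rm_closed)
  then show "Re (dot k (rm a \<xi>) (rm a \<xi>)) = 0" using a by simp
qed (rule i)

end

section \<open>Vanishing of cohomology as exactness\<close>

context unitary_rep
begin

lemma hilbert_power_simps:
  "carrier (hilbert_power H k) = hpow k" "\<one>\<^bsub>hilbert_power H k\<^esub> = (\<lambda>i\<in>{..<k}. \<zero>\<^bsub>H\<^esub>)"
  by (simp_all add: hilbert_power_def hpow_def)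

lemma hilbert_power_mult: "\<xi> \<otimes>\<^bsub>hilbert_power H k\<^esub> \<eta> = (\<lambda>i\<in>{..<k}. \<xi> i \<oplus>\<^bsub>H\<^esub> \<eta> i)"
  by (simp add: hilbert_power_def)

lemma group_hilbert_power: "group (hilbert_power H k)"
  unfolding hilbert_power_def by (rule product_group) (rule M.a_group)

lemma hpow_add: "\<xi> \<in> hpow k \<Longrightarrow> \<eta> \<in> hpow k \<Longrightarrow> (\<lambda>i\<in>{..<k}. \<xi> i \<oplus>\<^bsub>H\<^esub> \<eta> i) \<in> hpow k"
  unfolding hpow_def by auto

lemma rm_hom:
  assumes A: "A \<in> carrier_mat m n"
  shows "rm A \<in> hom (hilbert_power H n) (hilbert_power H m)"
proof (rule homI)
  show "rm A \<xi> \<in> carrier (hilbert_power H m)" if "\<xi> \<in> carrier (hilbert_power H n)" for \<xi>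
    using that rm_closed[OF A] by (simp add: hilbert_power_simps)
  fix \<xi> \<eta> assume "\<xi> \<in> carrier (hilbert_power H n)" "\<eta> \<in> carrier (hilbert_power H n)"
  then have h: "\<xi> \<in> hpow n" "\<eta> \<in> hpow n" by (simp_all add: hilbert_power_simps)
  let ?s = "\<lambda>i\<in>{..<n}. \<xi> i \<oplus>\<^bsub>H\<^esub> \<eta> i"
  have s: "?s \<in> hpow n" using h by (rule hpow_add)
  show "rm A (\<xi> \<otimes>\<^bsub>hilbert_power H n\<^esub> \<eta>) = rm A \<xi> \<otimes>\<^bsub>hilbert_power H m\<^esub> rm A \<eta>"
    unfolding hilbert_power_mult
  proof (rule hpow_eqI[of _ m])
    show "rm A ?s \<in> hpow m" "(\<lambda>i\<in>{..<m}. rm A \<xi> i \<oplus>\<^bsub>H\<^esub> rm A \<eta> i) \<in> hpow m"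
      using rm_closed[OF A] h s by (auto intro: hpow_add)
    fix i assume i: "i < m"
    have c: "rm A \<xi> i \<in> carrier H" "rm A \<eta> i \<in> carrier H" "rm A ?s i \<in> carrier H"
      using hpowD[OF rm_closed[OF A] i] h s by blast+
    have "rm A ?s i = rm A \<xi> i \<oplus>\<^bsub>H\<^esub> rm A \<eta> i"
    proof (rule vec_eqI)
      fix z assume z: "z \<in> carrier H"
      show "hinner H (rm A ?s i) z = hinner H (rm A \<xi> i \<oplus>\<^bsub>H\<^esub> rm A \<eta> i) z"
        using c z h by (simp add: hinner_add hinner_rm[OF A h(1) i z] hinner_rm[OF A h(2) i z]
            hinner_rm[OF A s i z] ra_add sum.distrib)
    qed (use c in simp_all)
    then show "rm A ?s i = (\<lambda>i\<in>{..<m}. rm A \<xi> i \<oplus>\<^bsub>H\<^esub> rm A \<eta> i) i" using i by simp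
  qed
qed

lemma rm_group_hom: "A \<in> carrier_mat m n \<Longrightarrow> group_hom (hilbert_power H n) (hilbert_power H m) (rm A)"
  by (simp add: group_hom_def group_hom_axioms_def group_hilbert_power rm_hom)

lemma subgroup_ker:
  assumes A: "A \<in> carrier_mat m n"
  shows "subgroup (kernel (hilbert_power H n) (hilbert_power H m) (rm A)) (hilbert_power H n)"
  using rm_group_hom[OF A] by (rule group_hom.subgroup_kernel)

lemma ker_iff:
  assumes A: "A \<in> carrier_mat m n"
  shows "\<xi> \<in> kernel (hilbert_power H n) (hilbert_power H m) (rm A)
    \<longleftrightarrow> \<xi> \<in> hpow n \<and> (\<forall>i<m. rm A \<xi> i = \<zero>\<^bsub>H\<^esub>)"
proof
  assume "\<xi> \<in> hpow n \<and> (\<forall>i<m. rm A \<xi> i = \<zero>\<^bsub>H\<^esub>)"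
  moreover from this have "rm A \<xi> = (\<lambda>i\<in>{..<m}. \<zero>\<^bsub>H\<^esub>)"
    using rm_closed[OF A, of \<xi>] by (intro hpow_eqI[of _ m]) (auto simp: hpow_def)
  ultimately show "\<xi> \<in> kernel (hilbert_power H n) (hilbert_power H m) (rm A)"
    by (simp add: kernel_def hilbert_power_simps)
qed (simp add: kernel_def hilbert_power_simps)

text \<open>In a one-element quotient every coset equals the image. The coset of \<xi> contains
  \<xi>, because the image contains the unit.\<close>

lemma trivial_cohomologyD:
  assumes n: "d n \<in> carrier_mat m k" and n1: "d (n - 1) \<in> carrier_mat k l"
    and triv: "trivial_group (group_cohomology d n H \<pi>)"
    and \<xi>: "\<xi> \<in> hpow k" "\<And>i. i < m \<Longrightarrow> rm (d n) \<xi> i = \<zero>\<^bsub>H\<^esub>"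
  obtains \<eta> where "\<eta> \<in> hpow l" "rm (d (n - 1)) \<eta> = \<xi>"
proof -
  let ?P = "hilbert_power H k" and ?K = "kernel (hilbert_power H k) (hilbert_power H m) (rm (d n))"
    and ?I = "rm (d (n - 1)) ` hpow l"
  let ?G = "subgroup_generated ?P ?K"
  have dims: "dim_row (d n) = m" "dim_col (d n) = k" "dim_col (d (n - 1)) = l" using n n1 by auto
  have car: "carrier ?G = ?K"
    by (rule subgroup.carrier_subgroup_generated_subgroup[OF subgroup_ker[OF n]])
  have \<xi>K: "\<xi> \<in> ?K" using \<xi> ker_iff[OF n] by blast
  have "carrier (?G Mod ?I) = {\<one>\<^bsub>?G Mod ?I\<^esub>}"
    using triv unfolding trivial_group_def group_cohomology_def dims hilbert_power_simps by blast
  then have "rcosets\<^bsub>?G\<^esub> ?I = {?I}" by (simp add: FactGroup_def)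
  moreover have "?I #>\<^bsub>?G\<^esub> \<xi> \<in> rcosets\<^bsub>?G\<^esub> ?I"
    unfolding RCOSETS_def car using \<xi>K by blast
  ultimately have eq: "?I #>\<^bsub>?G\<^esub> \<xi> = ?I" by blast
  have "\<one>\<^bsub>?P\<^esub> \<in> ?I"
  proof -
    have "rm (d (n - 1)) \<one>\<^bsub>hilbert_power H l\<^esub> = \<one>\<^bsub>?P\<^esub>"
      by (rule group_hom.hom_one[OF rm_group_hom[OF n1]])
    moreover have "\<one>\<^bsub>hilbert_power H l\<^esub> \<in> hpow l" by (auto simp: hilbert_power_simps hpow_def)
    ultimately show ?thesis by (metis imageI)
  qed
  then have "\<one>\<^bsub>?P\<^esub> \<otimes>\<^bsub>?G\<^esub> \<xi> \<in> ?I #>\<^bsub>?G\<^esub> \<xi>" unfolding r_coset_def by blast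
  moreover have "\<one>\<^bsub>?P\<^esub> \<otimes>\<^bsub>?G\<^esub> \<xi> = \<xi>"
    using group.is_monoid[OF group_hilbert_power, THEN monoid.l_one, of \<xi> k] \<xi>(1)
    by (simp add: hilbert_power_simps(1) subgroup_generated_def)
  ultimately have "\<xi> \<in> ?I" using eq by metis
  then show ?thesis using that by blast
qed

text \<open>Image and kernel coincide, so there is only one coset. Normality is proved as well,
  since \<open>trivial_group\<close> includes that the quotient is a group.\<close>

lemma trivial_cohomologyI:
  assumes n: "d n \<in> carrier_mat m k" and n1: "d (n - 1) \<in> carrier_mat k l"
    and ex: "\<And>\<xi>. \<xi> \<in> hpow k \<Longrightarrow> (\<And>i. i < m \<Longrightarrow> rm (d n) \<xi> i = \<zero>\<^bsub>H\<^esub>) \<Longrightarrow> \<exists>\<eta>\<in>hpow l. rm (d (n - 1)) \<eta> = \<xi>"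
    and complex: "\<And>\<eta> i. \<eta> \<in> hpow l \<Longrightarrow> i < m \<Longrightarrow> rm (d n) (rm (d (n - 1)) \<eta>) i = \<zero>\<^bsub>H\<^esub>"
  shows "trivial_group (group_cohomology d n H \<pi>)"
proof -
  let ?P = "hilbert_power H k" and ?K = "kernel (hilbert_power H k) (hilbert_power H m) (rm (d n))"
    and ?I = "rm (d (n - 1)) ` hpow l"
  let ?G = "subgroup_generated ?P ?K"
  have dims: "dim_row (d n) = m" "dim_col (d n) = k" "dim_col (d (n - 1)) = l" using n n1 by auto
  have car: "carrier ?G = ?K"
    by (rule subgroup.carrier_subgroup_generated_subgroup[OF subgroup_ker[OF n]])
  have IK: "?I = ?K"
  proof
    show "?I \<subseteq> ?K" using complex rm_closed[OF n1] ker_iff[OF n] by blast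
    show "?K \<subseteq> ?I"
    proof
      fix \<xi> assume "\<xi> \<in> ?K"
      then have "\<xi> \<in> hpow k" "\<And>i. i < m \<Longrightarrow> rm (d n) \<xi> i = \<zero>\<^bsub>H\<^esub>" using ker_iff[OF n] by blast+
      then show "\<xi> \<in> ?I" using ex by blast
    qed
  qed
  have G: "group ?G" using group_hilbert_power by (rule group.group_subgroup_generated)
  have sub: "subgroup ?I ?G" unfolding IK using group.subgroup_self[OF G] unfolding car .
  have coset: "?I #>\<^bsub>?G\<^esub> x = ?I" if "x \<in> carrier ?G" for x
    using group.coset_join2[OF G that sub that[unfolded car, folded IK]] .
  have rc: "rcosets\<^bsub>?G\<^esub> ?I = {?I}"
    unfolding RCOSETS_def using coset monoid.one_closed[OF group.is_monoid[OF G]] by auto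
  have "x <#\<^bsub>?G\<^esub> ?I = ?I" if "x \<in> carrier ?G" for x
    using group.coset_join3[OF G that sub that[unfolded car, folded IK]] .
  then have normal: "?I \<lhd> ?G"
    using sub G coset by (simp add: normal_def normal_axioms_def)
  have "group (?G Mod ?I)" using normal by (rule normal.factorgroup_is_group)
  then show ?thesis
    unfolding trivial_group_def group_cohomology_def dims hilbert_power_simps
    using rc by (simp add: FactGroup_def)
qed

end

section \<open>The Hilbert space of a positive definite kernel\<close>

lemma LIMSEQ_zero_iff_norm_le:
  fixes x :: "nat \<Rightarrow> complex"
  assumes "\<And>e. e > 0 \<Longrightarrow> \<exists>M. \<forall>n\<ge>M. cmod (x n) \<le> e"
  shows "x \<longlonglongrightarrow> 0"
proof (rule LIMSEQ_I)
  fix r :: real assume "r > 0"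
  then obtain M where "\<forall>n\<ge>M. cmod (x n) \<le> r / 2" using assms[of "r / 2"] by auto
  then have "\<forall>n\<ge>M. cmod (x n - 0) < r" using \<open>r > 0\<close> by (metis diff_zero field_sum_of_halves less_add_same_cancel1 order_le_less_trans half_gt_zero)
  then show "\<exists>M. \<forall>n\<ge>M. cmod (x n - 0) < r" by blast
qed

text \<open>The Moore-Aronszajn construction: \<open>B\<close> is the sesquilinear extension of a
  real kernel to finite complex combinations of points.\<close>

locale pd_kernel =
  fixes K :: "'s \<Rightarrow> 's \<Rightarrow> real"
  assumes K_sym: "K s t = K t s"
    and K_psd: "\<And>c :: 's \<Rightarrow> real. \<And>F. finite F \<Longrightarrow> 0 \<le> (\<Sum>s\<in>F. \<Sum>t\<in>F. c s * c t * K s t)"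
begin

definition K1 :: "'s \<Rightarrow> ('s \<Rightarrow>\<^sub>0 complex) \<Rightarrow> complex" where
  "K1 s d = (\<Sum>t\<in>Poly_Mapping.keys d. cnj (Poly_Mapping.lookup d t) * K s t)"

definition B :: "('s \<Rightarrow>\<^sub>0 complex) \<Rightarrow> ('s \<Rightarrow>\<^sub>0 complex) \<Rightarrow> complex" where
  "B c d = (\<Sum>s\<in>Poly_Mapping.keys c. Poly_Mapping.lookup c s * K1 s d)"

definition csmul :: "complex \<Rightarrow> ('s \<Rightarrow>\<^sub>0 complex) \<Rightarrow> ('s \<Rightarrow>\<^sub>0 complex)" where
  "csmul r p = Poly_Mapping.map ((*) r) p"

abbreviation \<delta> :: "'s \<Rightarrow> ('s \<Rightarrow>\<^sub>0 complex)" where "\<delta> s \<equiv> Poly_Mapping.single s 1"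

lemma lookup_csmul [simp]: "Poly_Mapping.lookup (csmul r p) x = r * Poly_Mapping.lookup p x"
  by (simp add: csmul_def Poly_Mapping.map.rep_eq when_def)

lemma csmul_add: "csmul r (a + b) = csmul r a + csmul r b"
  by (rule poly_mapping_eqI) (simp add: lookup_add algebra_simps)

lemma csmul_diff: "csmul r (a - b) = csmul r a - csmul r b"
  by (rule poly_mapping_eqI) (simp add: lookup_minus algebra_simps)

lemma csmul_single [simp]: "csmul r (Poly_Mapping.single s a) = Poly_Mapping.single s (r * a)"
  by (rule poly_mapping_eqI) (simp add: lookup_single when_def)

lemma K1_add: "K1 s (a + b) = K1 s a + K1 s b"
  unfolding K1_def
  by (rule setsum_keys_plus_distrib[of "\<lambda>t r. cnj r * K s t"]) (simp_all add: algebra_simps)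

lemma B_add_left: "B (a + b) d = B a d + B b d"
  unfolding B_def
  by (rule setsum_keys_plus_distrib[of "\<lambda>s r. r * K1 s d"]) (simp_all add: algebra_simps)

lemma B_add_right: "B d (a + b) = B d a + B d b"
  by (simp add: B_def K1_add sum.distrib algebra_simps)

lemma B_single: "B (Poly_Mapping.single s a) (Poly_Mapping.single t b) = a * cnj b * K s t"
  by (cases "a = 0"; cases "b = 0") (simp_all add: B_def K1_def)

lemma B_cnj: "B d c = cnj (B c d)"
proof (induction c rule: poly_mapping_additive_induct)
  case (single s a)
  show ?case
    by (induction d rule: poly_mapping_additive_induct)
       (simp_all add: B_single K_sym[of _ s] B_add_left B_add_right)
qed (simp add: B_add_left B_add_right)

lemma B_csmul_left: "B (csmul r c) d = r * B c d"
proof (induction c rule: poly_mapping_additive_induct)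
  case (single s a)
  show ?case
    by (induction d rule: poly_mapping_additive_induct) (simp_all add: B_single B_add_right algebra_simps)
qed (simp add: csmul_add B_add_left algebra_simps)

lemma B_csmul_right: "B c (csmul r d) = cnj r * B c d"
proof -
  have "B c (csmul r d) = cnj (B (csmul r d) c)" by (rule B_cnj)
  also have "\<dots> = cnj r * cnj (B d c)" by (simp add: B_csmul_left)
  also have "cnj (B d c) = B c d" by (rule B_cnj[symmetric])
  finally show ?thesis .
qed

lemma B_diff_left: "B (a - b) d = B a d - B b d"
  using B_add_left[of "a - b" b d] unfolding eq_diff_eq diff_add_cancel by (rule sym)

lemma B_diff_right: "B d (a - b) = B d a - B d b"
  using B_add_right[of d "a - b" b] unfolding eq_diff_eq diff_add_cancel by (rule sym)

lemma B_expand_right: "B c d = (\<Sum>t\<in>Poly_Mapping.keys d. cnj (Poly_Mapping.lookup d t) * B c (\<delta> t))"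
proof -
  have *: "B c (\<delta> t) = (\<Sum>s\<in>Poly_Mapping.keys c. Poly_Mapping.lookup c s * K s t)" for t
    by (simp add: B_def K1_def)
  have "B c d = (\<Sum>t\<in>Poly_Mapping.keys d. \<Sum>s\<in>Poly_Mapping.keys c.
      Poly_Mapping.lookup c s * (cnj (Poly_Mapping.lookup d t) * K s t))"
    unfolding B_def K1_def sum_distrib_left by (rule sum.swap)
  then show ?thesis by (simp add: * sum_distrib_left mult_ac)
qed

text \<open>For a real symmetric kernel the real and the imaginary parts of the coefficients
  contribute separately.\<close>

lemma B_nonneg: "0 \<le> Re (B c c)"
proof -
  let ?F = "Poly_Mapping.keys c" and ?u = "\<lambda>s. Re (Poly_Mapping.lookup c s)" and ?v = "\<lambda>s. Im (Poly_Mapping.lookup c s)"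
  have "Re (B c c) = (\<Sum>s\<in>?F. \<Sum>t\<in>?F. Re (Poly_Mapping.lookup c s * (cnj (Poly_Mapping.lookup c t) * K s t)))"
    by (simp only: B_def K1_def sum_distrib_left Re_sum)
  also have "\<dots> = (\<Sum>s\<in>?F. \<Sum>t\<in>?F. ?u s * ?u t * K s t + ?v s * ?v t * K s t)"
    by (intro sum.cong refl) (simp add: algebra_simps)
  finally have "Re (B c c) = (\<Sum>s\<in>?F. \<Sum>t\<in>?F. ?u s * ?u t * K s t) + (\<Sum>s\<in>?F. \<Sum>t\<in>?F. ?v s * ?v t * K s t)"
    by (simp only: sum.distrib)
  then show ?thesis using K_psd[of ?F ?u] K_psd[of ?F ?v] by simp
qed

text \<open>Only a seminorm. Null combinations are not divided out; by Cauchy-Schwarz they represent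
  the zero function.\<close>

definition N :: "('s \<Rightarrow>\<^sub>0 complex) \<Rightarrow> real" where
  "N c = sqrt (Re (B c c))"

lemma N_nonneg [simp]: "0 \<le> N c" and N_sq: "(N c)\<^sup>2 = Re (B c c)"
  by (simp_all add: N_def B_nonneg)

lemma Re_B_le: "\<bar>Re (B c d)\<bar> \<le> N c * N d"
proof -
  have "(Re (B c d))\<^sup>2 \<le> (N c)\<^sup>2 * (N d)\<^sup>2"
  proof (rule quadratic_nonneg)
    fix t :: real
    have "Re (B d c) = Re (B c d)" using B_cnj[of c d] by simp
    then have "Re (B (c + csmul t d) (c + csmul t d)) = (N c)\<^sup>2 + 2 * t * Re (B c d) + t\<^sup>2 * (N d)\<^sup>2"
      unfolding N_sq by (simp add: B_add_left B_add_right B_csmul_left B_csmul_right power2_eq_square algebra_simps)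
    then show "0 \<le> (N c)\<^sup>2 + 2 * t * Re (B c d) + t\<^sup>2 * (N d)\<^sup>2"
      using B_nonneg[of "c + csmul t d"] by simp
  qed simp
  then have "\<bar>Re (B c d)\<bar>\<^sup>2 \<le> (N c * N d)\<^sup>2" by (simp add: power_mult_distrib)
  then show ?thesis by (rule power2_le_imp_le) simp
qed

lemma N_csmul: "N (csmul r c) = cmod r * N c"
proof (rule power2_eq_imp_eq)
  have "B (csmul r c) (csmul r c) = (r * cnj r) * B c c" by (simp add: B_csmul_left B_csmul_right)
  then show "(N (csmul r c))\<^sup>2 = (cmod r * N c)\<^sup>2"
    by (simp add: N_sq power_mult_distrib complex_mult_cnj cmod_power2)
qed simp_all

lemma B_le: "cmod (B c d) \<le> N c * N d"
proof (cases "B c d = 0")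
  case False
  \<comment> \<open>A phase that makes the value real and positive, so that the bound for real parts
    applies.\<close>
  define u where "u = cnj (B c d) / cmod (B c d)"
  have u1: "cmod u = 1" using False by (simp add: u_def norm_divide)
  have "B (csmul u c) d = of_real (cmod (B c d))"
    using False complex_norm_square[of "B c d", symmetric]
    by (simp add: u_def B_csmul_left power2_eq_square mult.commute)
  then show ?thesis using Re_B_le[of "csmul u c" d] by (simp add: N_csmul u1)
qed simp

lemma N_triangle: "N (c + d) \<le> N c + N d"
proof (rule power2_le_imp_le)
  have "Re (B d c) = Re (B c d)" using B_cnj[of c d] by simp
  then have "(N (c + d))\<^sup>2 = (N c)\<^sup>2 + 2 * Re (B c d) + (N d)\<^sup>2"
    by (simp add: N_sq B_add_left B_add_right)
  then show "(N (c + d))\<^sup>2 \<le> (N c + N d)\<^sup>2"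
    using abs_le_D1[OF Re_B_le[of c d]] by (simp add: power2_sum)
qed simp

lemma N_minus_commute: "N (c - d) = N (d - c)"
  by (simp add: N_def B_diff_left B_diff_right)

lemma N_triangle3: "N (a - c) \<le> N (a - b) + N (b - c)"
proof -
  have "(a - b) + (b - c) = a - c" by (simp add: algebra_simps)
  then show ?thesis using N_triangle[of "a - b" "b - c"] by (simp only:)
qed

definition cauchy :: "(nat \<Rightarrow> ('s \<Rightarrow>\<^sub>0 complex)) \<Rightarrow> bool" where
  "cauchy x \<longleftrightarrow> (\<forall>e>0. \<exists>M. \<forall>i\<ge>M. \<forall>j\<ge>M. N (x i - x j) < e)"

text \<open>The completion is realized as a space of functions: the limit of a Cauchy sequence \<open>x\<close> is
  identified with \<open>s \<mapsto> lim \<langle>x\<^sub>n, \<delta> s\<rangle>\<close>.\<close>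

definition represents :: "(nat \<Rightarrow> ('s \<Rightarrow>\<^sub>0 complex)) \<Rightarrow> ('s \<Rightarrow> complex) \<Rightarrow> bool" where
  "represents x f \<longleftrightarrow> cauchy x \<and> (\<forall>s. (\<lambda>n. B (x n) (\<delta> s)) \<longlonglongrightarrow> f s)"

lemma cauchy_bounded:
  assumes "cauchy x"
  obtains C where "C > 0" "\<And>n. N (x n) \<le> C"
proof -
  have "\<exists>M. \<forall>i\<ge>M. \<forall>j\<ge>M. N (x i - x j) < 1"
    using assms[unfolded cauchy_def, rule_format, of 1] by simp
  then obtain M where M: "\<forall>i\<ge>M. \<forall>j\<ge>M. N (x i - x j) < 1" by blast
  define C where "C = 1 + N (x M) + (\<Sum>i<M. N (x i))"
  have nn: "0 \<le> (\<Sum>i<M. N (x i))" by (simp add: sum_nonneg)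
  have "N (x n) \<le> C" for n
  proof (cases "n < M")
    case True
    then have "N (x n) \<le> (\<Sum>i<M. N (x i))" by (intro member_le_sum) auto
    then show ?thesis using N_nonneg[of "x M"] unfolding C_def by linarith
  next
    case False
    then have "N (x n - x M) < 1" using M by simp
    then show ?thesis using N_triangle[of "x n - x M" "x M"] nn unfolding C_def diff_add_cancel by linarith
  qed
  moreover have "C > 0" using nn N_nonneg[of "x M"] unfolding C_def by linarith
  ultimately show ?thesis using that by blast
qed

lemma cauchy_add: "cauchy x \<Longrightarrow> cauchy y \<Longrightarrow> cauchy (\<lambda>n. x n + y n)"
  unfolding cauchy_def
proof (intro allI impI)
  fix e :: real assume xy: "\<forall>e>0. \<exists>M. \<forall>i\<ge>M. \<forall>j\<ge>M. N (x i - x j) < e" "\<forall>e>0. \<exists>M. \<forall>i\<ge>M. \<forall>j\<ge>M. N (y i - y j) < e" and e: "e > 0"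
  obtain M where M: "\<forall>i\<ge>M. \<forall>j\<ge>M. N (x i - x j) < e / 2" using xy(1) e half_gt_zero by blast
  obtain M' where M': "\<forall>i\<ge>M'. \<forall>j\<ge>M'. N (y i - y j) < e / 2" using xy(2) e half_gt_zero by blast
  have "N (x i + y i - (x j + y j)) < e" if "i \<ge> max M M'" "j \<ge> max M M'" for i j
  proof -
    have "N (x i + y i - (x j + y j)) \<le> N (x i - x j) + N (y i - y j)"
      using N_triangle[of "x i - x j" "y i - y j"] by (simp add: algebra_simps)
    also have "\<dots> < e / 2 + e / 2" using M M' that by (intro add_strict_mono) auto
    finally show ?thesis by simp
  qed
  then show "\<exists>M. \<forall>i\<ge>M. \<forall>j\<ge>M. N (x i + y i - (x j + y j)) < e" by blast
qed

lemma cauchy_csmul: "cauchy x \<Longrightarrow> cauchy (\<lambda>n. csmul r (x n))"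
  unfolding cauchy_def
proof (intro allI impI)
  fix e :: real assume x: "\<forall>e>0. \<exists>M. \<forall>i\<ge>M. \<forall>j\<ge>M. N (x i - x j) < e" and e: "e > 0"
  have "e / (cmod r + 1) > 0" using e by (simp add: add_nonneg_pos)
  then obtain M where M: "\<forall>i\<ge>M. \<forall>j\<ge>M. N (x i - x j) < e / (cmod r + 1)" using x by blast
  have "N (csmul r (x i) - csmul r (x j)) < e" if "i \<ge> M" "j \<ge> M" for i j
  proof -
    have "N (x i - x j) < e / (cmod r + 1)" using M that by blast
    then have "(cmod r + 1) * N (x i - x j) < e"
      by (simp add: pos_less_divide_eq add_nonneg_pos mult.commute)
    then have "cmod r * N (x i - x j) + N (x i - x j) < e" by (simp add: distrib_right)
    then have "cmod r * N (x i - x j) < e" using N_nonneg[of "x i - x j"] by linarith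
    then show ?thesis by (simp add: N_csmul flip: csmul_diff)
  qed
  then show "\<exists>M. \<forall>i\<ge>M. \<forall>j\<ge>M. N (csmul r (x i) - csmul r (x j)) < e" by blast
qed

lemma represents_add: "represents x f \<Longrightarrow> represents y g \<Longrightarrow> represents (\<lambda>n. x n + y n) (\<lambda>s. f s + g s)"
  unfolding represents_def by (auto intro: cauchy_add tendsto_add simp: B_add_left)

lemma represents_csmul: "represents x f \<Longrightarrow> represents (\<lambda>n. csmul r (x n)) (\<lambda>s. r * f s)"
  unfolding represents_def by (auto intro: cauchy_csmul tendsto_mult_left simp: B_csmul_left)

lemma represents_diff:
  assumes "represents x f" "represents y g"
  shows "represents (\<lambda>n. x n - y n) (\<lambda>s. f s - g s)"
proof -
  have "csmul (- 1) a = - a" for a by (rule poly_mapping_eqI) simp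
  then show ?thesis
    using represents_add[OF assms(1) represents_csmul[OF assms(2), of "- 1"]] by simp
qed

lemma represents_const: "represents (\<lambda>_. c) (\<lambda>s. B c (\<delta> s))"
proof -
  have "N 0 = 0" by (simp add: N_def B_def)
  then show ?thesis by (simp add: represents_def cauchy_def)
qed

text \<open>Independence of the representing sequence: testing against a fixed finite combination only
  involves finitely many of the values \<open>f s\<close>.\<close>

lemma represents_0_limit:
  assumes x: "represents x (\<lambda>_. 0)" and y: "cauchy y"
  shows "(\<lambda>n. B (x n) (y n)) \<longlonglongrightarrow> 0"
proof (rule LIMSEQ_zero_iff_norm_le)
  fix e :: real assume e: "e > 0"
  have "cauchy x" using x by (simp add: represents_def)
  then obtain C where C: "C > 0" "\<And>n. N (x n) \<le> C" using cauchy_bounded by blast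
  have "e / (2 * C) > 0" using e C by simp
  then obtain M where M: "\<forall>i\<ge>M. \<forall>j\<ge>M. N (y i - y j) < e / (2 * C)" using y unfolding cauchy_def by blast
  have "(\<lambda>n. B (x n) (y M)) \<longlonglongrightarrow> (\<Sum>t\<in>Poly_Mapping.keys (y M). cnj (Poly_Mapping.lookup (y M) t) * 0)"
    by (subst B_expand_right, intro tendsto_sum tendsto_mult_left) (use x in \<open>simp add: represents_def\<close>)
  then have "(\<lambda>n. B (x n) (y M)) \<longlonglongrightarrow> 0" by simp
  then obtain M' where M': "\<forall>n\<ge>M'. cmod (B (x n) (y M)) < e / 2"
    using LIMSEQ_D[of "\<lambda>n. B (x n) (y M)" 0 "e / 2"] e by auto
  have "cmod (B (x n) (y n)) \<le> e" if n: "n \<ge> max M M'" for n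
  proof -
    have "cmod (B (x n) (y n - y M)) \<le> N (x n) * N (y n - y M)" by (rule B_le)
    also have "\<dots> \<le> C * (e / (2 * C))"
      using C M n by (intro mult_mono) (auto simp: less_imp_le)
    finally have "cmod (B (x n) (y n - y M)) \<le> e / 2" using C by simp
    moreover have "cmod (B (x n) (y M)) \<le> e / 2" using M' n by (simp add: less_imp_le)
    moreover have "B (x n) (y n) = B (x n) (y n - y M) + B (x n) (y M)" by (simp add: B_diff_right)
    ultimately show ?thesis using norm_triangle_ineq[of "B (x n) (y n - y M)" "B (x n) (y M)"] by simp
  qed
  then show "\<exists>M. \<forall>n\<ge>M. cmod (B (x n) (y n)) \<le> e" by blast
qed

lemma cauchy_convergent:
  assumes "cauchy x" "cauchy y"
  shows "convergent (\<lambda>n. B (x n) (y n))"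
proof -
  obtain C where C: "C > 0" "\<And>n. N (x n) \<le> C" using cauchy_bounded[OF assms(1)] by blast
  obtain D where D: "D > 0" "\<And>n. N (y n) \<le> D" using cauchy_bounded[OF assms(2)] by blast
  have "Cauchy (\<lambda>n. B (x n) (y n))"
  proof (rule CauchyI)
    fix e :: real assume e: "e > 0"
    have "e / (2 * D) > 0" "e / (2 * C) > 0" using e C D by simp_all
    then obtain M M' where M: "\<forall>i\<ge>M. \<forall>j\<ge>M. N (x i - x j) < e / (2 * D)"
      and M': "\<forall>i\<ge>M'. \<forall>j\<ge>M'. N (y i - y j) < e / (2 * C)"
      using assms unfolding cauchy_def by meson
    have "cmod (B (x i) (y i) - B (x j) (y j)) < e" if "i \<ge> max M M'" "j \<ge> max M M'" for i j
    proof -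
      have "cmod (B (x i - x j) (y i)) \<le> N (x i - x j) * N (y i)" by (rule B_le)
      also have "\<dots> \<le> N (x i - x j) * D" using D by (intro mult_left_mono) auto
      also have "\<dots> < e / (2 * D) * D" using M that D by (intro mult_strict_right_mono) auto
      finally have 1: "cmod (B (x i - x j) (y i)) < e / 2" using D by simp
      have "cmod (B (x j) (y i - y j)) \<le> N (x j) * N (y i - y j)" by (rule B_le)
      also have "\<dots> \<le> C * N (y i - y j)" using C by (intro mult_right_mono) auto
      also have "\<dots> < C * (e / (2 * C))" using M' that C by (intro mult_strict_left_mono) auto
      finally have 2: "cmod (B (x j) (y i - y j)) < e / 2" using C by simp
      have "B (x i) (y i) - B (x j) (y j) = B (x i - x j) (y i) + B (x j) (y i - y j)"
        by (simp add: B_diff_left B_diff_right)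
      then show ?thesis using 1 2 norm_triangle_ineq[of "B (x i - x j) (y i)" "B (x j) (y i - y j)"] by simp
    qed
    then show "\<exists>M. \<forall>m\<ge>M. \<forall>n\<ge>M. cmod (B (x m) (y m) - B (x n) (y n)) < e" by blast
  qed
  then show ?thesis by (simp add: Cauchy_convergent_iff)
qed

definition inner :: "('s \<Rightarrow> complex) \<Rightarrow> ('s \<Rightarrow> complex) \<Rightarrow> complex" where
  "inner f g = lim (\<lambda>n. B ((SOME x. represents x f) n) ((SOME y. represents y g) n))"

text \<open>Exchanges the sequences chosen in \<open>inner\<close> for arbitrary ones: the
  differences represent 0, so \<open>represents_0_limit\<close> disposes of both error
  terms.\<close>

lemma inner_limit:
  assumes x: "represents x f" and y: "represents y g"
  shows "(\<lambda>n. B (x n) (y n)) \<longlonglongrightarrow> inner f g"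
proof -
  define x' y' where "x' = (SOME x. represents x f)" and "y' = (SOME y. represents y g)"
  have x': "represents x' f" and y': "represents y' g" 
    unfolding x'_def y'_def
    using someI[of "\<lambda>x. represents x f", OF x] someI[of "\<lambda>y. represents y g", OF y] by simp_all
  have "inner f g = lim (\<lambda>n. B (x' n) (y' n))" by (simp add: inner_def x'_def y'_def)
  moreover have "convergent (\<lambda>n. B (x' n) (y' n))"
    using x' y' by (intro cauchy_convergent) (simp_all add: represents_def)
  ultimately have lim: "(\<lambda>n. B (x' n) (y' n)) \<longlonglongrightarrow> inner f g"
    by (simp add: convergent_LIMSEQ_iff)
  have "(\<lambda>n. B (x n - x' n) (y n)) \<longlonglongrightarrow> 0"
    using represents_0_limit[of "\<lambda>n. x n - x' n" y] represents_diff[OF x x'] y by (simp add: represents_def)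
  moreover have "(\<lambda>n. B (y n - y' n) (x' n)) \<longlonglongrightarrow> 0"
    using represents_0_limit[of "\<lambda>n. y n - y' n" x'] represents_diff[OF y y'] x' by (simp add: represents_def)
  then have "(\<lambda>n. cnj (B (y n - y' n) (x' n))) \<longlonglongrightarrow> cnj 0" by (rule tendsto_cnj)
  then have "(\<lambda>n. B (x' n) (y n - y' n)) \<longlonglongrightarrow> 0" unfolding B_cnj[symmetric] by simp
  ultimately have "(\<lambda>n. B (x n - x' n) (y n) + B (x' n) (y n - y' n) + B (x' n) (y' n)) \<longlonglongrightarrow> 0 + 0 + inner f g"
    using lim by (intro tendsto_add)
  then show ?thesis by (simp add: B_diff_left B_diff_right)
qed

end

lemma cring_class_ring: "cring (class_ring :: complex ring)"
  using class_field[where 'a = complex] by (simp add: field_def domain_def)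

context pd_kernel
begin

definition HK :: "('s \<Rightarrow> complex) hilbert" where
  "HK = \<lparr>carrier = {f. \<exists>x. represents x f}, mult = (\<lambda>f g. f), one = (\<lambda>_. 0),
    ring.zero = (\<lambda>_. 0), ring.add = (\<lambda>f g s. f s + g s), smult = (\<lambda>c f s. c * f s), hinner = inner\<rparr>"

lemma HK_simps [simp]:
  "f \<in> carrier HK \<longleftrightarrow> (\<exists>x. represents x f)" "\<zero>\<^bsub>HK\<^esub> = (\<lambda>_. 0)" "f \<oplus>\<^bsub>HK\<^esub> g = (\<lambda>s. f s + g s)"
  "c \<odot>\<^bsub>HK\<^esub> f = (\<lambda>s. c * f s)" "hinner HK = inner"
  by (simp_all add: HK_def)

lemma represents_zero: "represents (\<lambda>_. 0) (\<lambda>_. 0)"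
  using represents_const[of 0] by (simp add: B_def)

lemma represents_uminus: "represents x f \<Longrightarrow> represents (\<lambda>n. - x n) (\<lambda>s. - f s)"
  using represents_diff[OF represents_zero] by fastforce

lemma abelian_group_HK: "abelian_group HK"
proof (rule abelian_groupI)
  show "f \<oplus>\<^bsub>HK\<^esub> g \<in> carrier HK" if "f \<in> carrier HK" "g \<in> carrier HK" for f g
    using that represents_add unfolding HK_simps by blast
  show "\<zero>\<^bsub>HK\<^esub> \<in> carrier HK" using represents_zero unfolding HK_simps by blast
  fix f assume "f \<in> carrier HK"
  then obtain x where "represents x f" by auto
  then have "(\<lambda>s. - f s) \<in> carrier HK" using represents_uminus unfolding HK_simps by blast
  moreover have "(\<lambda>s. - f s) \<oplus>\<^bsub>HK\<^esub> f = \<zero>\<^bsub>HK\<^esub>" by simp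
  ultimately show "\<exists>g\<in>carrier HK. g \<oplus>\<^bsub>HK\<^esub> f = \<zero>\<^bsub>HK\<^esub>" by blast
qed (simp_all add: fun_eq_iff add_ac)

lemma HK_minus:
  assumes "f \<in> carrier HK" "g \<in> carrier HK"
  shows "f \<ominus>\<^bsub>HK\<^esub> g = (\<lambda>s. f s - g s)"
proof -
  interpret G: abelian_group HK by (rule abelian_group_HK)
  obtain x where "represents x g" using assms by auto
  then have "(\<lambda>s. - g s) \<in> carrier HK" using represents_uminus unfolding HK_simps by blast
  then have "\<ominus>\<^bsub>HK\<^esub> g = (\<lambda>s. - g s)" using assms(2) by (intro G.minus_equality abelian_group_HK) simp_all
  then show ?thesis by (simp add: a_minus_def)
qed

lemma module_HK: "module (class_ring :: complex ring) HK"
proof (rule moduleI[OF cring_class_ring abelian_group_HK])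
  show "a \<odot>\<^bsub>HK\<^esub> f \<in> carrier HK" if "f \<in> carrier HK" for a :: complex and f
    using that represents_csmul unfolding HK_simps by blast
qed (simp_all add: class_ring_simps algebra_simps)

lemma hnorm_HK:
  assumes "represents x f"
  shows "(\<lambda>n. N (x n)) \<longlonglongrightarrow> hnorm HK f"
  using tendsto_real_sqrt[OF tendsto_Re[OF inner_limit[OF assms assms]]]
  by (simp add: N_def hnorm_def)

text \<open>A diagonal argument: from a sequence representing \<open>s i\<close> the entry
  \<open>c i\<close> is taken, which is within \<open>1 / real (Suc i)\<close> of all later entries.
  Then \<open>c\<close> is Cauchy and the function it represents is the limit.\<close>

lemma HK_complete:
  assumes s: "\<And>i. s i \<in> carrier HK"
    and cauchy: "\<And>e. e > 0 \<Longrightarrow> \<exists>M. \<forall>i\<ge>M. \<forall>j\<ge>M. hnorm HK (s i \<ominus>\<^bsub>HK\<^esub> s j) < e"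
  shows "\<exists>f\<in>carrier HK. (\<lambda>i. hnorm HK (s i \<ominus>\<^bsub>HK\<^esub> f)) \<longlonglongrightarrow> 0"
proof -
  obtain x where x: "\<And>i. represents (x i) (s i)" using s unfolding HK_simps by metis
  have "\<exists>m. \<forall>n\<ge>m. N (x i n - x i m) < 1 / real (Suc i)" for i
  proof -
    have "cauchy (x i)" using x by (simp add: represents_def)
    then have "\<exists>M. \<forall>p\<ge>M. \<forall>q\<ge>M. N (x i p - x i q) < 1 / real (Suc i)" by (simp add: cauchy_def)
    then show ?thesis by blast
  qed
  then obtain m where m: "\<And>i n. n \<ge> m i \<Longrightarrow> N (x i n - x i (m i)) < 1 / real (Suc i)" by metis
  define c where "c i = x i (m i)" for i
  have lim: "(\<lambda>n. N (x i n - x j n)) \<longlonglongrightarrow> hnorm HK (s i \<ominus>\<^bsub>HK\<^esub> s j)" for i j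
    using hnorm_HK[OF represents_diff[OF x x]] HK_minus[OF s s] by simp
  have small: "\<exists>M. 1 / real (Suc M) < e" if "e > 0" for e :: real
    using nat_approx_posE[OF that] by metis
  have dec: "1 / real (Suc i) \<le> 1 / real (Suc M)" if "M \<le> i" for i M
    using that by (auto intro!: divide_left_mono)
  have "cauchy c" unfolding cauchy_def
  proof (intro allI impI)
    fix e :: real assume "e > 0"
    then have e3: "e / 3 > 0" by simp
    obtain M where M: "\<forall>i\<ge>M. \<forall>j\<ge>M. hnorm HK (s i \<ominus>\<^bsub>HK\<^esub> s j) < e / 3" using cauchy[OF e3] by blast
    obtain M' where M': "1 / real (Suc M') < e / 3" using small[OF e3] by blast
    have "N (c i - c j) < e" if ij: "i \<ge> max M M'" "j \<ge> max M M'" for i j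
    proof -
      have "hnorm HK (s i \<ominus>\<^bsub>HK\<^esub> s j) < e / 3" using M ij by simp
      then have "\<forall>\<^sub>F n in sequentially. N (x i n - x j n) < e / 3" using lim by (intro order_tendstoD(2))
      then obtain n0 where n0: "\<forall>n\<ge>n0. N (x i n - x j n) < e / 3" by (auto simp: eventually_sequentially)
      define n where "n = max n0 (max (m i) (m j))"
      have "N (x i n - c i) < 1 / real (Suc i)" "N (x j n - c j) < 1 / real (Suc j)"
        using m[of i n] m[of j n] by (simp_all add: n_def c_def)
      then have "N (x i n - c i) < e / 3" "N (x j n - c j) < e / 3"
        using M' dec[of M' i] dec[of M' j] ij by auto
      moreover have "N (x i n - x j n) < e / 3" using n0 by (simp add: n_def)
      moreover have "N (c i - c j) \<le> N (c i - x i n) + N (x i n - c j)" by (rule N_triangle3)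
      moreover have "N (x i n - c j) \<le> N (x i n - x j n) + N (x j n - c j)" by (rule N_triangle3)
      ultimately show ?thesis using N_minus_commute[of "c i" "x i n"] by linarith
    qed
    then show "\<exists>M. \<forall>i\<ge>M. \<forall>j\<ge>M. N (c i - c j) < e" by blast
  qed
  define f where "f t = lim (\<lambda>n. B (c n) (\<delta> t))" for t
  have "cauchy (\<lambda>_. \<delta> t)" for t using represents_const[of "\<delta> t"] by (simp add: represents_def)
  then have f: "represents c f"
    unfolding represents_def f_def using \<open>cauchy c\<close> cauchy_convergent[OF \<open>cauchy c\<close>] by (simp add: convergent_LIMSEQ_iff)
  have fH: "f \<in> carrier HK" using f by auto
  have lim': "(\<lambda>n. N (x i n - c n)) \<longlonglongrightarrow> hnorm HK (s i \<ominus>\<^bsub>HK\<^esub> f)" for i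
    using hnorm_HK[OF represents_diff[OF x f]] HK_minus[OF s fH] by simp
  have "(\<lambda>i. hnorm HK (s i \<ominus>\<^bsub>HK\<^esub> f)) \<longlonglongrightarrow> 0"
  proof (rule LIMSEQ_I)
    fix e :: real assume "e > 0"
    then have e3: "e / 3 > 0" by simp
    obtain M where M: "\<forall>i\<ge>M. \<forall>j\<ge>M. N (c i - c j) < e / 3" using \<open>cauchy c\<close> e3 unfolding cauchy_def by meson
    obtain M' where M': "1 / real (Suc M') < e / 3" using small[OF e3] by blast
    have "norm (hnorm HK (s i \<ominus>\<^bsub>HK\<^esub> f) - 0) < e" if i: "i \<ge> max M M'" for i
    proof -
      have "N (x i n - c n) \<le> 2 * (e / 3)" if n: "n \<ge> max M (m i)" for n
      proof -
        have "N (x i n - c i) < e / 3" using m[of i n] n M' dec[of M' i] i by (simp add: c_def)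
        moreover have "N (c i - c n) < e / 3" using M i n by simp
        moreover have "N (x i n - c n) \<le> N (x i n - c i) + N (c i - c n)" by (rule N_triangle3)
        ultimately show ?thesis by linarith
      qed
      then have "hnorm HK (s i \<ominus>\<^bsub>HK\<^esub> f) \<le> 2 * (e / 3)" by (intro LIMSEQ_le_const2[OF lim']) blast
      moreover have "0 \<le> hnorm HK (s i \<ominus>\<^bsub>HK\<^esub> f)" by (rule LIMSEQ_le_const[OF lim']) simp
      ultimately show ?thesis using \<open>e > 0\<close> by simp
    qed
    then show "\<exists>M. \<forall>i\<ge>M. norm (hnorm HK (s i \<ominus>\<^bsub>HK\<^esub> f) - 0) < e" by blast
  qed
  then show ?thesis using fH by blast
qed

lemma hilbert_space_HK: "hilbert_space HK"
proof (intro hilbert_space.intro hilbert_space_axioms.intro module_HK)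
  fix f g h assume "f \<in> carrier HK" "g \<in> carrier HK" "h \<in> carrier HK"
  then obtain x y z where *: "represents x f" "represents y g" "represents z h" by auto
  have "(\<lambda>n. B (x n + y n) (z n)) \<longlonglongrightarrow> inner (\<lambda>s. f s + g s) h"
    using * by (intro inner_limit represents_add)
  moreover have "(\<lambda>n. B (x n + y n) (z n)) \<longlonglongrightarrow> inner f h + inner g h"
    unfolding B_add_left using * by (intro tendsto_add inner_limit)
  ultimately show "hinner HK (f \<oplus>\<^bsub>HK\<^esub> g) h = hinner HK f h + hinner HK g h"
    by (simp add: LIMSEQ_unique)
next
  fix f g c assume "f \<in> carrier HK" "g \<in> carrier HK"
  then obtain x y where *: "represents x f" "represents y g" by auto
  have "(\<lambda>n. B (csmul c (x n)) (y n)) \<longlonglongrightarrow> inner (\<lambda>s. c * f s) g"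
    using * by (intro inner_limit represents_csmul)
  moreover have "(\<lambda>n. B (csmul c (x n)) (y n)) \<longlonglongrightarrow> c * inner f g"
    unfolding B_csmul_left using * by (intro tendsto_mult_left inner_limit)
  ultimately show "hinner HK (c \<odot>\<^bsub>HK\<^esub> f) g = c * hinner HK f g"
    by (simp add: LIMSEQ_unique)
next
  fix f g assume "f \<in> carrier HK" "g \<in> carrier HK"
  then obtain x y where *: "represents x f" "represents y g" by auto
  have "(\<lambda>n. B (y n) (x n)) \<longlonglongrightarrow> inner g f" using * by (intro inner_limit)
  moreover have "(\<lambda>n. cnj (B (x n) (y n))) \<longlonglongrightarrow> cnj (inner f g)" using * by (intro tendsto_cnj inner_limit)
  then have "(\<lambda>n. B (y n) (x n)) \<longlonglongrightarrow> cnj (inner f g)" unfolding B_cnj[symmetric] .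
  ultimately show "hinner HK g f = cnj (hinner HK f g)"
    by (simp add: LIMSEQ_unique)
next
  fix f assume "f \<in> carrier HK"
  then obtain x where x: "represents x f" by auto
  have lim: "(\<lambda>n. Re (B (x n) (x n))) \<longlonglongrightarrow> Re (inner f f)" by (intro tendsto_Re inner_limit x)
  then show "0 \<le> Re (hinner HK f f)"
    using LIMSEQ_le_const[OF lim, of 0] B_nonneg by simp
  assume 0: "hinner HK f f = 0"
  \<comment> \<open>The value \<open>f s\<close> is the limit of pairings with
    \<open>\<delta> s\<close>, which Cauchy-Schwarz bounds by the norms tending to 0.\<close>
  have "f s = 0" for s
  proof -
    have "(\<lambda>n. N (x n) * N (\<delta> s)) \<longlonglongrightarrow> hnorm HK f * N (\<delta> s)" by (intro tendsto_mult_right hnorm_HK x)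
    moreover have "hnorm HK f = 0" using 0 by (simp add: hnorm_def)
    ultimately have "(\<lambda>n. N (x n) * N (\<delta> s)) \<longlonglongrightarrow> 0" by simp
    moreover have "\<forall>\<^sub>F n in sequentially. norm (B (x n) (\<delta> s)) \<le> N (x n) * N (\<delta> s)" by (simp add: B_le)
    ultimately have "(\<lambda>n. B (x n) (\<delta> s)) \<longlonglongrightarrow> 0" by (rule Lim_null_comparison[rotated])
    then show ?thesis using x LIMSEQ_unique unfolding represents_def by blast
  qed
  then show "f = \<zero>\<^bsub>HK\<^esub>" by auto
next
  show "\<exists>f\<in>carrier HK. (\<lambda>i. hnorm HK (s i \<ominus>\<^bsub>HK\<^esub> f)) \<longlonglongrightarrow> 0"
    if "\<And>i. s i \<in> carrier HK" "\<And>e. e > 0 \<Longrightarrow> \<exists>M. \<forall>i\<ge>M. \<forall>j\<ge>M. hnorm HK (s i \<ominus>\<^bsub>HK\<^esub> s j) < e" for s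
    using that by (rule HK_complete)
qed

end

section \<open>Representations from group actions that preserve the kernel\<close>

locale pd_kernel_action = pd_kernel K for K :: "'s \<Rightarrow> 's \<Rightarrow> real" +
  fixes act :: "'g::group_add \<Rightarrow> 's \<Rightarrow> 's"
  assumes act_0: "act 0 s = s" and act_plus: "act (g + h) s = act g (act h s)"
    and K_act: "K (act g s) (act g t) = K s t"
begin

lemma act_cancel [simp]: "act (- g) (act g s) = s" "act g (act (- g) s) = s"
  by (simp_all add: act_0 flip: act_plus)

lemma inj_act: "inj (act g)"
  by (metis act_cancel(1) injI)

text \<open>As \<open>map_key\<close> precomposes, moving the support by \<open>g\<close> calls for
  the action of \<open>- g\<close>.\<close>

definition push :: "'g \<Rightarrow> ('s \<Rightarrow>\<^sub>0 complex) \<Rightarrow> ('s \<Rightarrow>\<^sub>0 complex)" where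
  "push g c = Poly_Mapping.map_key (act (- g)) c"

lemma push_add: "push g (a + b) = push g a + push g b"
  by (simp add: push_def map_key_plus inj_act)

lemma push_single: "push g (Poly_Mapping.single s a) = Poly_Mapping.single (act g s) a"
  using map_key_single[OF inj_act, of "- g" "act g s" a] by (simp add: push_def)

lemma B_push: "B (push g c) (push g d) = B c d"
proof (induction c rule: poly_mapping_additive_induct)
  case (single s a)
  show ?case
    by (induction d rule: poly_mapping_additive_induct)
       (simp_all add: push_add push_single B_single K_act B_add_right)
qed (simp add: push_add B_add_left)

lemma push_diff: "push g (a - b) = push g a - push g b"
  using push_add[of g "a - b" b] by (simp add: eq_diff_eq)

definition shift :: "'g \<Rightarrow> ('s \<Rightarrow> complex) \<Rightarrow> 's \<Rightarrow> complex" where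
  "shift g f = (\<lambda>s. f (act (- g) s))"

lemma represents_push: "represents x f \<Longrightarrow> represents (\<lambda>n. push g (x n)) (shift g f)"
proof -
  assume x: "represents x f"
  have "B (push g (x n)) (\<delta> s) = B (x n) (\<delta> (act (- g) s))" for n s
    using B_push[of g "x n" "\<delta> (act (- g) s)"] by (simp add: push_single)
  moreover have "N (push g (x i) - push g (x j)) = N (x i - x j)" for i j
    by (simp add: N_def B_push flip: push_diff)
  ultimately show ?thesis using x by (simp add: represents_def cauchy_def shift_def)
qed

lemma shift_plus: "shift (g + h) f = shift g (shift h f)"
  by (simp only: shift_def minus_add act_plus)

lemma shift_0: "shift 0 f = f"
  by (simp add: shift_def act_0)

lemma unitary_representation_HK: "unitary_representation HK shift"
  unfolding unitary_representation_def unitary_operator_def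
proof (intro conjI allI ballI hilbert_space_HK)
  have closed: "shift g f \<in> carrier HK" if "f \<in> carrier HK" for g f
    using that represents_push unfolding HK_simps by blast
  have inv: "shift (- g) (shift g f) = f" "shift g (shift (- g) f) = f" for g f
    by (simp_all add: shift_0 flip: shift_plus)
  show "bij_betw (shift g) (carrier HK) (carrier HK)" for g
    by (rule bij_betw_byWitness[where f' = "shift (- g)"]) (use closed inv in auto)
  show "shift g (f \<oplus>\<^bsub>HK\<^esub> f') = shift g f \<oplus>\<^bsub>HK\<^esub> shift g f'" "shift g (c \<odot>\<^bsub>HK\<^esub> f) = c \<odot>\<^bsub>HK\<^esub> shift g f" for g f f' c
    by (simp_all add: shift_def)
  show "hinner HK (shift g f) (shift g f') = hinner HK f f'" if "f \<in> carrier HK" "f' \<in> carrier HK" for g f f'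
  proof -
    obtain x y where xy: "represents x f" "represents y f'" using \<open>f \<in> carrier HK\<close> \<open>f' \<in> carrier HK\<close> by auto
    have "(\<lambda>n. B (push g (x n)) (push g (y n))) \<longlonglongrightarrow> inner (shift g f) (shift g f')"
      using xy by (intro inner_limit represents_push)
    then show ?thesis using inner_limit[OF xy] by (simp add: B_push LIMSEQ_unique)
  qed
  show "shift (g + h) f = shift g (shift h f)" for g h f by (rule shift_plus)
qed

definition ket :: "'s \<Rightarrow> ('s \<Rightarrow> complex)" where
  "ket s = (\<lambda>t. B (\<delta> s) (\<delta> t))"

lemma ket_closed: "ket s \<in> carrier HK"
  using represents_const[of "\<delta> s"] unfolding HK_simps ket_def by blast

lemma shift_ket: "shift g (ket s) = ket (act g s)"
proof
  fix t
  show "shift g (ket s) t = ket (act g s) t"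
    using K_act[of g s "act (- g) t"] by (simp add: shift_def ket_def B_single)
qed

lemma hinner_ket: "hinner HK (ket s) (ket t) = of_real (K s t)"
  using inner_limit[OF represents_const[of "\<delta> s"] represents_const[of "\<delta> t"]]
  by (simp add: ket_def B_single LIMSEQ_const_iff)

end

text \<open>Vanishing of cohomology is known only for Hilbert spaces with carriers in
  \<open>'h\<close>. All of the structure is copied along an injection of the carrier.\<close>

lemma transport_unitary_representation:
  fixes H :: "'a hilbert" and \<pi> :: "'g::group_add \<Rightarrow> 'a \<Rightarrow> 'a" and f :: "'a \<Rightarrow> 'h"
  assumes rep: "unitary_representation H \<pi>" and f: "inj_on f (carrier H)"
  obtains H' :: "'h hilbert" and \<pi>' where "unitary_representation H' \<pi>'"
    "\<And>x. x \<in> carrier H \<Longrightarrow> f x \<in> carrier H'"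
    "\<And>x y. x \<in> carrier H \<Longrightarrow> y \<in> carrier H \<Longrightarrow> hinner H' (f x) (f y) = hinner H x y"
    "\<And>g x. x \<in> carrier H \<Longrightarrow> \<pi>' g (f x) = f (\<pi> g x)"
proof -
  interpret unitary_rep H \<pi> using rep by unfold_locales
  define r where "r = the_inv_into (carrier H) f"
  have r [simp]: "r (f x) = x" if "x \<in> carrier H" for x
    using that f by (simp add: r_def the_inv_into_f_f)
  define H' :: "'h hilbert" where "H' = \<lparr>carrier = f ` carrier H, mult = (\<lambda>x y. x), one = f \<zero>\<^bsub>H\<^esub>,
    ring.zero = f \<zero>\<^bsub>H\<^esub>, add = (\<lambda>x y. f (r x \<oplus>\<^bsub>H\<^esub> r y)), smult = (\<lambda>c x. f (c \<odot>\<^bsub>H\<^esub> r x)),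
    hinner = (\<lambda>x y. hinner H (r x) (r y))\<rparr>"
  define \<pi>' where "\<pi>' g x = f (\<pi> g (r x))" for g x
  have H' [simp]: "carrier H' = f ` carrier H" "\<zero>\<^bsub>H'\<^esub> = f \<zero>\<^bsub>H\<^esub>" "x \<oplus>\<^bsub>H'\<^esub> y = f (r x \<oplus>\<^bsub>H\<^esub> r y)"
    "c \<odot>\<^bsub>H'\<^esub> x = f (c \<odot>\<^bsub>H\<^esub> r x)" "hinner H' x y = hinner H (r x) (r y)" for x y c
    by (simp_all add: H'_def)
  have ab: "abelian_group H'"
  proof (rule abelian_groupI)
    fix x assume "x \<in> carrier H'"
    then obtain u where u: "u \<in> carrier H" "x = f u" by auto
    then have "f (\<ominus>\<^bsub>H\<^esub> u) \<oplus>\<^bsub>H'\<^esub> x = \<zero>\<^bsub>H'\<^esub>" by (simp add: M.l_neg)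
    then show "\<exists>y\<in>carrier H'. y \<oplus>\<^bsub>H'\<^esub> x = \<zero>\<^bsub>H'\<^esub>" using u(1) by (intro bexI[of _ "f (\<ominus>\<^bsub>H\<^esub> u)"]) simp_all
  qed (auto simp: M.a_assoc M.a_comm M.a_lcomm)
  then interpret A: abelian_group H' .
  have minus: "f x \<ominus>\<^bsub>H'\<^esub> f y = f (x \<ominus>\<^bsub>H\<^esub> y)" if "x \<in> carrier H" "y \<in> carrier H" for x y
  proof -
    have "\<ominus>\<^bsub>H'\<^esub> f y = f (\<ominus>\<^bsub>H\<^esub> y)"
      using that by (intro A.minus_equality ab) (simp_all add: M.l_neg)
    then show ?thesis using that by (simp add: a_minus_def)
  qed
  have norm: "hnorm H' (f x) = hnorm H x" if "x \<in> carrier H" for x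
    using that by (simp add: hnorm_def)
  have hs: "hilbert_space H'"
  proof (intro hilbert_space.intro hilbert_space_axioms.intro)
    show "module (class_ring :: complex ring) H'"
      by (rule moduleI[OF cring_class_ring ab])
         (auto simp: smult_l_distr[unfolded class_ring_simps] smult_r_distr[unfolded class_ring_simps]
            smult_assoc1[unfolded class_ring_simps] smult_one[unfolded class_ring_simps] class_ring_simps)
    show "\<exists>x\<in>carrier H'. (\<lambda>i. hnorm H' (s i \<ominus>\<^bsub>H'\<^esub> x)) \<longlonglongrightarrow> 0"
      if s: "\<And>i. s i \<in> carrier H'" and e: "\<And>e. e > 0 \<Longrightarrow> \<exists>N. \<forall>i\<ge>N. \<forall>j\<ge>N. hnorm H' (s i \<ominus>\<^bsub>H'\<^esub> s j) < e" for s
    proof -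
      have "\<exists>u. u \<in> carrier H \<and> s i = f u" for i using s[of i] by auto
      then obtain u where u: "\<And>i. u i \<in> carrier H" "\<And>i. s i = f (u i)" by metis
      have "\<exists>x\<in>carrier H. (\<lambda>i. hnorm H (u i \<ominus>\<^bsub>H\<^esub> x)) \<longlonglongrightarrow> 0"
        using e u by (intro complete) (simp_all add: minus norm)
      then obtain x where "x \<in> carrier H" "(\<lambda>i. hnorm H (u i \<ominus>\<^bsub>H\<^esub> x)) \<longlonglongrightarrow> 0" by blast
      then show ?thesis using u by (intro bexI[of _ "f x"]) (simp_all add: minus norm)
    qed
    show "hinner H' (x \<oplus>\<^bsub>H'\<^esub> y) z = hinner H' x z + hinner H' y z"
      if "x \<in> carrier H'" "y \<in> carrier H'" "z \<in> carrier H'" for x y z using that by (auto simp: hinner_add)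
    show "hinner H' (c \<odot>\<^bsub>H'\<^esub> x) y = c * hinner H' x y" if "x \<in> carrier H'" "y \<in> carrier H'" for x y c
      using that by (auto simp: hinner_smult)
    show "hinner H' y x = cnj (hinner H' x y)" if "x \<in> carrier H'" "y \<in> carrier H'" for x y
    proof -
      have "r x \<in> carrier H" "r y \<in> carrier H" using that by auto
      then show ?thesis unfolding H' by (rule hinner_cnj)
    qed
    show "0 \<le> Re (hinner H' x x)" if "x \<in> carrier H'" for x using that by (auto simp: hinner_nonneg)
    show "x = \<zero>\<^bsub>H'\<^esub>" if "x \<in> carrier H'" "hinner H' x x = 0" for x
    proof -
      obtain u where "u \<in> carrier H" "x = f u" using \<open>x \<in> carrier H'\<close> by auto
      then show ?thesis using \<open>hinner H' x x = 0\<close> hinner_definite[of u] by simp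
    qed
  qed
  have bij: "bij_betw (\<pi>' g) (carrier H') (carrier H')" for g
  proof (rule bij_betw_byWitness[where f' = "\<pi>' (- g)"])
    show "\<forall>x\<in>carrier H'. \<pi>' (- g) (\<pi>' g x) = x" "\<forall>x\<in>carrier H'. \<pi>' g (\<pi>' (- g) x) = x"
      by (auto simp: \<pi>'_def pi_0 simp flip: pi_plus)
  qed (auto simp: \<pi>'_def)
  have p1: "\<pi>' g (x \<oplus>\<^bsub>H'\<^esub> y) = \<pi>' g x \<oplus>\<^bsub>H'\<^esub> \<pi>' g y"
    "hinner H' (\<pi>' g x) (\<pi>' g y) = hinner H' x y" if "x \<in> carrier H'" "y \<in> carrier H'" for g x y
    using that by (auto simp: \<pi>'_def pi_add pi_inner)
  have p2: "\<pi>' g (c \<odot>\<^bsub>H'\<^esub> x) = c \<odot>\<^bsub>H'\<^esub> \<pi>' g x" "\<pi>' (g + h) x = \<pi>' g (\<pi>' h x)"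
    if "x \<in> carrier H'" for g h c x
    using that by (auto simp: \<pi>'_def pi_smult pi_plus)
  have "unitary_representation H' \<pi>'"
    unfolding unitary_representation_def unitary_operator_def
    by (intro conjI allI ballI hs bij p1 p2; assumption)
  then show ?thesis by (rule that) (auto simp: \<pi>'_def)
qed

text \<open>Complex functions on a countable set have at most the cardinality of the continuum: such
  a function is coded by a set of natural numbers, hence by a real number.\<close>

lemma inj_functions_into_continuum:
  assumes "countable (UNIV :: 's set)" "(UNIV :: real set) \<lesssim> (UNIV :: 'h set)"
  obtains f :: "('s \<Rightarrow> complex) \<Rightarrow> 'h" where "inj f"
proof -
  have "(UNIV :: real set) \<lesssim> (UNIV :: nat set set)"
    by (rule eqpoll_imp_lepoll[OF eqpoll_sym[OF nat_sets_eqpoll_reals]])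
  then obtain r :: "real \<Rightarrow> nat set" where r: "inj r" unfolding lepoll_def by blast
  have "(UNIV :: nat set set) \<lesssim> (UNIV :: real set)" by (rule eqpoll_imp_lepoll[OF nat_sets_eqpoll_reals])
  then obtain t :: "nat set \<Rightarrow> real" where t: "inj t" unfolding lepoll_def by blast
  obtain h :: "real \<Rightarrow> 'h" where h: "inj h" using assms(2) unfolding lepoll_def by blast
  obtain e :: "'s \<Rightarrow> nat" where e: "inj e" using assms(1) by (auto simp: countable_def)
  \<comment> \<open>The triples carry the code of the argument, a flag for real or imaginary part,
    and an element of the set of naturals coding that real number.\<close>
  define M where "M \<phi> = {(k, b, n). \<exists>s. k = e s \<and> n \<in> r ((if b then Re else Im) (\<phi> s))}"
    for \<phi> :: "'s \<Rightarrow> complex"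
  define F where "F \<phi> = to_nat ` M \<phi>" for \<phi>
  have mem: "(e s, b, n) \<in> M \<phi> \<longleftrightarrow> n \<in> r ((if b then Re else Im) (\<phi> s))" for \<phi> s b n
    by (simp add: M_def inj_eq[OF e])
  have "inj F"
  proof (rule injI, rule ext)
    fix \<phi> \<psi> s assume "F \<phi> = F \<psi>"
    then have "M \<phi> = M \<psi>" unfolding F_def by (rule inj_image_eq_iff[OF inj_to_nat, THEN iffD1])
    then have "r ((if b then Re else Im) (\<phi> s)) = r ((if b then Re else Im) (\<psi> s))" for b
      using mem[of s b _ \<phi>] mem[of s b _ \<psi>] by (intro Set.set_eqI) metis
    then have "(if b then Re else Im) (\<phi> s) = (if b then Re else Im) (\<psi> s)" for b
      by (rule injD[OF r])
    from this[of True] this[of False] show "\<phi> s = \<psi> s" by (simp add: complex_eq_iff)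
  qed
  then have "inj (h \<circ> t \<circ> F)" using h t by (intro inj_compose)
  then show ?thesis by (rule that)
qed

section \<open>Sums of squares in the image of the conjugation map\<close>

locale finite_type_complex =
  fixes X :: "'v set set" and act :: "'g::group_add \<Rightarrow> 'v \<Rightarrow> 'v" and ori :: "'v set \<Rightarrow> 'v list set"
    and \<tau> :: "nat \<Rightarrow> nat \<Rightarrow> 'v set" and M :: nat
  assumes type_F: "type_F_complex M X act"
    and inv_ori: "invariant_orientation X act ori"
    and reps: "\<And>m. m \<le> M \<Longrightarrow> orbit_representatives X act m (\<tau> m)"

sublocale finite_type_complex \<subseteq> oriented_complex X ori
  using type_F inv_ori by unfold_locales (auto simp: type_F_complex_def invariant_orientation_def)

context finite_type_complex
begin

lemma act_0: "v \<in> \<Union>X \<Longrightarrow> act 0 v = v" and act_plus: "v \<in> \<Union>X \<Longrightarrow> act (g + h) v = act g (act h v)"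
  and act_simplex: "\<sigma> \<in> X \<Longrightarrow> act g ` \<sigma> \<in> X"
  using type_F unfolding type_F_complex_def simplicial_action_def by blast+

lemma act_vertex: "v \<in> \<Union>X \<Longrightarrow> act g v \<in> \<Union>X"
  using act_simplex[of _ g] by blast

lemma image_act_0: "\<sigma> \<subseteq> \<Union>X \<Longrightarrow> act 0 ` \<sigma> = \<sigma>"
  using act_0 by (auto simp: image_def subset_eq)

lemma image_act_plus: "\<sigma> \<subseteq> \<Union>X \<Longrightarrow> act (g + h) ` \<sigma> = act g ` act h ` \<sigma>"
  unfolding image_image by (rule image_cong) (auto intro!: act_plus)

lemma inj_on_act: "inj_on (act g) (\<Union>X)"
proof (rule inj_on_inverseI[where g = "act (- g)"])
  fix v assume "v \<in> \<Union>X"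
  then show "act (- g) (act g v) = v" using act_plus[of v "- g" g] act_0[of v] by simp
qed

lemma act_free:
  assumes "\<sigma> \<in> X" "act g ` \<sigma> = act h ` \<sigma>"
  shows "g = h"
proof -
  have sub: "\<sigma> \<subseteq> \<Union>X" using assms(1) by blast
  have "act (- h + g) ` \<sigma> = act (- h + h) ` \<sigma>" by (simp only: image_act_plus[OF sub] assms(2))
  also have "\<dots> = \<sigma>" using image_act_0[OF sub] by simp
  finally have "- h + g = 0" using type_F assms(1) unfolding type_F_complex_def free_action_def by blast
  then have "h + (- h + g) = h + 0" by (rule arg_cong)
  then show ?thesis by (simp only: add_minus_cancel add_0_right)
qed

lemma inj_orbit: "\<sigma> \<in> X \<Longrightarrow> inj (\<lambda>g. act g ` \<sigma>)"
  using act_free by (auto intro: injI)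

definition actC :: "'g \<Rightarrow> ('v set \<Rightarrow>\<^sub>0 real) \<Rightarrow> ('v set \<Rightarrow>\<^sub>0 real)" where
  "actC g = linear_ext (\<lambda>\<rho>. Poly_Mapping.single (act g ` \<rho>) 1)"

lemma actC_simps: "actC g 0 = 0" "actC g (a + b) = actC g a + actC g b" "actC g (smul r a) = smul r (actC g a)"
  "actC g (sum f A) = (\<Sum>x\<in>A. actC g (f x))" "actC g (Poly_Mapping.single \<rho> r) = Poly_Mapping.single (act g ` \<rho>) r"
  by (simp_all add: actC_def linear_ext_add linear_ext_smul linear_ext_sum)

lemma oriented_simplex_act:
  assumes "set ys \<in> insert {} X"
  shows "oriented_simplex (map (act g) ys) = actC g (oriented_simplex ys)"
proof (cases "ys = []")
  case True
  then show ?thesis by (simp add: oriented_simplex_def actC_simps)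
next
  case False
  then have X': "set ys \<in> X" using assms by simp
  then have sub: "set ys \<subseteq> \<Union>X" by blast
  have inj: "inj_on (act g) (set ys)" using inj_on_act sub by (rule inj_on_subset)
  have ori_sub: "set zs = set ys" if "zs \<in> ori (set ys)" for zs
  proof -
    obtain xs where "set xs = set ys" "ori (set ys) = {ys. even_reordering xs ys}" using ori[OF X'] by blast
    then show ?thesis using that by (auto simp: even_reordering_def)
  qed
  have "ori (act g ` set ys) = map (act g) ` ori (set ys)"
    using inv_ori X' by (simp add: invariant_orientation_def)
  moreover have "map (act g) ys \<in> map (act g) ` ori (set ys) \<longleftrightarrow> ys \<in> ori (set ys)"
  proof
    assume "map (act g) ys \<in> map (act g) ` ori (set ys)"
    then obtain zs where zs: "zs \<in> ori (set ys)" "map (act g) ys = map (act g) zs" by auto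
    have "inj_on (act g) (set ys \<union> set zs)" using inj ori_sub[OF zs(1)] by simp
    then have "ys = zs" using zs(2) by (metis inj_on_map_eq_map)
    then show "ys \<in> ori (set ys)" using zs(1) by simp
  qed simp
  ultimately have "orientation_sign ori (map (act g) ys) = orientation_sign ori ys"
    by (simp add: orientation_sign_def)
  then show ?thesis
    using inj X' act_simplex[OF X'] by (simp add: oriented_simplex_def actC_simps distinct_map)
qed

lemma simplicial_boundary_act:
  assumes "\<sigma> \<in> X"
  shows "simplicial_boundary ori (act g ` \<sigma>) = actC g (simplicial_boundary ori \<sigma>)"
proof -
  obtain xs where xs: "distinct xs" "set xs = \<sigma>" "orientation_sign ori xs = 1"
    "simplicial_boundary ori \<sigma> = alt_sum xs oriented_simplex"
    using simplicial_boundary_oriented_simplex[OF assms] by blast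
  have "oriented_simplex xs = Poly_Mapping.single \<sigma> 1" using xs assms by (simp add: oriented_simplex_def)
  then have "oriented_simplex (map (act g) xs) = Poly_Mapping.single (act g ` \<sigma>) 1"
    using oriented_simplex_act[of xs g] xs assms by (simp add: actC_simps)
  moreover have "boundary (oriented_simplex (map (act g) xs)) = alt_sum (map (act g) xs) oriented_simplex"
    using xs act_simplex[OF assms] by (intro boundary_oriented_simplex) simp
  moreover have "alt_sum (map (act g) xs) oriented_simplex = alt_sum xs (\<lambda>ys. actC g (oriented_simplex ys))"
  proof -
    have "oriented_simplex (omit i (map (act g) xs)) = actC g (oriented_simplex (omit i xs))" for i
    proof -
      have "set (omit i xs) \<in> insert {} X" using face_closed[OF assms] set_omit[of i xs] xs(2) by blast
      then show ?thesis by (simp add: omit_map oriented_simplex_act)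
    qed
    then show ?thesis by (simp add: alt_sum_conv)
  qed
  moreover have "alt_sum xs (\<lambda>ys. actC g (oriented_simplex ys)) = actC g (alt_sum xs oriented_simplex)"
    by (simp add: alt_sum_conv actC_simps)
  ultimately show ?thesis using xs(4) by (simp add: boundary_def)
qed

section \<open>Rows over the group algebra as chains\<close>

definition orb :: "'v set \<Rightarrow> 'g group_algebra \<Rightarrow> ('v set \<Rightarrow>\<^sub>0 real)" where
  "orb \<sigma> = linear_ext (\<lambda>g. Poly_Mapping.single (act g ` \<sigma>) 1)"

lemma orb_simps: "orb \<sigma> 0 = 0" "orb \<sigma> (a + b) = orb \<sigma> a + orb \<sigma> b" "orb \<sigma> (sum f A) = (\<Sum>x\<in>A. orb \<sigma> (f x))"
  "orb \<sigma> (Poly_Mapping.single g r) = Poly_Mapping.single (act g ` \<sigma>) r"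
  by (simp_all add: orb_def linear_ext_add linear_ext_sum)

lemma orb_mult:
  assumes "\<sigma> \<in> X"
  shows "orb \<sigma> (a * b) = linear_ext (\<lambda>g. actC g (orb \<sigma> b)) a"
proof (induction a rule: poly_mapping_additive_induct)
  case (single g r)
  have "\<sigma> \<subseteq> \<Union>X" using assms by blast
  then show ?case
    by (induction b rule: poly_mapping_additive_induct)
       (simp_all add: mult_single orb_simps actC_simps image_act_plus distrib_left smul_distrib)
qed (simp add: distrib_right orb_simps linear_ext_add)

lemma boundary_orb:
  assumes "\<sigma> \<in> X"
  shows "boundary (orb \<sigma> a) = linear_ext (\<lambda>g. actC g (simplicial_boundary ori \<sigma>)) a"
  unfolding boundary_def orb_def linear_ext_linear_ext by (simp add: simplicial_boundary_act[OF assms])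

text \<open>Chains of dimension \<open>m\<close> form a free module over the group algebra with
  basis the orbit representatives; \<open>y\<close> is the row of coordinates.\<close>

definition \<Phi> :: "nat \<Rightarrow> (nat \<Rightarrow> 'g group_algebra) \<Rightarrow> ('v set \<Rightarrow>\<^sub>0 real)" where
  "\<Phi> m y = (\<Sum>j<num_orbits X act m. orb (\<tau> m j) (y j))"

lemma \<tau>_simplex:
  assumes "m \<le> M" "j < num_orbits X act m"
  shows "\<tau> m j \<in> simplices X m" "\<tau> m j \<in> X" "act g ` \<tau> m j \<in> simplices X m"
proof -
  show 1: "\<tau> m j \<in> simplices X m" using reps[OF assms(1)] assms(2) by (simp add: orbit_representatives_def)
  then show 2: "\<tau> m j \<in> X" by (simp add: simplices_def)
  have "inj_on (act g) (\<tau> m j)" using inj_on_act 2 by (meson Union_upper inj_on_subset)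
  then show "act g ` \<tau> m j \<in> simplices X m" using 1 2 act_simplex by (simp add: simplices_def card_image)
qed

text \<open>Distinct representatives have distinct orbits and the action is free, so every simplex
  is the translate of a representative in only one way. Coordinates of chains are therefore well
  defined.\<close>

lemma orbit_unique:
  assumes m: "m \<le> M" and ij: "i < num_orbits X act m" "j < num_orbits X act m"
    and eq: "act g ` \<tau> m i = act h ` \<tau> m j"
  shows "i = j \<and> g = h"
proof -
  have sub: "\<tau> m i \<subseteq> \<Union>X" "\<tau> m j \<subseteq> \<Union>X" using \<tau>_simplex(2)[OF m] ij by blast+
  have orbit: "simplex_orbit act (act g ` \<sigma>) = simplex_orbit act \<sigma>" if s: "\<sigma> \<subseteq> \<Union>X" for g \<sigma>
  proof -
    have "act f ` act g ` \<sigma> = act (f + g) ` \<sigma>" for f using image_act_plus[OF s] by simp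
    moreover have "act f ` \<sigma> = act (f - g) ` act g ` \<sigma>" for f
      using image_act_plus[OF s, of "f - g" g] by simp
    ultimately show ?thesis unfolding simplex_orbit_def by blast
  qed
  have "simplex_orbit act (\<tau> m i) = simplex_orbit act (\<tau> m j)"
    using orbit[OF sub(1), of g] orbit[OF sub(2), of h] eq by simp
  moreover have "inj_on (\<lambda>i. simplex_orbit act (\<tau> m i)) {..<num_orbits X act m}"
    using reps[OF m] by (simp add: orbit_representatives_def bij_betw_def)
  ultimately have "i = j" using ij by (auto dest: inj_onD)
  then show ?thesis using act_free[OF \<tau>_simplex(2)[OF m ij(1)]] eq by simp
qed

lemma orbit_exists:
  assumes m: "m \<le> M" and "\<sigma> \<in> simplices X m"
  obtains j g where "j < num_orbits X act m" "\<sigma> = act g ` \<tau> m j"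
proof -
  have "simplex_orbit act \<sigma> \<in> simplex_orbits X act m" using assms(2) by (simp add: simplex_orbits_def)
  also have "\<dots> = (\<lambda>i. simplex_orbit act (\<tau> m i)) ` {..<num_orbits X act m}"
    using reps[OF m] by (simp add: orbit_representatives_def bij_betw_def)
  finally obtain j where j: "j < num_orbits X act m" "simplex_orbit act \<sigma> = simplex_orbit act (\<tau> m j)" by blast
  have "\<sigma> \<subseteq> \<Union>X" using assms(2) by (auto simp: simplices_def)
  then have "\<sigma> = act 0 ` \<sigma>" by (simp add: image_act_0)
  then have "\<sigma> \<in> simplex_orbit act \<sigma>" unfolding simplex_orbit_def by blast
  then show ?thesis using j that by (auto simp: simplex_orbit_def)
qed

lemma lookup_\<Phi>:
  assumes m: "m \<le> M" and j: "j < num_orbits X act m"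
  shows "Poly_Mapping.lookup (\<Phi> m y) (act g ` \<tau> m j) = Poly_Mapping.lookup (y j) g"
proof -
  have "Poly_Mapping.lookup (orb (\<tau> m i) a) (act g ` \<tau> m j) = (if i = j then Poly_Mapping.lookup a g else 0)"
    if i: "i < num_orbits X act m" for i a
  proof (induction a rule: poly_mapping_additive_induct)
    case (single h r)
    have "act h ` \<tau> m i = act g ` \<tau> m j \<longleftrightarrow> i = j \<and> h = g"
      using orbit_unique[OF m i j, of h g] by blast
    then show ?case by (simp add: orb_simps lookup_single when_def)
  qed (simp add: orb_simps lookup_add)
  then show ?thesis using j by (simp add: \<Phi>_def lookup_sum)
qed

lemma keys_\<Phi>:
  assumes m: "m \<le> M"
  shows "Poly_Mapping.keys (\<Phi> m y) \<subseteq> simplices X m"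
proof -
  have "Poly_Mapping.keys (orb (\<tau> m j) (y j)) \<subseteq> simplices X m" if "j < num_orbits X act m" for j
    unfolding orb_def using \<tau>_simplex(3)[OF m that] by (intro order.trans[OF keys_linear_ext]) auto
  then show ?thesis unfolding \<Phi>_def by (intro order.trans[OF keys_sum]) auto
qed

lemma chain_eqI:
  assumes m: "m \<le> M" and keys: "Poly_Mapping.keys c \<subseteq> simplices X m" "Poly_Mapping.keys c' \<subseteq> simplices X m"
    and eq: "\<And>j g. j < num_orbits X act m \<Longrightarrow> Poly_Mapping.lookup c (act g ` \<tau> m j) = Poly_Mapping.lookup c' (act g ` \<tau> m j)"
  shows "c = c'"
proof (rule poly_mapping_eqI)
  fix \<rho>
  show "Poly_Mapping.lookup c \<rho> = Poly_Mapping.lookup c' \<rho>"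
  proof (cases "\<rho> \<in> simplices X m")
    case True
    then show ?thesis using orbit_exists[OF m True] eq by metis
  next
    case False
    then have "\<rho> \<notin> Poly_Mapping.keys c" "\<rho> \<notin> Poly_Mapping.keys c'" using keys by blast+
    then show ?thesis by (simp add: in_keys_iff)
  qed
qed

text \<open>Reads off coordinates: the coefficient of \<open>g\<close> in entry \<open>j\<close> is
  the coefficient of the chain at \<open>act g\<close> followed by the image of
  \<open>\<tau> m j\<close>.\<close>

lemma \<Phi>_map_key:
  assumes m: "m \<le> M" and keys: "Poly_Mapping.keys c \<subseteq> simplices X m"
  shows "\<Phi> m (\<lambda>j. Poly_Mapping.map_key (\<lambda>g. act g ` \<tau> m j) c) = c"
  by (rule chain_eqI[OF m keys_\<Phi>[OF m] keys])
     (simp add: lookup_\<Phi>[OF m] map_key.rep_eq inj_orbit \<tau>_simplex(2)[OF m])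

lemma codifferential_entry:
  assumes "\<rho> \<in> X"
  shows "codifferential_entry act ori \<sigma> \<rho> = Poly_Mapping.map_key (\<lambda>g. act g ` \<rho>) (simplicial_boundary ori \<sigma>)"
proof (rule poly_mapping_eqI)
  fix h
  let ?\<epsilon> = "\<lambda>g. Poly_Mapping.lookup (simplicial_boundary ori \<sigma>) (act g ` \<rho>)"
  have "finite ((\<lambda>g. act g ` \<rho>) -` Poly_Mapping.keys (simplicial_boundary ori \<sigma>))"
    by (rule finite_vimageI[OF finite_keys inj_orbit[OF assms]])
  moreover have "{g. ?\<epsilon> g \<noteq> 0} = (\<lambda>g. act g ` \<rho>) -` Poly_Mapping.keys (simplicial_boundary ori \<sigma>)"
    by (auto simp: in_keys_iff)
  ultimately have "finite {g. ?\<epsilon> g \<noteq> 0}" by simp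
  then have "Poly_Mapping.lookup (codifferential_entry act ori \<sigma> \<rho>) h = ?\<epsilon> h"
    by (simp add: codifferential_entry_def Let_def lookup_sum lookup_single when_def)
  then show "Poly_Mapping.lookup (codifferential_entry act ori \<sigma> \<rho>) h
      = Poly_Mapping.lookup (Poly_Mapping.map_key (\<lambda>g. act g ` \<rho>) (simplicial_boundary ori \<sigma>)) h"
    by (simp add: map_key.rep_eq inj_orbit assms)
qed

abbreviation codiff :: "nat \<Rightarrow> 'g group_algebra mat" where "codiff \<equiv> codifferential X act ori \<tau>"

abbreviation nor :: "nat \<Rightarrow> nat" where "nor \<equiv> num_orbits X act"

lemma codiff_carrier [simp]: "codiff m \<in> carrier_mat (nor (Suc m)) (nor m)"
  by (simp add: codifferential_def)

lemma \<Phi>_codifferential_row: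
  assumes m: "Suc m \<le> M" and i: "i < nor (Suc m)"
  shows "\<Phi> m (\<lambda>j. codiff m $$ (i, j)) = simplicial_boundary ori (\<tau> (Suc m) i)"
proof -
  have m': "m \<le> M" using m by simp
  have \<tau>i: "\<tau> (Suc m) i \<in> X" "card (\<tau> (Suc m) i) = Suc (Suc m)"
    using \<tau>_simplex[OF m i] by (auto simp: simplices_def)
  have "Poly_Mapping.keys (simplicial_boundary ori (\<tau> (Suc m) i)) \<subseteq> simplices X m"
    using keys_simplicial_boundary[OF \<tau>i(1)] \<tau>i(2) by (auto simp: simplices_def)
  from \<Phi>_map_key[OF m' this] show ?thesis
    unfolding \<Phi>_def using i
    by (simp add: codifferential_def codifferential_entry \<tau>_simplex(2)[OF m'])
qed

text \<open>The boundary is equivariant, so it is determined by its values on representatives, and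
  these are the rows of \<open>codiff m\<close>. In coordinates it is right multiplication by that
  matrix.\<close>

lemma boundary_\<Phi>:
  assumes m: "Suc m \<le> M"
  shows "boundary (\<Phi> (Suc m) y) = \<Phi> m (\<lambda>j. \<Sum>i<nor (Suc m). y i * codiff m $$ (i, j))"
proof -
  have m': "m \<le> M" using m by simp
  have "boundary (\<Phi> (Suc m) y) = (\<Sum>i<nor (Suc m). boundary (orb (\<tau> (Suc m) i) (y i)))"
    by (simp add: \<Phi>_def boundary_def linear_ext_sum)
  also have "\<dots> = (\<Sum>i<nor (Suc m). linear_ext (\<lambda>g. actC g (\<Phi> m (\<lambda>j. codiff m $$ (i, j)))) (y i))"
    by (intro sum.cong refl) (simp add: boundary_orb \<tau>_simplex(2)[OF m] \<Phi>_codifferential_row[OF m])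
  also have "\<dots> = (\<Sum>i<nor (Suc m). \<Sum>j<nor m. orb (\<tau> m j) (y i * codiff m $$ (i, j)))"
  proof (intro sum.cong refl)
    fix i
    have "linear_ext (\<lambda>g. \<Sum>j<nor m. F j g) a = (\<Sum>j<nor m. linear_ext (F j) a)" for F and a :: "'g group_algebra"
      by (simp add: linear_ext_def smul_sum) (rule sum.swap)
    then show "linear_ext (\<lambda>g. actC g (\<Phi> m (\<lambda>j. codiff m $$ (i, j)))) (y i) = (\<Sum>j<nor m. orb (\<tau> m j) (y i * codiff m $$ (i, j)))"
      by (simp add: \<Phi>_def actC_simps orb_mult \<tau>_simplex(2)[OF m'])
  qed
  also have "\<dots> = \<Phi> m (\<lambda>j. \<Sum>i<nor (Suc m). y i * codiff m $$ (i, j))"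
    unfolding \<Phi>_def orb_simps by (rule sum.swap)
  finally show ?thesis .
qed

text \<open>Works row by row: the chain of a row of \<open>b\<close> is a cycle, hence bounds, and
  the coordinates of a filling form the corresponding row of \<open>c\<close>.\<close>

lemma factor_through_codifferential:
  assumes m: "Suc m \<le> M" and b: "b \<in> carrier_mat l (nor m)"
    and cycle: "\<And>i. i < l \<Longrightarrow> boundary (\<Phi> m (\<lambda>j. b $$ (i, j))) = 0"
  obtains c where "c \<in> carrier_mat l (nor (Suc m))" "b = c * codiff m"
proof -
  have m': "m \<le> M" using m by simp
  have contr: "contractible_space (geometric_realization X)" and lf: "locally_finite_complex X"
    using type_F by (simp_all add: type_F_complex_def)
  have "\<exists>y. \<forall>j<nor m. b $$ (i, j) = (\<Sum>l<nor (Suc m). y l * codiff m $$ (l, j))" if i: "i < l" for i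
  proof -
    have "bounds (Suc m) (\<Phi> m (\<lambda>j. b $$ (i, j)))"
      by (rule cycle_is_boundary[OF contr lf keys_\<Phi>[OF m'] cycle[OF i]])
    then obtain e where e: "Poly_Mapping.keys e \<subseteq> simplices X (Suc m)" "boundary e = \<Phi> m (\<lambda>j. b $$ (i, j))"
      unfolding bounds_def by blast
    define y where "y l = Poly_Mapping.map_key (\<lambda>g. act g ` \<tau> (Suc m) l) e" for l
    have "\<Phi> (Suc m) y = e" using \<Phi>_map_key[OF m e(1)] unfolding y_def .
    then have eq: "\<Phi> m (\<lambda>j. b $$ (i, j)) = \<Phi> m (\<lambda>j. \<Sum>l<nor (Suc m). y l * codiff m $$ (l, j))"
      using boundary_\<Phi>[OF m, of y] e(2) by simp
    have "b $$ (i, j) = (\<Sum>l<nor (Suc m). y l * codiff m $$ (l, j))" if j: "j < nor m" for j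
      by (rule poly_mapping_eqI)
         (use lookup_\<Phi>[OF m' j, of "\<lambda>j. b $$ (i, j)"] lookup_\<Phi>[OF m' j, of "\<lambda>j. \<Sum>l<nor (Suc m). y l * codiff m $$ (l, j)"] eq in simp)
    then show ?thesis by blast
  qed
  then have "\<forall>i. \<exists>y. i < l \<longrightarrow> (\<forall>j<nor m. b $$ (i, j) = (\<Sum>l<nor (Suc m). y l * codiff m $$ (l, j)))"
    by blast
  from choice[OF this] obtain y
    where "\<forall>i. i < l \<longrightarrow> (\<forall>j<nor m. b $$ (i, j) = (\<Sum>l<nor (Suc m). y i l * codiff m $$ (l, j)))" ..
  then have y: "\<And>i j. i < l \<Longrightarrow> j < nor m \<Longrightarrow> b $$ (i, j) = (\<Sum>l<nor (Suc m). y i l * codiff m $$ (l, j))"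
    by blast
  define c where "c = mat l (nor (Suc m)) (\<lambda>(i, l). y i l)"
  have "b = c * codiff m"
  proof (rule eq_matI)
    fix i j assume "i < dim_row (c * codiff m)" "j < dim_col (c * codiff m)"
    then have "i < l" "j < nor m" by (simp_all add: c_def codifferential_def)
    then show "b $$ (i, j) = (c * codiff m) $$ (i, j)"
      using y[of i j] by (simp add: c_def codifferential_def scalar_prod_def atLeast0LessThan)
  qed (use b in \<open>auto simp: c_def codifferential_def\<close>)
  then show ?thesis using that[of c] by (simp add: c_def)
qed

end

section \<open>The regular representation on chains\<close>

lemma (in pd_kernel) finsum_HK:
  assumes "finite A" "\<And>a. a \<in> A \<Longrightarrow> f a \<in> carrier HK"
  shows "finsum HK f A = (\<lambda>t. \<Sum>a\<in>A. f a t)"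
proof -
  interpret G: abelian_group HK by (rule abelian_group_HK)
  show ?thesis using assms
  proof (induction A rule: finite_induct)
    case (insert a A)
    have "finsum HK f (insert a A) = f a \<oplus>\<^bsub>HK\<^esub> finsum HK f A"
      by (rule G.finsum_insert) (use insert in \<open>auto simp del: HK_simps\<close>)
    then show ?case using insert by simp
  qed simp
qed

context finite_type_complex
begin

text \<open>The laws of an action are assumed for \<open>act\<close> only on the vertices of \<open>X\<close>; \<open>act'\<close> satisfies them
  everywhere.\<close>

definition act' :: "'g \<Rightarrow> 'v set \<Rightarrow> 'v set" where
  "act' g \<sigma> = (if \<sigma> \<subseteq> \<Union>X then act g ` \<sigma> else \<sigma>)"

text \<open>With this kernel the construction yields the square-summable functions on sets of
  vertices, permuted by the group.\<close>

definition ident_kernel :: "'v set \<Rightarrow> 'v set \<Rightarrow> real" where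
  "ident_kernel s t = (if s = t then 1 else 0)"

lemma act'_0: "act' 0 s = s"
  using image_act_0[of s] by (simp add: act'_def)

lemma act'_plus: "act' (g + h) s = act' g (act' h s)"
proof (cases "s \<subseteq> \<Union>X")
  case True
  then have "act h ` s \<subseteq> \<Union>X" using act_vertex by blast
  then show ?thesis using True image_act_plus[OF True] by (simp add: act'_def)
qed (simp add: act'_def)

lemma act'_eq_iff: "act' g s = t \<longleftrightarrow> s = act' (- g) t"
proof -
  have "act' (- g) (act' g s) = s" "act' g (act' (- g) t) = t"
    by (simp_all add: act'_0 flip: act'_plus)
  then show ?thesis by metis
qed

sublocale ch: pd_kernel_action ident_kernel act'
proof
  show "ident_kernel s t = ident_kernel t s" for s t by (simp add: ident_kernel_def)
  show "0 \<le> (\<Sum>s\<in>F. \<Sum>t\<in>F. c s * c t * ident_kernel s t)" if "finite F" for c :: "'v set \<Rightarrow> real" and F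
  proof -
    have "(\<Sum>s\<in>F. \<Sum>t\<in>F. c s * c t * ident_kernel s t) = (\<Sum>s\<in>F. c s * c s)"
      using that by (intro sum.cong refl) (simp add: ident_kernel_def if_distrib cong: if_cong)
    then show ?thesis by (simp add: sum_nonneg)
  qed
  show "act' 0 s = s" for s by (rule act'_0)
  show "act' (g + h) s = act' g (act' h s)" for g h s by (rule act'_plus)
  show "ident_kernel (act' g s) (act' g t) = ident_kernel s t" for g s t
    using act'_eq_iff[of g s "act' g t"] act'_eq_iff[of g t "act' g t"] by (auto simp: ident_kernel_def)
qed

sublocale U: unitary_rep ch.HK ch.shift
  by unfold_locales (rule ch.unitary_representation_HK)

definition embed :: "('v set \<Rightarrow>\<^sub>0 real) \<Rightarrow> 'v set \<Rightarrow> complex" where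
  "embed c = (\<lambda>t. complex_of_real (Poly_Mapping.lookup c t))"

lemma embed_closed: "embed c \<in> carrier ch.HK"
proof (induction c rule: poly_mapping_additive_induct)
  case (single s r)
  have "embed (Poly_Mapping.single s r) = complex_of_real r \<odot>\<^bsub>ch.HK\<^esub> ch.ket s"
    by (auto simp: embed_def ch.ket_def ch.B_single ident_kernel_def lookup_single when_def)
  then show ?case using U.smult_closed'[OF ch.ket_closed] by metis
next
  case (add a b)
  have "embed (a + b) = embed a \<oplus>\<^bsub>ch.HK\<^esub> embed b" by (simp add: embed_def lookup_add)
  then show ?case using U.M.a_closed[OF add] by metis
qed

lemma lookup_actC:
  assumes "Poly_Mapping.keys c \<subseteq> {\<rho>. \<rho> \<subseteq> \<Union>X}"
  shows "Poly_Mapping.lookup (actC g c) t = Poly_Mapping.lookup c (act' (- g) t)"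
proof -
  have "Poly_Mapping.lookup (linear_ext (\<lambda>\<rho>. Poly_Mapping.single (act' g \<rho>) 1) c) t = Poly_Mapping.lookup c (act' (- g) t)"
    by (induction c rule: poly_mapping_additive_induct)
       (simp_all add: linear_ext_add lookup_add lookup_single act'_eq_iff)
  moreover have "actC g c = linear_ext (\<lambda>\<rho>. Poly_Mapping.single (act' g \<rho>) 1) c"
    unfolding actC_def by (rule linear_ext_cong) (use assms in \<open>auto simp: act'_def\<close>)
  ultimately show ?thesis by simp
qed

lemma ra_embed:
  assumes "Poly_Mapping.keys c \<subseteq> {\<rho>. \<rho> \<subseteq> \<Union>X}"
  shows "rep_algebra ch.HK ch.shift a (embed c) = embed (linear_ext (\<lambda>g. actC g c) a)"
proof -
  have "complex_of_real (Poly_Mapping.lookup a g) \<odot>\<^bsub>ch.HK\<^esub> ch.shift g (embed c) \<in> carrier ch.HK" for g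
    by (intro U.smult_closed' U.pi_closed embed_closed)
  then have "rep_algebra ch.HK ch.shift a (embed c)
      = (\<lambda>t. \<Sum>g\<in>Poly_Mapping.keys a. (complex_of_real (Poly_Mapping.lookup a g) \<odot>\<^bsub>ch.HK\<^esub> ch.shift g (embed c)) t)"
    unfolding rep_algebra_def by (intro ch.finsum_HK) simp_all
  also have "\<dots> = embed (linear_ext (\<lambda>g. actC g c) a)"
    by (rule ext) (simp add: embed_def lookup_linear_ext lookup_actC[OF assms] ch.shift_def)
  finally show ?thesis .
qed

text \<open>By equivariance, applying a row to the boundaries of the representatives gives the
  boundary of the chain of that row. Annihilating this vector thus means being a cycle.\<close>

lemma rm_boundary_vector:
  assumes m: "m \<le> M" and b: "b \<in> carrier_mat l (nor m)" and i: "i < l"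
  shows "rep_mat ch.HK ch.shift b (\<lambda>j\<in>{..<nor m}. embed (simplicial_boundary ori (\<tau> m j))) i
    = embed (boundary (\<Phi> m (\<lambda>j. b $$ (i, j))))"
proof -
  let ?\<xi> = "\<lambda>j\<in>{..<nor m}. embed (simplicial_boundary ori (\<tau> m j))"
  have ra: "rep_algebra ch.HK ch.shift a (?\<xi> j) = embed (boundary (orb (\<tau> m j) a))" if "j < nor m" for a j
  proof -
    have \<tau>X: "\<tau> m j \<in> X" by (rule \<tau>_simplex(2)[OF m that])
    have "Poly_Mapping.keys (simplicial_boundary ori (\<tau> m j)) \<subseteq> {\<rho>. \<rho> \<subseteq> \<Union>X}"
      using keys_simplicial_boundary[OF \<tau>X] \<tau>X by blast
    then show ?thesis using that by (simp add: ra_embed boundary_orb[OF \<tau>X])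
  qed
  have "rep_mat ch.HK ch.shift b ?\<xi> i = finsum ch.HK (\<lambda>j. rep_algebra ch.HK ch.shift (b $$ (i, j)) (?\<xi> j)) {..<nor m}"
    using U.rm_index[of i b ?\<xi>] b i by auto
  also have "\<dots> = (\<lambda>t. \<Sum>j<nor m. rep_algebra ch.HK ch.shift (b $$ (i, j)) (?\<xi> j) t)"
  proof (rule ch.finsum_HK)
    fix j assume "j \<in> {..<nor m}"
    then show "rep_algebra ch.HK ch.shift (b $$ (i, j)) (?\<xi> j) \<in> carrier ch.HK"
      using ra[of j] embed_closed by (metis lessThan_iff)
  qed simp
  also have "\<dots> = (\<lambda>t. \<Sum>j<nor m. embed (boundary (orb (\<tau> m j) (b $$ (i, j)))) t)"
    by (intro ext sum.cong refl) (metis ra lessThan_iff)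
  also have "\<dots> = embed (boundary (\<Phi> m (\<lambda>j. b $$ (i, j))))"
    by (simp add: embed_def \<Phi>_def boundary_def linear_ext_sum lookup_sum)
  finally show ?thesis .
qed

text \<open>Apply both sides of \<open>d\<^sup>* a d = \<Sum> b\<^sup>* b\<close> to the vector of the boundaries \<open>\<partial>\<tau>\<^sub>j\<close>, on which \<open>d\<close>
  vanishes because \<open>\<partial>\<partial> = 0\<close>.\<close>

lemma square_rows_are_cycles:
  assumes m: "Suc m \<le> M" and a: "a \<in> carrier_mat (nor (Suc m)) (nor (Suc m))"
    and as: "set as \<subseteq> carrier_mat (nor m) (nor m)"
    and eq: "conj_map (codiff m) a = foldr (+) (map (\<lambda>a. star_mat a * a) as) (0\<^sub>m (nor m) (nor m))"
    and b: "b \<in> set as" and i: "i < nor m"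
  shows "boundary (\<Phi> m (\<lambda>j. b $$ (i, j))) = 0"
proof -
  have m': "m \<le> M" using m by simp
  \<comment> \<open>For \<open>m = 0\<close> the entries are multiples of the empty simplex, a fixed
    vector, and the conclusion says that the augmentation of each row is 0.\<close>
  let ?\<xi> = "\<lambda>j\<in>{..<nor m}. embed (simplicial_boundary ori (\<tau> m j))"
  have \<xi>: "?\<xi> \<in> U.hpow (nor m)" by (auto simp: U.hpow_def simp del: ch.HK_simps intro: embed_closed)
  have emb0: "embed 0 = \<zero>\<^bsub>ch.HK\<^esub>" by (simp add: embed_def)
  have d0: "U.rm (codiff m) ?\<xi> p = \<zero>\<^bsub>ch.HK\<^esub>" if p: "p < nor (Suc m)" for p
  proof -
    have "\<tau> (Suc m) p \<in> X" "card (\<tau> (Suc m) p) = Suc (Suc m)"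
      using \<tau>_simplex[OF m p] by (auto simp: simplices_def)
    then have "boundary (\<Phi> m (\<lambda>j. codiff m $$ (p, j))) = 0"
      unfolding \<Phi>_codifferential_row[OF m p] by (intro boundary_boundary_simplex) simp_all
    then show ?thesis using rm_boundary_vector[OF m' codiff_carrier p] emb0 by metis
  qed
  have ad: "a * codiff m \<in> carrier_mat (nor (Suc m)) (nor m)" using a by (rule mult_carrier_mat) simp
  have "conj_map (codiff m) a = star_mat (codiff m) * (a * codiff m)"
    unfolding conj_map_def by (rule assoc_mult_mat[OF star_mat_carrier[OF codiff_carrier] a codiff_carrier])
  then have "U.quad (nor m) ?\<xi> (conj_map (codiff m) a)
      = Re (U.dot (nor (Suc m)) (U.rm (a * codiff m) ?\<xi>) (U.rm (codiff m) ?\<xi>))"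
    using U.quad_star_mult[OF codiff_carrier ad \<xi>] by metis
  also have "\<dots> = 0"
    using d0 U.hpowD[OF U.rm_closed[OF ad \<xi>]] by (simp add: U.dot_def del: ch.HK_simps)
  finally have "U.quad (nor m) ?\<xi> (foldr (+) (map (\<lambda>a. star_mat a * a) as) (0\<^sub>m (nor m) (nor m))) = 0"
    unfolding eq .
  from U.quad_sum_squares_eq_0[OF as \<xi> this b i]
  have "embed (boundary (\<Phi> m (\<lambda>j. b $$ (i, j)))) = \<zero>\<^bsub>ch.HK\<^esub>"
    using rm_boundary_vector[OF m' _ i, of b] as b by (metis subsetD)
  then show ?thesis
    by (intro poly_mapping_eqI) (simp add: embed_def fun_eq_iff)
qed

lemma squares_factor:
  assumes m: "Suc m \<le> M" and a: "a \<in> carrier_mat (nor (Suc m)) (nor (Suc m))"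
    and as: "set as \<subseteq> carrier_mat (nor m) (nor m)"
    and eq: "conj_map (codiff m) a = foldr (+) (map (\<lambda>a. star_mat a * a) as) (0\<^sub>m (nor m) (nor m))"
    and b: "b \<in> set as"
  shows "\<exists>c\<in>carrier_mat (nor m) (nor (Suc m)). b = c * codiff m"
proof -
  have "b \<in> carrier_mat (nor m) (nor m)" using as b by blast
  then show ?thesis
    using factor_through_codifferential[OF m _ square_rows_are_cycles[OF m a as eq b]] by blast
qed

end

section \<open>Extending functionals and solving for cochains\<close>

definition unit_row :: "nat \<Rightarrow> nat \<Rightarrow> 'g::group_add group_algebra \<Rightarrow> 'g group_algebra mat" where
  "unit_row k j x = mat 1 k (\<lambda>(p, q). if q = j then x else 0)"

lemma unit_row_carrier [simp]: "unit_row k j x \<in> carrier_mat 1 k"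
  by (simp add: unit_row_def)

lemma unit_row_simps [simp]: "dim_row (unit_row k j x) = 1" "dim_col (unit_row k j x) = k"
  "q < k \<Longrightarrow> unit_row k j x $$ (0, q) = (if q = j then x else 0)"
  by (simp_all add: unit_row_def)

lemma row_product_carrier [simp]:
  "r \<in> carrier_mat 1 k \<Longrightarrow> s \<in> carrier_mat 1 l \<Longrightarrow> star_mat r * s \<in> carrier_mat k l"
  by (intro mult_carrier_mat[of _ _ 1] star_mat_carrier)

lemmas row_carrier_Suc [simp] = unit_row_carrier[unfolded One_nat_def] row_product_carrier[unfolded One_nat_def]

lemma row_product_index:
  "r \<in> carrier_mat 1 k \<Longrightarrow> s \<in> carrier_mat 1 l \<Longrightarrow> p < k \<Longrightarrow> q < l \<Longrightarrow>
    (star_mat r * s) $$ (p, q) = star (r $$ (0, p)) * s $$ (0, q)"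
  by (auto simp: scalar_prod_def)

text \<open>Sums of squares are built from square matrices, so the row is padded by zero rows. For
  \<open>k = 0\<close> there is no room for a row, and the product is the empty sum.\<close>

lemma row_product_sum_squares:
  assumes r: "r \<in> carrier_mat 1 k"
  shows "star_mat r * r \<in> sum_squares k"
proof (cases "k = 0")
  case True
  then have "star_mat r * r = 0\<^sub>m k k" using r by (intro eq_matI) auto
  then show ?thesis unfolding sum_squares_def by (intro CollectI exI[of _ "[]"]) simp
next
  case False
  define A where "A = mat k k (\<lambda>(p, q). if p = 0 then r $$ (0, q) else 0)"
  have "star_mat A * A = star_mat r * r"
  proof (rule eq_matI)
    fix p q assume "p < dim_row (star_mat r * r)" "q < dim_col (star_mat r * r)"
    then have pq: "p < k" "q < k" using r by auto
    have "(star_mat A * A) $$ (p, q) = (\<Sum>i = 0..<k. star (A $$ (i, p)) * A $$ (i, q))"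
      using pq by (simp add: A_def scalar_prod_def)
    also have "\<dots> = (\<Sum>i = 0..<k. if i = 0 then star (r $$ (0, p)) * r $$ (0, q) else 0)"
      using pq by (intro sum.cong) (auto simp: A_def)
    also have "\<dots> = (star_mat r * r) $$ (p, q)"
      using False row_product_index[OF r r pq] by simp
    finally show "(star_mat A * A) $$ (p, q) = (star_mat r * r) $$ (p, q)" .
  qed (use r in \<open>auto simp: A_def\<close>)
  moreover have "star_mat r * r + 0\<^sub>m k k = star_mat r * r" using r by (intro right_add_zero_mat) simp
  ultimately show ?thesis unfolding sum_squares_def
    by (intro CollectI exI[of _ "[A]"]) (simp add: A_def)
qed

lemma conj_map_simps:
  assumes d: "d \<in> carrier_mat k l"
  shows "a \<in> carrier_mat k k \<Longrightarrow> conj_map d a \<in> carrier_mat l l"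
    and "a \<in> carrier_mat k k \<Longrightarrow> b \<in> carrier_mat k k \<Longrightarrow> conj_map d (a + b) = conj_map d a + conj_map d b"
    and "a \<in> carrier_mat k k \<Longrightarrow> conj_map d (scaleR_mat r a) = scaleR_mat r (conj_map d a)"
    and "a \<in> carrier_mat k k \<Longrightarrow> conj_map d (star_mat a) = star_mat (conj_map d a)"
    and "r1 \<in> carrier_mat m k \<Longrightarrow> r2 \<in> carrier_mat m k \<Longrightarrow> conj_map d (star_mat r1 * r2) = star_mat (r1 * d) * (r2 * d)"
proof -
  note d' = star_mat_carrier[OF d]
  show "conj_map d a \<in> carrier_mat l l" if "a \<in> carrier_mat k k"
    unfolding conj_map_def by (rule mult_carrier_mat[OF mult_carrier_mat[OF d' that] d])
  show "conj_map d (a + b) = conj_map d a + conj_map d b" if a: "a \<in> carrier_mat k k" and b: "b \<in> carrier_mat k k"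
    unfolding conj_map_def mult_add_distrib_mat[OF d' a b]
    by (rule add_mult_distrib_mat[OF mult_carrier_mat[OF d' a] mult_carrier_mat[OF d' b] d])
  show "conj_map d (scaleR_mat r a) = scaleR_mat r (conj_map d a)" if a: "a \<in> carrier_mat k k"
    unfolding conj_map_def scaleR_mat_mult_left[OF mult_carrier_mat[OF d' a] d] scaleR_mat_mult_right[OF d' a] ..
  show "conj_map d (star_mat a) = star_mat (conj_map d a)" if a: "a \<in> carrier_mat k k"
    unfolding conj_map_def star_mat_mult[OF mult_carrier_mat[OF d' a] d] star_mat_mult[OF d' a] star_mat_star_mat
    by (rule assoc_mult_mat[OF d' star_mat_carrier[OF a] d])
  show "conj_map d (star_mat r1 * r2) = star_mat (r1 * d) * (r2 * d)"
    if r1: "r1 \<in> carrier_mat m k" and r2: "r2 \<in> carrier_mat m k"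
    unfolding conj_map_def star_mat_mult[OF r1 d]
    using assoc_mult_mat[OF d' star_mat_carrier[OF r1] r2]
      assoc_mult_mat[OF mult_carrier_mat[OF d' star_mat_carrier[OF r1]] r2 d] by simp
qed

lemma linear_functionalD:
  assumes "linear_functional V \<phi>"
  shows "a \<in> V \<Longrightarrow> b \<in> V \<Longrightarrow> \<phi> (a + b) = \<phi> a + \<phi> b" "a \<in> V \<Longrightarrow> \<phi> (scaleR_mat r a) = r * \<phi> a"
  using assms by (simp_all add: linear_functional_def)

lemma linear_functional_zero:
  assumes "linear_functional (carrier_mat k k) \<phi>"
  shows "\<phi> (0\<^sub>m k k) = 0"
proof -
  have "\<phi> (0\<^sub>m k k + 0\<^sub>m k k) = \<phi> (0\<^sub>m k k) + \<phi> (0\<^sub>m k k)"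
    by (rule linear_functionalD[OF assms]) simp_all
  then show ?thesis by simp
qed

definition entries :: "nat \<Rightarrow> (nat \<times> nat) set \<Rightarrow> (nat \<times> nat \<Rightarrow> 'g::group_add group_algebra) \<Rightarrow> 'g group_algebra mat" where
  "entries k S F = mat k k (\<lambda>p. if p \<in> S then F p else 0)"

lemma entries_carrier [simp]: "entries k S F \<in> carrier_mat k k"
  by (simp add: entries_def)

lemma linear_functional_entries:
  assumes \<phi>: "linear_functional (carrier_mat k k) \<phi>" and S: "finite S"
  shows "\<phi> (entries k S F) = (\<Sum>p\<in>S. \<phi> (entries k {p} F))"
  using S
proof (induction S rule: finite_induct)
  case empty
  have "entries k {} F = 0\<^sub>m k k" by (rule eq_matI) (simp_all add: entries_def)
  then show ?case using linear_functional_zero[OF \<phi>] by simp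
next
  case (insert p S)
  have "entries k (insert p S) F = entries k {p} F + entries k S F"
    by (rule eq_matI) (use insert.hyps in \<open>auto simp: entries_def\<close>)
  then show ?case using insert linear_functionalD(1)[OF \<phi>, of "entries k {p} F" "entries k S F"] by simp
qed

text \<open>The products of rows in \<open>eq\<close> are the matrix units multiplied by group
  elements; over the reals these span all matrices.\<close>

lemma linear_functional_ext:
  fixes \<phi> \<psi> :: "'g::group_add group_algebra mat \<Rightarrow> real"
  assumes \<phi>: "linear_functional (carrier_mat k k) \<phi>" and \<psi>: "linear_functional (carrier_mat k k) \<psi>"
    and eq: "\<And>i j g. i < k \<Longrightarrow> j < k \<Longrightarrow>
      \<phi> (star_mat (unit_row k i (Poly_Mapping.single 0 1)) * unit_row k j (Poly_Mapping.single g 1))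
        = \<psi> (star_mat (unit_row k i (Poly_Mapping.single 0 1)) * unit_row k j (Poly_Mapping.single g 1))"
    and a: "a \<in> carrier_mat k k"
  shows "\<phi> a = \<psi> a"
proof -
  have *: "\<phi> (entries k {(i, j)} (\<lambda>_. x)) = \<psi> (entries k {(i, j)} (\<lambda>_. x))" if ij: "i < k" "j < k" for i j x
  proof (induction x rule: poly_mapping_additive_induct)
    case (single g r)
    let ?u = "star_mat (unit_row k i (Poly_Mapping.single 0 1)) * unit_row k j (Poly_Mapping.single g 1)"
    have "entries k {(i, j)} (\<lambda>_. Poly_Mapping.single g r) = scaleR_mat r ?u"
    proof (rule eq_matI)
      fix p q assume "p < dim_row (scaleR_mat r ?u)" "q < dim_col (scaleR_mat r ?u)"
      then have pq: "p < k" "q < k" by (simp_all add: scaleR_mat_def)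
      then show "entries k {(i, j)} (\<lambda>_. Poly_Mapping.single g r) $$ (p, q) = scaleR_mat r ?u $$ (p, q)"
        using row_product_index[OF unit_row_carrier unit_row_carrier pq, of i "Poly_Mapping.single 0 1" j "Poly_Mapping.single g 1"]
        by (auto simp: entries_def scaleR_mat_def star_single mult_single)
    qed (simp_all add: entries_def scaleR_mat_def)
    moreover have "?u \<in> carrier_mat k k" by simp
    ultimately show ?case using eq[OF ij] linear_functionalD(2)[OF \<phi>] linear_functionalD(2)[OF \<psi>] by simp
  next
    case (add x y)
    have "entries k {(i, j)} (\<lambda>_. x + y) = entries k {(i, j)} (\<lambda>_. x) + entries k {(i, j)} (\<lambda>_. y)"
      by (rule eq_matI) (auto simp: entries_def)
    then show ?case using add linear_functionalD(1)[OF \<phi>] linear_functionalD(1)[OF \<psi>] by simp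
  qed
  let ?S = "{..<k} \<times> {..<k}"
  have a': "a = entries k ?S (\<lambda>p. a $$ p)" by (rule eq_matI) (use a in \<open>auto simp: entries_def\<close>)
  have "\<phi> (entries k {p} (\<lambda>p. a $$ p)) = \<psi> (entries k {p} (\<lambda>p. a $$ p))" if "p \<in> ?S" for p
  proof -
    have "entries k {p} (\<lambda>p. a $$ p) = entries k {(fst p, snd p)} (\<lambda>_. a $$ p)"
      by (rule eq_matI) (auto simp: entries_def)
    then show ?thesis using *[of "fst p" "snd p" "a $$ p"] that by auto
  qed
  then have "(\<Sum>p\<in>?S. \<phi> (entries k {p} (\<lambda>p. a $$ p))) = (\<Sum>p\<in>?S. \<psi> (entries k {p} (\<lambda>p. a $$ p)))"
    by (rule sum.cong[OF refl])
  then have "\<phi> (entries k ?S (\<lambda>p. a $$ p)) = \<psi> (entries k ?S (\<lambda>p. a $$ p))"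
    using linear_functional_entries[OF \<phi>, of ?S] linear_functional_entries[OF \<psi>, of ?S] by simp
  then show ?thesis using a' by metis
qed

lemma (in unitary_rep) rm_unit_row:
  assumes \<xi>: "\<xi> \<in> hpow k" and j: "j < k"
  shows "rm (unit_row k j x) \<xi> 0 = ra x (\<xi> j)"
proof (rule vec_eqI)
  have "rm (unit_row k j x) \<xi> \<in> hpow 1" by (rule rm_closed[OF unit_row_carrier \<xi>])
  then show "rm (unit_row k j x) \<xi> 0 \<in> carrier H" by simp
  show "ra x (\<xi> j) \<in> carrier H" using \<xi> j by simp
  fix z assume z: "z \<in> carrier H"
  have "hinner H (rm (unit_row k j x) \<xi> 0) z = (\<Sum>q<k. hinner H (ra (unit_row k j x $$ (0, q)) (\<xi> q)) z)"
    by (rule hinner_rm[OF unit_row_carrier \<xi> _ z]) simp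
  also have "\<dots> = (\<Sum>q<k. if q = j then hinner H (ra x (\<xi> j)) z else 0)"
    using \<xi> z by (intro sum.cong refl) (simp add: hinner_ra_0)
  finally show "hinner H (rm (unit_row k j x) \<xi> 0) z = hinner H (ra x (\<xi> j)) z" using j by simp
qed

text \<open>GNS construction: the vectors \<open>\<xi>\<^sub>i\<close> are the classes of the standard basis rows, with inner products
  given by \<open>\<psi>(s\<^sup>* r)\<close> on rows \<open>r\<close>, \<open>s\<close>.\<close>

lemma gns:
  fixes \<psi> :: "'g::group_add group_algebra mat \<Rightarrow> real"
  assumes ctb: "countable (UNIV :: 'g set)" and cont: "(UNIV :: real set) \<lesssim> (UNIV :: 'h set)"
    and lin: "linear_functional (carrier_mat k k) \<psi>"
    and herm: "\<And>a. a \<in> carrier_mat k k \<Longrightarrow> \<psi> (star_mat a) = \<psi> a"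
    and pos: "\<And>r. r \<in> carrier_mat 1 k \<Longrightarrow> 0 \<le> \<psi> (star_mat r * r)"
  obtains H :: "'h hilbert" and \<pi> :: "'g \<Rightarrow> 'h \<Rightarrow> 'h" and \<xi> where "unitary_representation H \<pi>"
    "\<xi> \<in> unitary_rep.hpow H k" "\<And>a. a \<in> carrier_mat k k \<Longrightarrow> unitary_rep.quad H \<pi> k \<xi> a = \<psi> a"
proof -
  define e :: "'g \<times> nat \<Rightarrow> 'g group_algebra mat" where "e s = unit_row k (snd s) (Poly_Mapping.single (fst s) 1)" for s
  have e: "e s \<in> carrier_mat 1 k" for s by (simp add: e_def)
  note [simp] = e e[unfolded One_nat_def]
  define \<beta> where "\<beta> r s = \<psi> (star_mat s * r)" for r s
  have \<beta>_sym: "\<beta> r s = \<beta> s r" if "r \<in> carrier_mat 1 k" "s \<in> carrier_mat 1 k" for r s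
    using herm[of "star_mat s * r"] that star_mat_mult[OF star_mat_carrier[OF that(2)] that(1)] by (simp add: \<beta>_def)
  have \<beta>_add: "\<beta> (r + r') s = \<beta> r s + \<beta> r' s"
    if "r \<in> carrier_mat 1 k" "r' \<in> carrier_mat 1 k" "s \<in> carrier_mat 1 k" for r r' s
    using that linear_functionalD(1)[OF lin] mult_add_distrib_mat[OF star_mat_carrier[OF that(3)] that(1,2)]
    by (simp add: \<beta>_def)
  have \<beta>_scale: "\<beta> (scaleR_mat t r) s = t * \<beta> r s" if "r \<in> carrier_mat 1 k" "s \<in> carrier_mat 1 k" for t r s
    using that linear_functionalD(2)[OF lin] scaleR_mat_mult_right[OF star_mat_carrier[OF that(2)] that(1), symmetric]
    by (simp add: \<beta>_def)
  define K where "K s t = \<beta> (e s) (e t)" for s t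
  \<comment> \<open>The index \<open>(g, j)\<close> stands for the row with entry \<open>g\<close>
    at place \<open>j\<close>. Left translation preserves \<open>K\<close> because a group element
    cancels against its inverse in \<open>star_mat s * r\<close>.\<close>
  define act where "act g s = (g + fst s, snd s)" for g :: 'g and s :: "'g \<times> nat"
  \<comment> \<open>A finite combination of the rows \<open>e t\<close> is again a single row
    \<open>r\<close>, so positive definiteness of \<open>K\<close> becomes
    \<open>0 \<le> \<beta> r r\<close>.\<close>
  have comb: "\<exists>r\<in>carrier_mat 1 k. \<forall>s\<in>carrier_mat 1 k. \<beta> r s = (\<Sum>t\<in>F. c t * \<beta> (e t) s)"
    if "finite F" for F and c :: "'g \<times> nat \<Rightarrow> real"
    using that
  proof (induction F rule: finite_induct)
    case empty
    have "\<beta> (0\<^sub>m 1 k) s = 0" if "s \<in> carrier_mat 1 k" for s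
      using that linear_functional_zero[OF lin] right_mult_zero_mat[OF star_mat_carrier[OF that]] by (simp add: \<beta>_def)
    then show ?case by (intro bexI[of _ "0\<^sub>m 1 k"]) simp_all
  next
    case (insert t F)
    then obtain r where r: "r \<in> carrier_mat 1 k" "\<forall>s\<in>carrier_mat 1 k. \<beta> r s = (\<Sum>t\<in>F. c t * \<beta> (e t) s)" by blast
    show ?case
      using insert r by (intro bexI[of _ "scaleR_mat (c t) (e t) + r"]) (simp_all add: \<beta>_add \<beta>_scale)
  qed
  interpret pk: pd_kernel_action K act
  proof
    show "K s t = K t s" for s t by (simp add: K_def \<beta>_sym)
    show "0 \<le> (\<Sum>s\<in>F. \<Sum>t\<in>F. c s * c t * K s t)" if F: "finite F" for c F
    proof -
      obtain r where r: "r \<in> carrier_mat 1 k" "\<And>s. s \<in> carrier_mat 1 k \<Longrightarrow> \<beta> r s = (\<Sum>t\<in>F. c t * \<beta> (e t) s)"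
        using comb[OF F, of c] by blast
      have "(\<Sum>s\<in>F. \<Sum>t\<in>F. c s * c t * K s t) = (\<Sum>s\<in>F. c s * (\<Sum>t\<in>F. c t * \<beta> (e t) (e s)))"
        by (simp add: K_def sum_distrib_left mult_ac \<beta>_sym[OF e e])
      also have "\<dots> = (\<Sum>s\<in>F. c s * \<beta> (e s) r)" using r by (simp add: \<beta>_sym[OF e r(1)])
      also have "\<dots> = \<beta> r r" using r by simp
      finally show ?thesis using pos[OF r(1)] by (simp add: \<beta>_def)
    qed
    show "act 0 s = s" "act (g + h) s = act g (act h s)" for g h s
      by (simp_all add: act_def add.assoc)
    show "K (act g s) (act g t) = K s t" for g s t
    proof -
      have "star_mat (e (act g t)) * e (act g s) = star_mat (e t) * e s"
      proof (rule eq_matI)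
        fix p q assume "p < dim_row (star_mat (e t) * e s)" "q < dim_col (star_mat (e t) * e s)"
        then have pq: "p < k" "q < k" by (simp_all add: e_def)
        have "- fst t + - g + (g + fst s) = - fst t + fst s" by (simp only: add.assoc minus_add_cancel)
        then show "(star_mat (e (act g t)) * e (act g s)) $$ (p, q) = (star_mat (e t) * e s) $$ (p, q)"
          unfolding row_product_index[OF e e pq]
          using pq by (simp add: e_def act_def star_single mult_single minus_add del: add_uminus_conv_diff)
      qed (simp_all add: e_def)
      then show ?thesis by (simp add: K_def \<beta>_def)
    qed
  qed
  have "countable (UNIV :: ('g \<times> nat) set)"
    using countable_SIGMA[OF ctb, of "\<lambda>_. UNIV :: nat set"] by simp
  then obtain f :: "('g \<times> nat \<Rightarrow> complex) \<Rightarrow> 'h" where f: "inj f"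
    using inj_functions_into_continuum[OF _ cont] by blast
  obtain H :: "'h hilbert" and \<pi> where H: "unitary_representation H \<pi>"
    "\<And>x. x \<in> carrier pk.HK \<Longrightarrow> f x \<in> carrier H"
    "\<And>x y. x \<in> carrier pk.HK \<Longrightarrow> y \<in> carrier pk.HK \<Longrightarrow> hinner H (f x) (f y) = hinner pk.HK x y"
    "\<And>g x. x \<in> carrier pk.HK \<Longrightarrow> \<pi> g (f x) = f (pk.shift g x)"
    using transport_unitary_representation[OF pk.unitary_representation_HK inj_on_subset[OF f subset_UNIV]] by blast
  interpret V: unitary_rep H \<pi> using H(1) by unfold_locales
  define \<xi> where "\<xi> = (\<lambda>i\<in>{..<k}. f (pk.ket (0, i)))"
  have \<xi>: "\<xi> \<in> V.hpow k" using H(2)[OF pk.ket_closed] by (auto simp: V.hpow_def \<xi>_def)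
  have shift: "\<pi> g (\<xi> j) = f (pk.ket (g, j))" if "j < k" for g j
    using that H(4)[OF pk.ket_closed] by (simp add: \<xi>_def pk.shift_ket act_def)
  have "V.quad k \<xi> a = \<psi> a" if a: "a \<in> carrier_mat k k" for a
  proof (rule linear_functional_ext[OF _ lin _ a])
    show "linear_functional (carrier_mat k k) (V.quad k \<xi>)"
      using V.quad_positive_hermitian[OF \<xi>] by (simp add: positive_hermitian_functional_def)
    fix i j g assume ij: "i < k" "j < k"
    have ra: "V.ra (Poly_Mapping.single h 1) (\<xi> q) = \<pi> h (\<xi> q)" if "q < k" for h q
      using that \<xi> by (intro V.vec_eqI) (simp_all add: V.hinner_ra_single)
    have ra_one: "V.ra 1 (\<xi> q) = \<pi> 0 (\<xi> q)" if "q < k" for q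
      using ra[OF that, of 0] by simp
    have "V.quad k \<xi> (star_mat (unit_row k i (Poly_Mapping.single 0 1)) * unit_row k j (Poly_Mapping.single g 1))
        = V.ip (\<pi> g (\<xi> j)) (\<pi> 0 (\<xi> i))"
      by (subst V.quad_star_mult[OF unit_row_carrier unit_row_carrier \<xi>])
         (simp add: V.dot_def V.rm_unit_row[OF \<xi>] ij ra ra_one)
    also have "\<dots> = K (g, j) (0, i)"
      by (simp add: shift ij H(3) pk.ket_closed pk.hinner_ket del: pk.HK_simps)
    also have "\<dots> = \<psi> (star_mat (unit_row k i (Poly_Mapping.single 0 1)) * unit_row k j (Poly_Mapping.single g 1))"
      by (simp add: K_def \<beta>_def e_def)
    finally show "V.quad k \<xi> (star_mat (unit_row k i (Poly_Mapping.single 0 1)) * unit_row k j (Poly_Mapping.single g 1))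
      = \<psi> (star_mat (unit_row k i (Poly_Mapping.single 0 1)) * unit_row k j (Poly_Mapping.single g 1))" .
  qed
  then show ?thesis using that[OF H(1) \<xi>] by blast
qed

text \<open>The relation to the split conjugation space enters through \<open>zero\<close>: it makes
  the squared norm of \<open>rep_mat H \<pi> dn \<xi>\<close>, a value of the given functional,
  equal to 0.\<close>

theorem extension_of_vanishing:
  fixes \<phi> :: "'g::group_add group_algebra mat \<Rightarrow> real"
  assumes ctb: "countable (UNIV :: 'g set)" and cont: "(UNIV :: real set) \<lesssim> (UNIV :: 'h set)"
    and dn: "dn \<in> carrier_mat m k" and d: "d \<in> carrier_mat k l"
    and zero: "conj_map d (star_mat dn * dn) = 0\<^sub>m l l"
    and vanish: "\<And>(H :: 'h hilbert) \<pi> \<xi>. unitary_representation H \<pi> \<Longrightarrow> \<xi> \<in> unitary_rep.hpow H k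
      \<Longrightarrow> (\<And>i. i < m \<Longrightarrow> rep_mat H \<pi> dn \<xi> i = \<zero>\<^bsub>H\<^esub>) \<Longrightarrow> \<exists>\<eta>\<in>unitary_rep.hpow H l. rep_mat H \<pi> d \<eta> = \<xi>"
    and \<phi>: "positive_hermitian_functional l (conj_map d ` carrier_mat k k) \<phi>"
  shows "\<exists>\<psi>. positive_hermitian_functional l (carrier_mat l l) \<psi> \<and> (\<forall>a\<in>conj_map d ` carrier_mat k k. \<psi> a = \<phi> a)"
proof -
  let ?V = "conj_map d ` carrier_mat k k"
  define \<psi> where "\<psi> a = \<phi> (conj_map d a)" for a
  note D = conj_map_simps[OF d]
  have \<phi>': "linear_functional ?V \<phi>" "\<And>a. a \<in> ?V \<Longrightarrow> \<phi> (star_mat a) = \<phi> a" "\<And>a. a \<in> ?V \<Longrightarrow> a \<in> sum_squares l \<Longrightarrow> 0 \<le> \<phi> a"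
    using \<phi> by (auto simp: positive_hermitian_functional_def hermitian_functional_def positive_functional_def)
  have lin: "linear_functional (carrier_mat k k) \<psi>"
    using linear_functionalD[OF \<phi>'(1)] by (simp add: linear_functional_def \<psi>_def D)
  have herm: "\<psi> (star_mat a) = \<psi> a" if "a \<in> carrier_mat k k" for a
    using that by (simp add: \<psi>_def D \<phi>'(2))
  have pos: "0 \<le> \<psi> (star_mat r * r)" if r: "r \<in> carrier_mat 1 k" for r
  proof -
    have "r * d \<in> carrier_mat 1 l" using r d by simp
    then have "star_mat (r * d) * (r * d) \<in> sum_squares l" by (rule row_product_sum_squares)
    moreover have "conj_map d (star_mat r * r) = star_mat (r * d) * (r * d)" using D(5)[OF r r] .
    moreover have "conj_map d (star_mat r * r) \<in> ?V" using r by simp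
    ultimately show ?thesis using \<phi>'(3) by (simp add: \<psi>_def)
  qed
  obtain H :: "'h hilbert" and \<pi> and \<xi> where H: "unitary_representation H \<pi>"
    "\<xi> \<in> unitary_rep.hpow H k" "\<And>a. a \<in> carrier_mat k k \<Longrightarrow> unitary_rep.quad H \<pi> k \<xi> a = \<psi> a"
    using gns[OF ctb cont lin herm pos] by blast
  interpret V: unitary_rep H \<pi> using H(1) by unfold_locales
  have rm_dn: "V.rm dn \<xi> \<in> V.hpow m" by (rule V.rm_closed[OF dn H(2)])
  have "star_mat dn * dn \<in> carrier_mat k k" using dn by (intro mult_carrier_mat[of _ _ m]) simp_all
  then have "Re (V.dot m (V.rm dn \<xi>) (V.rm dn \<xi>)) = \<psi> (star_mat dn * dn)"
    using V.quad_star_mult[OF dn dn H(2)] H(3) by simp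
  also have "\<dots> = \<psi> (0\<^sub>m k k)"
  proof -
    have "conj_map d (0\<^sub>m k k) = 0\<^sub>m l l" using d by (simp add: conj_map_def)
    then show ?thesis using zero by (simp add: \<psi>_def)
  qed
  also have "\<dots> = 0" by (rule linear_functional_zero[OF lin])
  finally have "V.rm dn \<xi> i = \<zero>\<^bsub>H\<^esub>" if "i < m" for i
    using V.dot_self_eq_0[OF rm_dn _ that] by blast
  then obtain \<eta> where \<eta>: "\<eta> \<in> V.hpow l" "V.rm d \<eta> = \<xi>" using vanish[OF H(1,2)] by blast
  have "V.quad l \<eta> (conj_map d a) = \<phi> (conj_map d a)" if a: "a \<in> carrier_mat k k" for a
  proof -
    have ad: "a * d \<in> carrier_mat k l" using a d by simp
    have "conj_map d a = star_mat d * (a * d)"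
      unfolding conj_map_def by (rule assoc_mult_mat[OF star_mat_carrier[OF d] a d])
    then have "V.quad l \<eta> (conj_map d a) = Re (V.dot k (V.rm a \<xi>) \<xi>)"
      using V.quad_star_mult[OF d ad \<eta>(1)] V.rm_mult[OF a d \<eta>(1)] \<eta>(2) by simp
    then show ?thesis using H(3)[OF a] by (simp add: V.quad_def \<psi>_def)
  qed
  then show ?thesis using V.quad_positive_hermitian[OF \<eta>(1)] by blast
qed

section \<open>Cauchy-Schwarz and Riesz representation for rows\<close>

lemma smult_mult_mat:
  fixes A :: "'a::semiring_0 mat"
  shows "A \<in> carrier_mat m n \<Longrightarrow> B \<in> carrier_mat n k \<Longrightarrow> x \<cdot>\<^sub>m A * B = x \<cdot>\<^sub>m (A * B)"
  by (intro eq_matI) (auto simp: scalar_prod_def sum_distrib_left mult.assoc)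

text \<open>Differences are written in this form because \<open>linear_functional\<close> speaks of
  sums and real multiples.\<close>

lemma add_scaleR_minus_one:
  fixes a :: "'g::group_add group_algebra mat"
  assumes "a \<in> carrier_mat m n"
  shows "a + scaleR_mat (- 1) a = 0\<^sub>m m n"
proof -
  have "Poly_Mapping.single 0 (- 1) = (- 1 :: 'g group_algebra)"
    by (simp add: single_uminus)
  then show ?thesis using assms by (intro eq_matI) (auto simp: scaleR_mat_def)
qed

lemma positive_hermitian_functionalD:
  assumes "positive_hermitian_functional k V \<phi>"
  shows "linear_functional V \<phi>" "a \<in> V \<Longrightarrow> \<phi> (star_mat a) = \<phi> a" "a \<in> V \<Longrightarrow> a \<in> sum_squares k \<Longrightarrow> 0 \<le> \<phi> a"
  using assms by (auto simp: positive_hermitian_functional_def hermitian_functional_def positive_functional_def)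

text \<open>The form \<open>\<psi> (star_mat w * v)\<close> on rows is symmetric because
  \<open>\<psi>\<close> is hermitian, and positive because \<open>star_mat v * v\<close> is a sum of
  squares.\<close>

lemma row_Cauchy_Schwarz:
  assumes \<psi>: "positive_hermitian_functional k (carrier_mat k k) \<psi>"
    and r: "r \<in> carrier_mat 1 k" and s: "s \<in> carrier_mat 1 k"
  shows "(\<psi> (star_mat s * r))\<^sup>2 \<le> \<psi> (star_mat s * s) * \<psi> (star_mat r * r)"
proof (rule quadratic_nonneg)
  note lin = positive_hermitian_functionalD(1)[OF \<psi>]
  have pos: "0 \<le> \<psi> (star_mat v * v)" if v: "v \<in> carrier_mat 1 k" for v
    using positive_hermitian_functionalD(3)[OF \<psi> row_product_carrier[OF v v] row_product_sum_squares[OF v]] .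
  show "0 \<le> \<psi> (star_mat r * r)" by (rule pos[OF r])
  fix t :: real
  let ?b = "\<lambda>v w. \<psi> (star_mat w * v)"
  have sym: "?b v w = ?b w v" if v: "v \<in> carrier_mat 1 k" and w: "w \<in> carrier_mat 1 k" for v w
    using positive_hermitian_functionalD(2)[OF \<psi> row_product_carrier[OF w v]]
    unfolding star_mat_mult[OF star_mat_carrier[OF w] v] star_mat_star_mat by simp
  have add: "?b (s + scaleR_mat t r) w = ?b s w + t * ?b r w" if w: "w \<in> carrier_mat 1 k" for w
  proof -
    note w' = star_mat_carrier[OF w]
    have "star_mat w * (s + scaleR_mat t r) = star_mat w * s + scaleR_mat t (star_mat w * r)"
      using mult_add_distrib_mat[OF w' s scaleR_mat_carrier[OF r]] scaleR_mat_mult_right[OF w' r] by metis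
    then show ?thesis
      using linear_functionalD(1)[OF lin row_product_carrier[OF w s] scaleR_mat_carrier[OF row_product_carrier[OF w r]]]
        linear_functionalD(2)[OF lin row_product_carrier[OF w r]] by metis
  qed
  let ?v = "s + scaleR_mat t r"
  have v: "?v \<in> carrier_mat 1 k" using r s by (intro add_carrier_mat) simp
  have "?b ?v ?v = ?b s ?v + t * ?b r ?v" by (rule add[OF v])
  also have "\<dots> = ?b ?v s + t * ?b ?v r" using sym[OF s v] sym[OF r v] by simp
  also have "\<dots> = ?b s s + t * ?b r s + t * (?b s r + t * ?b r r)" using add[OF s] add[OF r] by simp
  finally show "0 \<le> ?b s s + 2 * t * ?b r s + t\<^sup>2 * ?b r r"
    using pos[OF v] sym[OF r s] by (simp add: algebra_simps power2_eq_square)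
qed

text \<open>Writes \<open>s\<close> as the combination of the basis rows with its entries as
  coefficients, and moves each coefficient across the star to \<open>r\<close>.\<close>

lemma linear_functional_row_product:
  assumes \<psi>: "linear_functional (carrier_mat k k) \<psi>"
    and s: "s \<in> carrier_mat 1 k" and r: "r \<in> carrier_mat 1 k"
  shows "\<psi> (star_mat s * r) = (\<Sum>j<k. \<psi> (star_mat (unit_row k j 1) * (star (s $$ (0, j)) \<cdot>\<^sub>m r)))"
proof -
  let ?F = "\<lambda>p. (star_mat s * r) $$ p"
  have row: "star_mat (unit_row k j 1) * (star (s $$ (0, j)) \<cdot>\<^sub>m r) = entries k ({j} \<times> {..<k}) ?F" if j: "j < k" for j
  proof (rule eq_matI)
    fix p q assume "p < dim_row (entries k ({j} \<times> {..<k}) ?F)" "q < dim_col (entries k ({j} \<times> {..<k}) ?F)"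
    then have pq: "p < k" "q < k" by (simp_all add: entries_def)
    have "star (s $$ (0, j)) \<cdot>\<^sub>m r \<in> carrier_mat 1 k" using r by simp
    from row_product_index[OF unit_row_carrier this pq, of j 1]
    show "(star_mat (unit_row k j 1) * (star (s $$ (0, j)) \<cdot>\<^sub>m r)) $$ (p, q) = entries k ({j} \<times> {..<k}) ?F $$ (p, q)"
      unfolding entries_def using row_product_index[OF s r pq] pq r by auto
  qed (use r in \<open>simp_all add: entries_def\<close>)
  have "star_mat s * r = entries k ({..<k} \<times> {..<k}) ?F"
    using row_product_carrier[OF s r] by (intro eq_matI) (auto simp: entries_def)
  then have "\<psi> (star_mat s * r) = (\<Sum>p\<in>{..<k} \<times> {..<k}. \<psi> (entries k {p} ?F))"
    using linear_functional_entries[OF \<psi>, of "{..<k} \<times> {..<k}" ?F] by (metis finite_cartesian_product finite_lessThan)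
  also have "\<dots> = (\<Sum>j<k. \<Sum>q<k. \<psi> (entries k {(j, q)} ?F))"
    by (simp only: sum.cartesian_product split_def prod.collapse)
  also have "\<dots> = (\<Sum>j<k. \<psi> (entries k ({j} \<times> {..<k}) ?F))"
  proof (rule sum.cong[OF refl])
    fix j
    have "\<psi> (entries k ({j} \<times> {..<k}) ?F) = (\<Sum>p\<in>{j} \<times> {..<k}. \<psi> (entries k {p} ?F))"
      by (rule linear_functional_entries[OF \<psi>]) simp
    also have "\<dots> = (\<Sum>i\<in>{j}. \<Sum>q<k. \<psi> (entries k {(i, q)} ?F))"
      by (simp only: sum.cartesian_product split_def prod.collapse)
    finally show "(\<Sum>q<k. \<psi> (entries k {(j, q)} ?F)) = \<psi> (entries k ({j} \<times> {..<k}) ?F)" by simp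
  qed
  also have "\<dots> = (\<Sum>j<k. \<psi> (star_mat (unit_row k j 1) * (star (s $$ (0, j)) \<cdot>\<^sub>m r)))"
    by (intro sum.cong refl) (metis row lessThan_iff)
  finally show ?thesis .
qed

context unitary_rep
begin

lemma ra_single_0: "x \<in> carrier H \<Longrightarrow> ra (Poly_Mapping.single 0 t) x = complex_of_real t \<odot>\<^bsub>H\<^esub> x"
  by (intro vec_eqI) (simp_all add: hinner_ra_single hinner_smult pi_0)

lemma rm_row_closed:
  assumes "\<xi> \<in> hpow k" "c \<in> carrier_mat 1 k"
  shows "rm c \<xi> 0 \<in> carrier H"
  by (rule hpowD[OF rm_closed[OF assms(2,1)]]) simp

lemma rm_row_add:
  assumes \<xi>: "\<xi> \<in> hpow k" and c: "c \<in> carrier_mat 1 k" and c': "c' \<in> carrier_mat 1 k"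
  shows "rm (c + c') \<xi> 0 = rm c \<xi> 0 \<oplus>\<^bsub>H\<^esub> rm c' \<xi> 0"
proof (rule vec_eqI)
  have cc: "c + c' \<in> carrier_mat 1 k" using c c' by simp
  note cl = rm_row_closed[OF \<xi> c] rm_row_closed[OF \<xi> c'] rm_row_closed[OF \<xi> cc]
  show "rm (c + c') \<xi> 0 \<in> carrier H" "rm c \<xi> 0 \<oplus>\<^bsub>H\<^esub> rm c' \<xi> 0 \<in> carrier H" using cl by simp_all
  fix z assume z: "z \<in> carrier H"
  have "hinner H (rm (c + c') \<xi> 0) z = (\<Sum>j<k. hinner H (ra ((c + c') $$ (0, j)) (\<xi> j)) z)"
    by (rule hinner_rm[OF cc \<xi> _ z]) simp
  also have "\<dots> = (\<Sum>j<k. hinner H (ra (c $$ (0, j)) (\<xi> j)) z + hinner H (ra (c' $$ (0, j)) (\<xi> j)) z)"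
    using c c' \<xi> z by (intro sum.cong refl) (simp add: hinner_ra_plus)
  also have "\<dots> = hinner H (rm c \<xi> 0) z + hinner H (rm c' \<xi> 0) z"
    unfolding sum.distrib using hinner_rm[OF c \<xi> _ z, of 0] hinner_rm[OF c' \<xi> _ z, of 0] by simp
  also have "\<dots> = hinner H (rm c \<xi> 0 \<oplus>\<^bsub>H\<^esub> rm c' \<xi> 0) z" using cl z by (simp add: hinner_add)
  finally show "hinner H (rm (c + c') \<xi> 0) z = hinner H (rm c \<xi> 0 \<oplus>\<^bsub>H\<^esub> rm c' \<xi> 0) z" .
qed

text \<open>The scalar acts as a 1 by 1 matrix. Consequently the vectors \<open>rm c \<xi> 0\<close>
  form a set stable under the group algebra.\<close>

lemma rm_row_smult:
  assumes \<xi>: "\<xi> \<in> hpow k" and c: "c \<in> carrier_mat 1 k"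
  shows "rm (x \<cdot>\<^sub>m c) \<xi> 0 = ra x (rm c \<xi> 0)"
proof -
  have "x \<cdot>\<^sub>m c = unit_row 1 0 x * c"
    using c by (intro eq_matI) (auto simp: scalar_prod_def unit_row_def)
  then show ?thesis
    using rm_mult[OF unit_row_carrier c \<xi>, of 0 x] rm_unit_row[OF rm_closed[OF c \<xi>], of 0 x] by simp
qed

lemma rm_row_scaleR:
  assumes \<xi>: "\<xi> \<in> hpow k" and c: "c \<in> carrier_mat 1 k"
  shows "rm (scaleR_mat t c) \<xi> 0 = complex_of_real t \<odot>\<^bsub>H\<^esub> rm c \<xi> 0"
  unfolding scaleR_mat_def rm_row_smult[OF \<xi> c] by (rule ra_single_0[OF rm_row_closed[OF \<xi> c]])

lemma rm_unit_row_one: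
  assumes "\<xi> \<in> hpow k" "j < k"
  shows "rm (unit_row k j 1) \<xi> 0 = \<xi> j"
proof -
  have "ra 1 (\<xi> j) = \<xi> j"
    using ra_single_0[of "\<xi> j" 1] assms by (intro vec_eqI) (simp_all add: hinner_smult)
  then show ?thesis using rm_unit_row[OF assms] by simp
qed

text \<open>By the bound, \<open>N\<close> vanishes wherever \<open>rm c \<xi> 0\<close> does. It
  therefore descends to a bounded functional on these vectors, to which Riesz representation
  applies.\<close>

lemma riesz_rows:
  assumes \<xi>: "\<xi> \<in> hpow k"
    and N: "\<And>c c'. c \<in> carrier_mat 1 k \<Longrightarrow> c' \<in> carrier_mat 1 k \<Longrightarrow> N (c + c') = N c + N c'"
      "\<And>t c. c \<in> carrier_mat 1 k \<Longrightarrow> N (scaleR_mat t c) = t * N c"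
    and bound: "\<And>c. c \<in> carrier_mat 1 k \<Longrightarrow> (N c)\<^sup>2 \<le> C * ip (rm c \<xi> 0) (rm c \<xi> 0)"
  shows "\<exists>\<eta>\<in>carrier H. (\<forall>c\<in>carrier_mat 1 k. ip \<eta> (rm c \<xi> 0) = N c) \<and>
    (\<forall>u\<in>carrier H. (\<forall>c\<in>carrier_mat 1 k. ip (rm c \<xi> 0) u = 0) \<longrightarrow> ip \<eta> u = 0)"
proof -
  note cl = rm_row_closed[OF \<xi>]
  have wd: "N c = N c'" if c: "c \<in> carrier_mat 1 k" and c': "c' \<in> carrier_mat 1 k"
    and eq: "rm c \<xi> 0 = rm c' \<xi> 0" for c c'
  proof -
    have s: "scaleR_mat (- 1) c' \<in> carrier_mat 1 k" using c' by (rule scaleR_mat_carrier)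
    have cc: "c + scaleR_mat (- 1) c' \<in> carrier_mat 1 k" using s by (rule add_carrier_mat)
    have "rm (c + scaleR_mat (- 1) c') \<xi> 0 = rm c' \<xi> 0 \<oplus>\<^bsub>H\<^esub> complex_of_real (- 1) \<odot>\<^bsub>H\<^esub> rm c' \<xi> 0"
      unfolding rm_row_add[OF \<xi> c s] rm_row_scaleR[OF \<xi> c'] eq ..
    also have "\<dots> = \<zero>\<^bsub>H\<^esub>"
      using cl[OF c'] by (intro vec_eqI) (simp_all add: hinner_add hinner_smult)
    finally have "(N (c + scaleR_mat (- 1) c'))\<^sup>2 \<le> C * ip \<zero>\<^bsub>H\<^esub> \<zero>\<^bsub>H\<^esub>" using bound[OF cc] by simp
    then have "N (c + scaleR_mat (- 1) c') = 0" by simp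
    then show ?thesis using N(1)[OF c s] N(2)[OF c', of "- 1"] by simp
  qed
  define R where "R = (\<lambda>c. rm c \<xi> 0) ` carrier_mat 1 k"
  define L where "L x = N (SOME c. c \<in> carrier_mat 1 k \<and> rm c \<xi> 0 = x)" for x
  have L: "L (rm c \<xi> 0) = N c" if c: "c \<in> carrier_mat 1 k" for c
  proof -
    have "(SOME c'. c' \<in> carrier_mat 1 k \<and> rm c' \<xi> 0 = rm c \<xi> 0) \<in> carrier_mat 1 k
      \<and> rm (SOME c'. c' \<in> carrier_mat 1 k \<and> rm c' \<xi> 0 = rm c \<xi> 0) \<xi> 0 = rm c \<xi> 0"
      by (rule someI[of _ c]) (use c in blast)
    then show ?thesis unfolding L_def using wd c by blast
  qed
  obtain \<eta> where \<eta>: "\<eta> \<in> carrier H" "\<And>x. x \<in> R \<Longrightarrow> ip \<eta> x = L x"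
    "\<And>u. u \<in> carrier H \<Longrightarrow> (\<And>x. x \<in> R \<Longrightarrow> ip x u = 0) \<Longrightarrow> ip \<eta> u = 0"
  proof (rule riesz_representation[of R L C])
    show "R \<subseteq> carrier H" unfolding R_def using cl by blast
    have z: "0\<^sub>m 1 k \<in> carrier_mat 1 k" by simp
    have "\<zero>\<^bsub>H\<^esub> = rm (scaleR_mat 0 (0\<^sub>m 1 k)) \<xi> 0"
      unfolding rm_row_scaleR[OF \<xi> z] using cl[OF z] by (intro vec_eqI) (simp_all add: hinner_smult)
    then show "\<zero>\<^bsub>H\<^esub> \<in> R" unfolding R_def using scaleR_mat_carrier[OF z, of 0] by blast
    fix x y assume "x \<in> R" "y \<in> R"
    then obtain c c' where c: "c \<in> carrier_mat 1 k" "c' \<in> carrier_mat 1 k"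
      and x: "x = rm c \<xi> 0" and y: "y = rm c' \<xi> 0"
      unfolding R_def by blast
    have cc: "c + c' \<in> carrier_mat 1 k" using c(2) by (rule add_carrier_mat)
    show "x \<oplus>\<^bsub>H\<^esub> y \<in> R" unfolding x y rm_row_add[OF \<xi> c, symmetric] R_def using cc by blast
    show "L (x \<oplus>\<^bsub>H\<^esub> y) = L x + L y"
      unfolding x y rm_row_add[OF \<xi> c, symmetric] L[OF cc] L[OF c(1)] L[OF c(2)] by (rule N(1)[OF c])
  next
    fix t x assume "x \<in> R"
    then obtain c where c: "c \<in> carrier_mat 1 k" and x: "x = rm c \<xi> 0" unfolding R_def by blast
    have tc: "scaleR_mat t c \<in> carrier_mat 1 k" using c by (rule scaleR_mat_carrier)
    show "complex_of_real t \<odot>\<^bsub>H\<^esub> x \<in> R"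
      unfolding x rm_row_scaleR[OF \<xi> c, symmetric] R_def using tc by blast
    show "L (complex_of_real t \<odot>\<^bsub>H\<^esub> x) = t * L x"
      unfolding x rm_row_scaleR[OF \<xi> c, symmetric] L[OF tc] L[OF c] by (rule N(2)[OF c])
  next
    fix x assume "x \<in> R"
    then show "(L x)\<^sup>2 \<le> C * ip x x" unfolding R_def using L bound by auto
  qed (rule that; blast)
  show ?thesis
  proof (intro bexI conjI ballI impI)
    show "ip \<eta> (rm c \<xi> 0) = N c" if "c \<in> carrier_mat 1 k" for c
      using \<eta>(2)[of "rm c \<xi> 0"] L[OF that] that unfolding R_def by simp
    show "ip \<eta> u = 0" if "u \<in> carrier H" "\<forall>c\<in>carrier_mat 1 k. ip (rm c \<xi> 0) u = 0" for u
      using \<eta>(3)[OF that(1)] that(2) unfolding R_def by blast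
  qed (rule \<eta>(1))
qed

text \<open>Positivity concerns every sum of squares in the image, whatever its given preimage. The
  factorization \<open>b = c * d\<close> supplies a preimage that is a sum of matrices
  \<open>star_mat c * c\<close>, on which \<open>quad\<close> is a sum of squared norms.\<close>

lemma cocycle_functional:
  assumes dn: "dn \<in> carrier_mat m k" and d: "d \<in> carrier_mat k l"
    and SC: "split_conj_space dn = {a \<in> carrier_mat k k. conj_map d a = 0\<^sub>m l l}"
    and factor: "\<And>a as b. a \<in> carrier_mat k k \<Longrightarrow> set as \<subseteq> carrier_mat l l
      \<Longrightarrow> conj_map d a = foldr (+) (map (\<lambda>a. star_mat a * a) as) (0\<^sub>m l l) \<Longrightarrow> b \<in> set as
      \<Longrightarrow> \<exists>c\<in>carrier_mat l k. b = c * d"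
    and \<xi>: "\<xi> \<in> hpow k" "\<And>i. i < m \<Longrightarrow> rm dn \<xi> i = \<zero>\<^bsub>H\<^esub>"
  shows "\<exists>\<phi>. positive_hermitian_functional l (conj_map d ` carrier_mat k k) \<phi> \<and>
    (\<forall>a\<in>carrier_mat k k. \<phi> (conj_map d a) = quad k \<xi> a)"
proof -
  note D = conj_map_simps[OF d]
  have dot0: "Re (dot m (rm x \<xi>) (rm dn \<xi>)) = 0" "Re (dot m (rm dn \<xi>) (rm x \<xi>)) = 0"
    if "x \<in> carrier_mat m k" for x
    using \<xi>(2) hpowD[OF rm_closed[OF that \<xi>(1)]] by (simp_all add: dot_def)
  \<comment> \<open>A term \<open>star_mat dn * x\<close> pairs \<open>rm x \<xi>\<close> with
    \<open>rm dn \<xi>\<close>, and a term \<open>y * dn\<close> pairs \<open>rm dn \<xi>\<close>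
    with \<open>rm (star_mat y) \<xi>\<close>; both are 0 for a cocycle.\<close>
  have ker: "quad k \<xi> a = 0" if "a \<in> carrier_mat k k" "conj_map d a = 0\<^sub>m l l" for a
  proof -
    have "a \<in> split_conj_space dn" using that SC by blast
    then obtain x y where a: "a = star_mat dn * x + y * dn" and x: "x \<in> carrier_mat m k" and y: "y \<in> carrier_mat k m"
      using dn unfolding split_conj_space_def by auto
    have "star_mat dn * x \<in> carrier_mat k k" "y * dn \<in> carrier_mat k k"
      using mult_carrier_mat[OF star_mat_carrier[OF dn] x] mult_carrier_mat[OF y dn] .
    then have "quad k \<xi> a = quad k \<xi> (star_mat dn * x) + quad k \<xi> (y * dn)"
      unfolding a by (rule quad_add[OF _ _ \<xi>(1)])
    moreover have "quad k \<xi> (star_mat dn * x) = 0"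
      unfolding quad_star_mult[OF dn x \<xi>(1)] by (rule dot0(1)[OF x])
    moreover have "quad k \<xi> (y * dn) = 0"
      using quad_star_mult[OF star_mat_carrier[OF y] dn \<xi>(1)] dot0(2)[OF star_mat_carrier[OF y]]
      unfolding star_mat_star_mat by (rule trans)
    ultimately show ?thesis by simp
  qed
  have wd: "quad k \<xi> a = quad k \<xi> a'"
    if a: "a \<in> carrier_mat k k" and a': "a' \<in> carrier_mat k k" and eq: "conj_map d a = conj_map d a'" for a a'
  proof -
    note s = scaleR_mat_carrier[OF a', of "- 1"]
    have "conj_map d (a + scaleR_mat (- 1) a') = 0\<^sub>m l l"
      unfolding D(2)[OF a s] D(3)[OF a'] eq by (rule add_scaleR_minus_one[OF D(1)[OF a']])
    then have "quad k \<xi> (a + scaleR_mat (- 1) a') = 0" using s by (intro ker) simp_all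
    then show ?thesis using quad_add[OF a s \<xi>(1)] quad_scaleR[OF a' \<xi>(1), of "- 1"] by simp
  qed
  define \<phi> where "\<phi> b = quad k \<xi> (SOME a. a \<in> carrier_mat k k \<and> conj_map d a = b)" for b
  have \<phi>: "\<phi> (conj_map d a) = quad k \<xi> a" if a: "a \<in> carrier_mat k k" for a
  proof -
    have "(SOME a'. a' \<in> carrier_mat k k \<and> conj_map d a' = conj_map d a) \<in> carrier_mat k k
      \<and> conj_map d (SOME a'. a' \<in> carrier_mat k k \<and> conj_map d a' = conj_map d a) = conj_map d a"
      by (rule someI[of _ a]) (use a in blast)
    then show ?thesis unfolding \<phi>_def using wd a by blast
  qed
  have squares: "\<exists>a\<in>carrier_mat k k. conj_map d a = foldr (+) (map (\<lambda>a. star_mat a * a) as) (0\<^sub>m l l) \<and> 0 \<le> quad k \<xi> a"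
    if "\<forall>b\<in>set as. \<exists>c\<in>carrier_mat l k. b = c * d" for as
    using that
  proof (induction as)
    case Nil
    have "conj_map d (0\<^sub>m k k) = 0\<^sub>m l l" using d by (simp add: conj_map_def)
    then show ?case using quad_0[OF \<xi>(1)] by (intro bexI[of _ "0\<^sub>m k k"]) simp_all
  next
    case (Cons b as)
    then obtain a where a: "a \<in> carrier_mat k k"
      "conj_map d a = foldr (+) (map (\<lambda>a. star_mat a * a) as) (0\<^sub>m l l)" "0 \<le> quad k \<xi> a" by auto
    obtain c where c: "c \<in> carrier_mat l k" "b = c * d" using Cons.prems by auto
    have cc: "star_mat c * c \<in> carrier_mat k k" using mult_carrier_mat[OF star_mat_carrier[OF c(1)] c(1)] .
    have "conj_map d (star_mat c * c + a) = foldr (+) (map (\<lambda>a. star_mat a * a) (b # as)) (0\<^sub>m l l)"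
      unfolding D(2)[OF cc a(1)] D(5)[OF c(1) c(1)] a(2) c(2) by simp
    moreover have "0 \<le> quad k \<xi> (star_mat c * c + a)"
      unfolding quad_add[OF cc a(1) \<xi>(1)] quad_star_mult[OF c(1) c(1) \<xi>(1)]
      using a(3) dot_self[OF rm_closed[OF c(1) \<xi>(1)]] by simp
    moreover have "star_mat c * c + a \<in> carrier_mat k k" using a(1) by (rule add_carrier_mat)
    ultimately show ?case by blast
  qed
  let ?V = "conj_map d ` carrier_mat k k"
  have "linear_functional ?V \<phi>"
    unfolding linear_functional_def
  proof (intro conjI ballI allI)
    fix x y assume "x \<in> ?V" "y \<in> ?V"
    then obtain a b where a: "a \<in> carrier_mat k k" "x = conj_map d a" and b: "b \<in> carrier_mat k k" "y = conj_map d b"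
      by blast
    show "\<phi> (x + y) = \<phi> x + \<phi> y"
      unfolding a(2) b(2) D(2)[OF a(1) b(1), symmetric] \<phi>[OF a(1)] \<phi>[OF b(1)] \<phi>[OF add_carrier_mat[OF b(1)]]
      by (rule quad_add[OF a(1) b(1) \<xi>(1)])
  next
    fix r x assume "x \<in> ?V"
    then obtain a where a: "a \<in> carrier_mat k k" "x = conj_map d a" by blast
    show "\<phi> (scaleR_mat r x) = r * \<phi> x"
      unfolding a(2) D(3)[OF a(1), symmetric] \<phi>[OF a(1)] \<phi>[OF scaleR_mat_carrier[OF a(1)]]
      by (rule quad_scaleR[OF a(1) \<xi>(1)])
  qed
  moreover have "hermitian_functional ?V \<phi>"
    unfolding hermitian_functional_def
  proof
    fix x assume "x \<in> ?V"
    then obtain a where a: "a \<in> carrier_mat k k" "x = conj_map d a" by blast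
    show "\<phi> (star_mat x) = \<phi> x"
      unfolding a(2) D(4)[OF a(1), symmetric] \<phi>[OF a(1)] \<phi>[OF star_mat_carrier[OF a(1)]]
      by (rule quad_star[OF a(1) \<xi>(1)])
  qed
  moreover have "positive_functional l ?V \<phi>"
    unfolding positive_functional_def
  proof
    fix x assume "x \<in> ?V \<inter> sum_squares l"
    then obtain a as where a: "a \<in> carrier_mat k k" "x = conj_map d a" and as: "set as \<subseteq> carrier_mat l l"
      "x = foldr (+) (map (\<lambda>a. star_mat a * a) as) (0\<^sub>m l l)"
      unfolding sum_squares_def by blast
    have "\<forall>b\<in>set as. \<exists>c\<in>carrier_mat l k. b = c * d"
      using factor[OF a(1) as(1)] a(2) as(2) by blast
    \<comment> \<open>The preimage \<open>a'\<close> may differ from \<open>a\<close>, but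
      \<open>\<phi>\<close> depends only on the common image.\<close>
    then obtain a' where "a' \<in> carrier_mat k k" "conj_map d a' = x" "0 \<le> quad k \<xi> a'"
      using squares as(2) by blast
    then show "0 \<le> \<phi> x" using \<phi> by auto
  qed
  ultimately show ?thesis using \<phi> unfolding positive_hermitian_functional_def by blast
qed

text \<open>In the GNS space of \<open>\<psi>\<close> the rows \<open>c * d\<close> form a subspace
  isometric to the vectors \<open>rm c \<xi> 0\<close>, and \<open>\<eta> j\<close> is the
  projection of the \<open>j\<close>-th basis row to its closure. Combining the basis rows with the
  entries of row \<open>i\<close> of \<open>d\<close> gives that row of \<open>d\<close>, which lies
  in the subspace already and corresponds to \<open>\<xi> i\<close>. Riesz representation in
  \<open>H\<close> replaces the space itself.\<close>

lemma coboundary_of_extension: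
  assumes d: "d \<in> carrier_mat k l" and \<xi>: "\<xi> \<in> hpow k"
    and \<psi>: "positive_hermitian_functional l (carrier_mat l l) \<psi>"
    and ext: "\<And>a. a \<in> carrier_mat k k \<Longrightarrow> \<psi> (conj_map d a) = quad k \<xi> a"
  shows "\<exists>\<eta>\<in>hpow l. rm d \<eta> = \<xi>"
proof -
  note lin = positive_hermitian_functionalD(1)[OF \<psi>]
  define N where "N j c = \<psi> (star_mat (unit_row l j 1) * (c * d))" for j c
  have codiff: "c * d \<in> carrier_mat 1 l" if "c \<in> carrier_mat 1 k" for c
    using that d by (rule mult_carrier_mat)
  have form: "\<psi> (star_mat (c * d) * (c' * d)) = ip (rm c' \<xi> 0) (rm c \<xi> 0)"
    if c: "c \<in> carrier_mat 1 k" and c': "c' \<in> carrier_mat 1 k" for c c'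
    using ext[OF row_product_carrier[OF c c']] conj_map_simps(5)[OF d c c'] quad_star_mult[OF c c' \<xi>]
    by (simp add: dot_def)
  have "\<exists>\<eta>\<in>carrier H. (\<forall>c\<in>carrier_mat 1 k. ip \<eta> (rm c \<xi> 0) = N j c) \<and>
    (\<forall>u\<in>carrier H. (\<forall>c\<in>carrier_mat 1 k. ip (rm c \<xi> 0) u = 0) \<longrightarrow> ip \<eta> u = 0)" for j
  proof (rule riesz_rows[OF \<xi>])
    fix c :: "'g group_algebra mat"
    have e: "(unit_row l j 1 :: 'g group_algebra mat) \<in> carrier_mat 1 l" by simp
    note e' = star_mat_carrier[OF e]
    assume c: "c \<in> carrier_mat 1 k"
    note ec = row_product_carrier[OF e codiff[OF c]]
    show "N j (scaleR_mat t c) = t * N j c" for t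
      unfolding N_def scaleR_mat_mult_left[OF c d, symmetric] scaleR_mat_mult_right[OF e' codiff[OF c], symmetric]
      by (rule linear_functionalD(2)[OF lin ec])
    show "(N j c)\<^sup>2 \<le> \<psi> (star_mat (unit_row l j 1) * unit_row l j 1) * ip (rm c \<xi> 0) (rm c \<xi> 0)"
      using row_Cauchy_Schwarz[OF \<psi> codiff[OF c] e] unfolding N_def form[OF c c] .
    fix c' :: "'g group_algebra mat" assume c': "c' \<in> carrier_mat 1 k"
    show "N j (c + c') = N j c + N j c'"
      unfolding N_def add_mult_distrib_mat[OF c c' d] mult_add_distrib_mat[OF e' codiff[OF c] codiff[OF c']]
      by (rule linear_functionalD(1)[OF lin ec row_product_carrier[OF e codiff[OF c']]])
  qed
  then have "\<forall>j. \<exists>\<eta>. \<eta> \<in> carrier H \<and> (\<forall>c\<in>carrier_mat 1 k. ip \<eta> (rm c \<xi> 0) = N j c) \<and>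
    (\<forall>u\<in>carrier H. (\<forall>c\<in>carrier_mat 1 k. ip (rm c \<xi> 0) u = 0) \<longrightarrow> ip \<eta> u = 0)"
    unfolding Bex_def by (rule allI)
  from choice[OF this] obtain \<eta> where *: "\<forall>j. \<eta> j \<in> carrier H \<and> (\<forall>c\<in>carrier_mat 1 k. ip (\<eta> j) (rm c \<xi> 0) = N j c) \<and>
    (\<forall>u\<in>carrier H. (\<forall>c\<in>carrier_mat 1 k. ip (rm c \<xi> 0) u = 0) \<longrightarrow> ip (\<eta> j) u = 0)"
    by (rule exE)
  have \<eta>: "\<eta> j \<in> carrier H" "c \<in> carrier_mat 1 k \<Longrightarrow> ip (\<eta> j) (rm c \<xi> 0) = N j c"
    "u \<in> carrier H \<Longrightarrow> (\<And>c. c \<in> carrier_mat 1 k \<Longrightarrow> ip (rm c \<xi> 0) u = 0) \<Longrightarrow> ip (\<eta> j) u = 0" for j c u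
    using *[rule_format, of j] by (blast, blast, blast)
  define \<zeta> where "\<zeta> = (\<lambda>j\<in>{..<l}. \<eta> j)"
  have \<zeta>: "\<zeta> \<in> hpow l" using \<eta>(1) by (auto simp: \<zeta>_def hpow_def)
  have "rm d \<zeta> i = \<xi> i" if i: "i < k" for i
  proof -
    let ?e = "unit_row k i 1 :: 'g group_algebra mat"
    have e\<xi>: "rm ?e \<xi> 0 = \<xi> i" by (rule rm_unit_row_one[OF \<xi> i])
    have cl: "rm d \<zeta> i \<in> carrier H" "\<xi> i \<in> carrier H"
      using hpowD[OF rm_closed[OF d \<zeta>] i] hpowD[OF \<xi> i] by blast+
    have expand: "ip (rm d \<zeta> i) z = (\<Sum>j<l. ip (\<eta> j) (ra (star (d $$ (i, j))) z))" if z: "z \<in> carrier H" for z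
    proof -
      have "hinner H (rm d \<zeta> i) z = (\<Sum>j<l. hinner H (ra (d $$ (i, j)) (\<zeta> j)) z)"
        by (rule hinner_rm[OF d \<zeta> i z])
      also have "\<dots> = (\<Sum>j<l. hinner H (\<eta> j) (ra (star (d $$ (i, j))) z))"
        using \<eta>(1) z by (intro sum.cong refl) (simp add: \<zeta>_def hinner_ra_adjoint)
      finally show ?thesis by simp
    qed
    \<comment> \<open>Both sides are \<open>\<psi> (star_mat (?e * d) * (c * d))\<close>: on the
      left the entries of \<open>d\<close> assemble the functionals \<open>N j\<close>, on the right
      this is \<open>form\<close>.\<close>
    have proj: "ip (rm d \<zeta> i) (rm c \<xi> 0) = ip (\<xi> i) (rm c \<xi> 0)" if c: "c \<in> carrier_mat 1 k" for c
    proof -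
      have ed: "(?e * d) $$ (0, j) = d $$ (i, j)" if j: "j < l" for j
      proof -
        have "(?e * d) $$ (0, j) = (\<Sum>p = 0..<k. ?e $$ (0, p) * d $$ (p, j))"
          using d j by (simp add: scalar_prod_def)
        also have "\<dots> = (\<Sum>p = 0..<k. if p = i then d $$ (i, j) else 0)"
          by (intro sum.cong refl) simp
        finally show ?thesis using i by simp
      qed
      have "ip (rm d \<zeta> i) (rm c \<xi> 0) = (\<Sum>j<l. N j (star (d $$ (i, j)) \<cdot>\<^sub>m c))"
        unfolding expand[OF rm_row_closed[OF \<xi> c]] rm_row_smult[OF \<xi> c, symmetric]
        using c by (intro sum.cong refl \<eta>(2)) simp
      also have "\<dots> = (\<Sum>j<l. \<psi> (star_mat (unit_row l j 1) * (star ((?e * d) $$ (0, j)) \<cdot>\<^sub>m (c * d))))"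
        unfolding N_def using ed by (intro sum.cong refl) (simp add: smult_mult_mat[OF c d])
      also have "\<dots> = \<psi> (star_mat (?e * d) * (c * d))"
        by (rule linear_functional_row_product[OF lin codiff[OF unit_row_carrier] codiff[OF c], symmetric])
      also have "\<dots> = ip (rm c \<xi> 0) (\<xi> i)"
        unfolding form[OF unit_row_carrier c] e\<xi> ..
      finally show ?thesis using ip_commute[OF cl(2) rm_row_closed[OF \<xi> c]] by simp
    qed
    let ?u = "rm d \<zeta> i \<ominus>\<^bsub>H\<^esub> \<xi> i"
    have u: "?u \<in> carrier H" using cl by (rule M.minus_closed)
    have perp: "ip (rm c \<xi> 0) ?u = 0" if c: "c \<in> carrier_mat 1 k" for c
      using proj[OF c] ip_commute[OF rm_row_closed[OF \<xi> c]] cl rm_row_closed[OF \<xi> c] by (simp add: hinner_minus)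
    \<comment> \<open>The vector \<open>ra (star a) ?u\<close> is still orthogonal to all
      \<open>rm c \<xi> 0\<close>, as these are stable under \<open>ra a\<close>, and
      \<open>\<eta> j\<close> lies in their closure. Hence \<open>?u\<close> is orthogonal to
      \<open>rm d \<zeta> i\<close> as well as to \<open>\<xi> i\<close>, and so to itself.\<close>
    have "ip (\<eta> j) (ra (star a) ?u) = 0" for j a
    proof (rule \<eta>(3))
      show "ra (star a) ?u \<in> carrier H" using u by (rule ra_closed)
      fix c :: "'g group_algebra mat" assume c: "c \<in> carrier_mat 1 k"
      have "a \<cdot>\<^sub>m c \<in> carrier_mat 1 k" using c by simp
      from perp[OF this] show "ip (rm c \<xi> 0) (ra (star a) ?u) = 0"
        unfolding rm_row_smult[OF \<xi> c] hinner_ra_adjoint[OF rm_row_closed[OF \<xi> c] u] .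
    qed
    then have "ip (rm d \<zeta> i) ?u = 0" using expand[OF u] by simp
    moreover have "ip (\<xi> i) ?u = 0" using perp[OF unit_row_carrier, of i 1] unfolding e\<xi> .
    ultimately have "ip ?u ?u = 0"
      using hinner_minus(1)[OF cl u] by simp
    then have "?u = \<zero>\<^bsub>H\<^esub>" by (rule ip_definite[OF u])
    then have "hinner H (rm d \<zeta> i) z = hinner H (\<xi> i) z" if "z \<in> carrier H" for z
      using hinner_minus(1)[OF cl that] that by simp
    then show ?thesis using cl by (intro vec_eqI)
  qed
  then have "rm d \<zeta> = \<xi>" by (rule hpow_eqI[OF rm_closed[OF d \<zeta>] \<xi>])
  then show ?thesis using \<zeta> by blast
qed

end

section \<open>The kernel condition and the equivalence\<close>

lemma star_mult_self_in_split_conj_space: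
  assumes dn: "dn \<in> carrier_mat m k"
  shows "star_mat dn * dn \<in> split_conj_space dn"
proof -
  have "star_mat dn * dn + 0\<^sub>m k m * dn = star_mat dn * dn"
    using left_mult_zero_mat[OF dn, of k] right_add_zero_mat[OF mult_carrier_mat[OF star_mat_carrier[OF dn] dn]] by simp
  then show ?thesis
    unfolding split_conj_space_def using dn by (intro CollectI exI[of _ dn] exI[of _ "0\<^sub>m k m"]) auto
qed

text \<open>The squared norm of the vector is \<open>quad l \<eta>\<close> of the matrix in
  hypothesis \<open>0\<close>, hence vanishes.\<close>

lemma (in unitary_rep) rm_rm_eq_0:
  assumes dn: "dn \<in> carrier_mat m k" and d: "d \<in> carrier_mat k l"
    and 0: "conj_map d (star_mat dn * dn) = 0\<^sub>m l l"
    and \<eta>: "\<eta> \<in> hpow l" and i: "i < m"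
  shows "rm dn (rm d \<eta>) i = \<zero>\<^bsub>H\<^esub>"
proof -
  have dd: "dn * d \<in> carrier_mat m l" using dn d by (rule mult_carrier_mat)
  have "Re (dot m (rm (dn * d) \<eta>) (rm (dn * d) \<eta>)) = quad l \<eta> (conj_map d (star_mat dn * dn))"
    unfolding conj_map_simps(5)[OF d dn dn] by (rule quad_star_mult[OF dd dd \<eta>, symmetric])
  also have "\<dots> = 0" unfolding 0 by (rule quad_0[OF \<eta>])
  finally have "rm (dn * d) \<eta> i = \<zero>\<^bsub>H\<^esub>" by (rule dot_self_eq_0[OF rm_closed[OF dd \<eta>] _ i])
  then show ?thesis unfolding rm_mult[OF dn d \<eta>] .
qed

theorem theorem4p5:
  fixes n :: nat
    and X :: "'v set set"
    and act :: "'g::group_add \<Rightarrow> 'v \<Rightarrow> 'v"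
    and ori :: "'v set \<Rightarrow> 'v list set"
    and \<tau> :: "nat \<Rightarrow> nat \<Rightarrow> 'v set"
    and k :: "nat \<Rightarrow> nat"
    and d :: "nat \<Rightarrow> 'g group_algebra mat"
  assumes "n \<ge> 1"
    and "type_F_complex (n + 1) X act"
    and "invariant_orientation X act ori"
    and "\<And>m. m \<le> n + 1 \<Longrightarrow> orbit_representatives X act m (\<tau> m)"
    and "k = num_orbits X act"
    and "d = codifferential X act ori \<tau>"
    and "split_conj_space (d n) =
           {a \<in> carrier_mat (k n) (k n). conj_map (d (n - 1)) a = 0\<^sub>m (k (n - 1)) (k (n - 1))}"
    \<comment> \<open>Not a condition on the group: the Hilbert spaces below have their carriers in \<open>'h\<close>, an arbitrary
       type large enough to carry a nonzero Hilbert space.\<close>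
    and "(UNIV :: real set) \<lesssim> (UNIV :: 'h set)"
  shows "(\<forall>(H :: 'h hilbert) \<pi>. unitary_representation H \<pi> \<longrightarrow> trivial_group (group_cohomology d n H \<pi>))
     \<longleftrightarrow>
     (\<forall>\<phi>. positive_hermitian_functional (k (n - 1)) (conj_map (d (n - 1)) ` carrier_mat (k n) (k n)) \<phi> \<longrightarrow>
        (\<exists>\<psi>. positive_hermitian_functional (k (n - 1)) (carrier_mat (k (n - 1)) (k (n - 1))) \<psi> \<and>
             (\<forall>a \<in> conj_map (d (n - 1)) ` carrier_mat (k n) (k n). \<psi> a = \<phi> a)))"
    (is "?vanish \<longleftrightarrow> ?extend")
proof
  interpret C: finite_type_complex X act ori \<tau> "n + 1"
    by (rule finite_type_complex.intro[OF assms(2,3,4)])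
  have n: "Suc (n - 1) = n" using assms(1) by simp
  have dn: "d n \<in> carrier_mat (k (Suc n)) (k n)" and dn1: "d (n - 1) \<in> carrier_mat (k n) (k (n - 1))"
    using C.codiff_carrier[of n] C.codiff_carrier[of "n - 1"] unfolding assms(5,6) n .
  \<comment> \<open>One inclusion of the kernel condition enters through this element; the other
    makes the functional of a cocycle well defined.\<close>
  have zero: "conj_map (d (n - 1)) (star_mat (d n) * d n) = 0\<^sub>m (k (n - 1)) (k (n - 1))"
    using star_mult_self_in_split_conj_space[OF dn] unfolding assms(7) by blast
  {
    assume vanish: ?vanish
    have exact: "\<exists>\<eta>\<in>unitary_rep.hpow H (k (n - 1)). rep_mat H \<pi> (d (n - 1)) \<eta> = \<xi>"
      if rep: "unitary_representation H \<pi>" and \<xi>: "\<xi> \<in> unitary_rep.hpow H (k n)"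
        and 0: "\<And>i. i < k (Suc n) \<Longrightarrow> rep_mat H \<pi> (d n) \<xi> i = \<zero>\<^bsub>H\<^esub>" for H :: "'h hilbert" and \<pi> \<xi>
    proof -
      interpret V: unitary_rep H \<pi> using rep by unfold_locales
      have "trivial_group (group_cohomology d n H \<pi>)" using vanish rep by blast
      from V.trivial_cohomologyD[OF dn dn1 this \<xi> 0] show ?thesis by blast
    qed
    show ?extend
      using extension_of_vanishing[OF type_F_countable[OF assms(2)] assms(8) dn dn1 zero exact] by blast
  next
    assume extend: ?extend
    show ?vanish
    proof (intro allI impI)
      fix H :: "'h hilbert" and \<pi> :: "'g \<Rightarrow> 'h \<Rightarrow> 'h" assume rep: "unitary_representation H \<pi>"
      interpret V: unitary_rep H \<pi> using rep by unfold_locales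
      show "trivial_group (group_cohomology d n H \<pi>)"
      proof (rule V.trivial_cohomologyI[OF dn dn1])
        show "V.rm (d n) (V.rm (d (n - 1)) \<eta>) i = \<zero>\<^bsub>H\<^esub>" if "\<eta> \<in> V.hpow (k (n - 1))" "i < k (Suc n)" for \<eta> i
          using V.rm_rm_eq_0[OF dn dn1 zero that] .
        fix \<xi> assume \<xi>: "\<xi> \<in> V.hpow (k n)" "\<And>i. i < k (Suc n) \<Longrightarrow> V.rm (d n) \<xi> i = \<zero>\<^bsub>H\<^esub>"
        have factor: "\<exists>c\<in>carrier_mat (k (n - 1)) (k n). b = c * d (n - 1)"
          if "a \<in> carrier_mat (k n) (k n)" "set as \<subseteq> carrier_mat (k (n - 1)) (k (n - 1))"
            "conj_map (d (n - 1)) a = foldr (+) (map (\<lambda>a. star_mat a * a) as) (0\<^sub>m (k (n - 1)) (k (n - 1)))"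
            "b \<in> set as" for a as b
          using C.squares_factor[of "n - 1" a as b] that unfolding assms(5,6) n by simp
        have "\<exists>\<phi>. positive_hermitian_functional (k (n - 1)) (conj_map (d (n - 1)) ` carrier_mat (k n) (k n)) \<phi> \<and>
          (\<forall>a\<in>carrier_mat (k n) (k n). \<phi> (conj_map (d (n - 1)) a) = V.quad (k n) \<xi> a)"
          by (rule V.cocycle_functional[OF dn dn1 assms(7) _ \<xi>]) (erule (3) factor)
        then obtain \<phi> where \<phi>: "positive_hermitian_functional (k (n - 1)) (conj_map (d (n - 1)) ` carrier_mat (k n) (k n)) \<phi>"
          "\<And>a. a \<in> carrier_mat (k n) (k n) \<Longrightarrow> \<phi> (conj_map (d (n - 1)) a) = V.quad (k n) \<xi> a"
          by blast
        obtain \<psi> where \<psi>: "positive_hermitian_functional (k (n - 1)) (carrier_mat (k (n - 1)) (k (n - 1))) \<psi>"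
          "\<forall>a \<in> conj_map (d (n - 1)) ` carrier_mat (k n) (k n). \<psi> a = \<phi> a"
          using extend \<phi>(1) by blast
        have "\<psi> (conj_map (d (n - 1)) a) = V.quad (k n) \<xi> a" if "a \<in> carrier_mat (k n) (k n)" for a
          using \<psi>(2) \<phi>(2)[OF that] that by simp
        then show "\<exists>\<eta>\<in>V.hpow (k (n - 1)). V.rm (d (n - 1)) \<eta> = \<xi>"
          by (rule V.coboundary_of_extension[OF dn1 \<xi>(1) \<psi>(1)])
      qed
    qed
  }
qed

end
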